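(* Let $n\ge 5$ and $t\ge 0$ be integers and let $G$ be a cactus with $n$ vertices and exactly $t$ cycles. (i) If $t=2k$ with $k\ge 0$, then \[ W_e(G) \leq \frac{1}{6}n^3 - \frac{1}{2}n^2 + \frac{1}{3}n + kn^2 - 4k^2n + \frac{4}{3}k^3 + 8k^2 - \frac{10}{3}k, \] with equality if and only if $G \cong Sw(k,k;n-4k-1)$. (ii) If $t=2k+1$ with $k\ge 0$, then \[ W_e(G) \leq \frac{1}{6}n^3 - \frac{13}{6}n + kn^2 - 4k^2n - 4kn - \frac{4}{3}k^3 + 10k^2 + \frac{35}{3}k + 5, \] with equality if and only if $G \cong Sw(k,k+1;n-4k-3)$.
   Context: All graphs are finite, simple and undirected. A cactus is a connected graph in which any two cycles have at most one common vertex. For a connected graph $G$ and edges $f=u_1u_2$, $g=v_1v_2$, $d_G(f,g)=\min\{d_G(u_i,v_j): i,j\in\{1,2\}\}+1$ if $f\neq g$, and $d_G(f,f)=0$; the edge-Wiener index is $W_e(G)=\sum_{\{f,g\}\subseteq E(G)} d_G(f,g)$ over unordered pairs of edges. A triangle-chain of length $i\ge 1$ is a chain of $i$ triangles $T_1,\dots,T_i$ in which consecutive triangles $T_s,T_{s+1}$ share exactly one vertex, no other pairs share vertices, and each triangle has at most two such shared (cut) vertices, these being distinct; an end of it is a vertex of $T_1$ (or of $T_i$) that is not a cut vertex. A triangle-chain of length $0$ is a single vertex, which is its end. The saw graph $Sw(i,j;n-2i-2j-1)$ is obtained from a triangle-chain $H_1$ of length $i$ with an end $u$ and a vertex-disjoint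 triangle-chain $H_2$ of length $j$ with an end $v$ by joining $u$ and $v$ by a path with $n-2i-2j$ vertices (i.e. of length $n-2i-2j-1$) whose end-vertices are $u$ and $v$ and whose internal vertices are new; it has $n$ vertices and $i+j$ cycles.
   Formalization: In (ii) the term -4/3 k^3 is corrected to +4/3 k^3 (for n=7, k=1 the printed bound 181/3 is below W_e(Sw(1,2;0))=63), and equality also allows G isomorphic to the 5-cycle, which for n=5, t=1 attains the bound 15 along with Sw(0,1;2). *)

theory Defs
  imports Complex_Main
begin

type_synonym 'a ugraph = "'a set \<times> 'a set set"

abbreviation verts :: "'a ugraph \<Rightarrow> 'a set" where
  "verts G \<equiv> fst G"

abbreviation edges :: "'a ugraph \<Rightarrow> 'a set set" where
  "edges G \<equiv> snd G"

definition simple_graph :: "'a ugraph \<Rightarrow> bool" where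
  "simple_graph G \<longleftrightarrow> finite (verts G) \<and> (\<forall>e\<in>edges G. e \<subseteq> verts G \<and> card e = 2)"

definition is_walk :: "'a ugraph \<Rightarrow> 'a list \<Rightarrow> bool" where
  "is_walk G p \<longleftrightarrow>
     p \<noteq> [] \<and> set p \<subseteq> verts G \<and> successively (\<lambda>x y. {x, y} \<in> edges G) p"

definition walk_betw :: "'a ugraph \<Rightarrow> 'a \<Rightarrow> 'a list \<Rightarrow> 'a \<Rightarrow> bool" where
  "walk_betw G u p v \<longleftrightarrow> is_walk G p \<and> hd p = u \<and> last p = v"

definition connected_graph :: "'a ugraph \<Rightarrow> bool" where
  "connected_graph G \<longleftrightarrow>
     verts G \<noteq> {} \<and> (\<forall>u\<in>verts G. \<forall>v\<in>verts G. \<exists>p. walk_betw G u p v)"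

text \<open>The distance is only meaningful when the two vertices are joined by a walk; a walk with
  \<open>Suc l\<close> vertices has length \<open>l\<close>.\<close>

definition gdist :: "'a ugraph \<Rightarrow> 'a \<Rightarrow> 'a \<Rightarrow> nat" where
  "gdist G u v = (LEAST l. \<exists>p. walk_betw G u p v \<and> length p = Suc l)"

definition edge_dist :: "'a ugraph \<Rightarrow> 'a set \<Rightarrow> 'a set \<Rightarrow> nat" where
  "edge_dist G f g = (if f = g then 0 else Min {gdist G u v | u v. u \<in> f \<and> v \<in> g} + 1)"

text \<open>The sum ranges over the two-element sets \<open>P = {f, g}\<close> of edges; the term with \<open>f = g\<close> is
  zero. The description is well defined because \<open>edge_dist\<close> is symmetric, see
  \<open>edge_dist_commute\<close> and \<open>edge_wiener_double_sum\<close> below.\<close>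

definition edge_wiener :: "'a ugraph \<Rightarrow> nat" where
  "edge_wiener G =
     (\<Sum>P | P \<subseteq> edges G \<and> card P = 2. THE d. \<exists>f g. P = {f, g} \<and> d = edge_dist G f g)"

text \<open>A cycle is a subgraph. The different vertex sequences that traverse it (rotations and
  reversals) give the same subgraph, so the cardinality of \<open>cycles G\<close> is the number of
  cycles of \<open>G\<close>.\<close>

definition cycle_seq :: "'a ugraph \<Rightarrow> 'a list \<Rightarrow> bool" where
  "cycle_seq G p \<longleftrightarrow>
     is_walk G p \<and> distinct p \<and> length p \<ge> 3 \<and> {last p, hd p} \<in> edges G"

definition cycle_subgraph :: "'a list \<Rightarrow> 'a ugraph" where
  "cycle_subgraph p = (set p, {{p ! i, p ! (Suc i mod length p)} | i. i < length p})"

definition cycles :: "'a ugraph \<Rightarrow> 'a ugraph set" where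
  "cycles G = {cycle_subgraph p | p. cycle_seq G p}"

definition cactus :: "'a ugraph \<Rightarrow> bool" where
  "cactus G \<longleftrightarrow> simple_graph G \<and> connected_graph G \<and>
     (\<forall>C\<in>cycles G. \<forall>D\<in>cycles G. C \<noteq> D \<longrightarrow> card (verts C \<inter> verts D) \<le> 1)"

definition graph_iso :: "'a ugraph \<Rightarrow> 'b ugraph \<Rightarrow> bool"  (infix \<open>\<cong>\<^sub>g\<close> 50) where
  "G \<cong>\<^sub>g H \<longleftrightarrow> (\<exists>h. bij_betw h (verts G) (verts H) \<and>
     (\<forall>u\<in>verts G. \<forall>v\<in>verts G. {u, v} \<in> edges G \<longleftrightarrow> {h u, h v} \<in> edges H))"

definition graph_union :: "'a ugraph \<Rightarrow> 'a ugraph \<Rightarrow> 'a ugraph" where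
  "graph_union G H = (verts G \<union> verts H, edges G \<union> edges H)"

text \<open>The path of length \<open>l\<close> (with \<open>l + 1\<close> vertices) on the vertices \<open>a, \<dots>, a + l\<close>.\<close>

definition path_graph :: "nat \<Rightarrow> nat \<Rightarrow> nat ugraph" where
  "path_graph a l = ({a..a + l}, {{a + r, a + r + 1} | r. r < l})"

text \<open>The cycle with 5 vertices attains the bound for cacti with 5 vertices and one cycle:
  it has 5 pairs of edges at distance 1 and 5 pairs at distance 2, so its edge-Wiener index is 15,
  which is also that of \<open>Sw(0,1;2)\<close>. The equality case with an odd number of cycles therefore
  lists it as an exception; the source statement omits it.\<close>

definition cycle_graph :: "nat \<Rightarrow> nat ugraph" where
  "cycle_graph m = cycle_subgraph [0..<m]"

text \<open>The triangle-chain of length \<open>i\<close> on the vertices \<open>a, \<dots>, a + 2 * i\<close>. Its triangles are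
  \<open>{a + 2 * s, a + 2 * s + 1, a + 2 * s + 2}\<close> for \<open>s < i\<close>, its cut vertices are
  \<open>a + 2 * s\<close> for \<open>0 < s < i\<close>, and \<open>a\<close> and \<open>a + 2 * i\<close> are ends of it (one at each side). Which
  of the ends of the same triangle is used is immaterial up to isomorphism.\<close>

definition triangle_chain :: "nat \<Rightarrow> nat \<Rightarrow> nat ugraph" where
  "triangle_chain a i = ({a..a + 2 * i},
     (\<Union>s<i. {{a + 2 * s, a + 2 * s + 1}, {a + 2 * s + 1, a + 2 * s + 2}, {a + 2 * s, a + 2 * s + 2}}))"

text \<open>\<open>saw i j l\<close> is \<open>Sw(i,j;l)\<close>: a path of length \<open>l\<close> joins the end \<open>u = 2 * i\<close> of the first
  chain to the end \<open>v = 2 * i + l\<close> of the second. For \<open>l = 0\<close> the path is a single vertex and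
  \<open>u\<close> and \<open>v\<close> are identified.\<close>

definition saw :: "nat \<Rightarrow> nat \<Rightarrow> nat \<Rightarrow> nat ugraph" where
  "saw i j l =
     graph_union (triangle_chain 0 i)
       (graph_union (path_graph (2 * i) l) (triangle_chain (2 * i + l) j))"

text \<open>In the bound for \<open>2 * k + 1\<close> cycles the coefficient of \<open>k ^ 3\<close> is \<open>+ 4 / 3\<close>, the value
  for which the bound is the edge-Wiener index of \<open>Sw(k,k+1;n-4k-3)\<close>. The
  \<open>- 4 / 3\<close> of the source statement is a misprint: for \<open>n = 7\<close>, \<open>k = 1\<close> it gives \<open>181 / 3\<close>, whereas \<open>Sw(1,2;0)\<close> has
  edge-Wiener index 63.\<close>

lemma walk_betw_rev:
  assumes "walk_betw G u p v"
  shows "walk_betw G v (rev p) u"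
  using assms
  by (auto simp: walk_betw_def is_walk_def hd_rev last_rev successively_rev insert_commute
      elim: successively_mono)

lemma gdist_commute: "gdist G u v = gdist G v u"
proof -
  have "(\<exists>p. walk_betw G u p v \<and> length p = Suc l) \<longleftrightarrow>
      (\<exists>p. walk_betw G v p u \<and> length p = Suc l)" for l
    by (metis walk_betw_rev length_rev)
  then show ?thesis by (simp add: gdist_def)
qed

lemma edge_dist_commute: "edge_dist G f g = edge_dist G g f"
proof -
  have "{gdist G u v | u v. u \<in> f \<and> v \<in> g} = {gdist G u v | u v. u \<in> g \<and> v \<in> f}"
    by (metis gdist_commute)
  then show ?thesis by (auto simp: edge_dist_def)
qed

lemma edge_wiener_double_sum:
  assumes "finite (edges G)"
  shows "2 * edge_wiener G = (\<Sum>f\<in>edges G. \<Sum>g\<in>edges G. edge_dist G f g)"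
proof -
  let ?E = "edges G"
  let ?d = "\<lambda>(f, g). edge_dist G f g"
  let ?O = "{(f, g). f \<in> ?E \<and> g \<in> ?E \<and> f \<noteq> g}"
  let ?U = "{P. P \<subseteq> ?E \<and> card P = 2}"
  let ?t = "\<lambda>P. THE d. \<exists>f g. P = {f, g} \<and> d = edge_dist G f g"
  have finO: "finite ?O"
    by (rule finite_subset[of _ "?E \<times> ?E"]) (use assms in auto)
  have finU: "finite ?U"
    using assms by simp
  have fibre: "sum ?d {x \<in> ?O. (\<lambda>(f, g). {f, g}) x = P} = 2 * ?t P" if P: "P \<in> ?U" for P
  proof -
    obtain f g where fg: "P = {f, g}" "f \<noteq> g"
      using P by (auto simp: card_2_iff)
    have "{x \<in> ?O. (\<lambda>(f, g). {f, g}) x = P} = {(f, g), (g, f)}"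
      using P fg by (auto simp: doubleton_eq_iff)
    moreover have "?t P = edge_dist G f g"
    proof (rule the_equality)
      show "\<exists>f' g'. P = {f', g'} \<and> edge_dist G f g = edge_dist G f' g'"
        using fg by blast
      show "d = edge_dist G f g" if "\<exists>f' g'. P = {f', g'} \<and> d = edge_dist G f' g'" for d
        using that fg edge_dist_commute[of G f g] by (auto simp: doubleton_eq_iff)
    qed
    ultimately show ?thesis
      using fg by (simp add: edge_dist_commute[of G g f])
  qed
  have "(\<Sum>f\<in>?E. \<Sum>g\<in>?E. edge_dist G f g) = sum ?d (?E \<times> ?E)"
    by (simp add: sum.cartesian_product)
  also have "\<dots> = sum ?d ?O"
    by (rule sum.mono_neutral_right) (use assms in \<open>auto simp: edge_dist_def\<close>)
  also have "\<dots> = (\<Sum>P\<in>?U. sum ?d {x \<in> ?O. (\<lambda>(f, g). {f, g}) x = P})"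
    by (rule sum.group[symmetric]) (use finO finU in \<open>auto simp: card_2_iff\<close>)
  also have "\<dots> = (\<Sum>P\<in>?U. 2 * ?t P)"
    by (intro sum.cong refl fibre) auto
  also have "\<dots> = 2 * edge_wiener G"
    by (simp add: edge_wiener_def sum_distrib_left)
  finally show ?thesis by simp
qed

lemma verts_saw: "verts (saw i j l) = {..2 * i + 2 * j + l}"
  by (auto simp: saw_def graph_union_def triangle_chain_def path_graph_def)

lemma simple_graph_saw: "simple_graph (saw i j l)"
  by (auto simp: simple_graph_def saw_def graph_union_def triangle_chain_def path_graph_def)

end

theory Submission
  imports Defs
begin

text \<open>A cactus arises from a single vertex by gluing blocks, that is bridges and cycles, at single
  vertices. If distances of edges are measured between their nearest end vertices, then their sum
  over the pairs of edges is the sum of contributions of the blocks, where everything that hangs at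
  a vertex of a block only enters as a weight of that vertex. Peel off the blocks one by one, from
  the leaves on, and replace each by a chain of bridges and triangles with the same numbers of
  edges and cycles. Two chains at a vertex of weight \<open>a > 0\<close> may be concatenated with the weight
  moved to one of the two free ends, because the sum of the distances from that end is larger. A
  triangle is treated in the same way. A longer cycle of length \<open>c\<close> is cut into two halves, and
  averaging over the \<open>c\<close> positions of the cut shows that it contributes less than a triangle and
  \<open>c - 3\<close> bridges between the two halves, except for the pentagon without weights. What remains is
  a single chain. Exchanging an adjacent triangle and bridge moves triangles to the nearer end, so
  the optimal chain is a balanced saw.\<close>

section \<open>Values of chains\<close>

text \<open>Distinct edges are at edge distance one more than their nearest ends, and
  \<open>n\<close> and \<open>t\<close> fix the number of edges, so only sums of nearest-end
  distances have to be compared. The induction works with values of lists and never builds the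
  replaced graph: a peeled block may be exchanged for a list because everything beyond a vertex acts
  only through its number of edges. Graph realizations are carried along solely to decide equality.
  Three phenomena shape the statements. The unweighted 4-cycle beats its chain; it is excluded by
  demanding at least 5 edges in total, and this total is invariant under peeling. The unweighted
  pentagon ties with its chain without being one, but it can only survive as the whole graph,
  because any further block leaves a positive weight. Finally, joining two nonempty chains costs
  nothing when the vertex between them has weight 0, so the resulting chain need not start at the
  vertex in question; a positive outside weight restores this in all but the last step.\<close>

text \<open>A chain of blocks is encoded by a list in which \<open>True\<close> stands for a triangle and \<open>False\<close> for
  a bridge.\<close>

definition bsize :: "bool \<Rightarrow> nat" where
  "bsize s = (if s then 3 else 1)"

definition csize :: "bool list \<Rightarrow> nat" where
  "csize S = sum_list (map bsize S)"

abbreviation ntri :: "bool list \<Rightarrow> nat" where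
  "ntri S \<equiv> count_list S True"

lemma bsize_simps [simp]: "bsize True = 3" "bsize False = 1"
  by (simp_all add: bsize_def)

lemma csize_simps [simp]:
  "csize [] = 0" "csize (s # S) = bsize s + csize S" "csize (S @ S') = csize S + csize S'"
  "csize (replicate k s) = k * bsize s"
  by (simp_all add: csize_def sum_list_replicate)

lemma csize_rev [simp]: "csize (rev S) = csize S"
  by (induction S) auto

lemma bsize_pos: "0 < bsize s"
  by (simp add: bsize_def)

lemma csize_eq_0_iff [simp]: "csize S = 0 \<longleftrightarrow> S = []"
  using bsize_pos by (cases S) (auto simp: csize_def)

lemma csize_pos_iff [simp]: "0 < csize S \<longleftrightarrow> S \<noteq> []"
  using csize_eq_0_iff[of S] by linarith

lemma count_list_replicate_True [simp]:
  "ntri (replicate k True) = k" "ntri (replicate k False) = 0"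
  by (induction k) auto

lemma csize_eq_length: "csize S = length S + 2 * ntri S"
  by (induction S) (auto simp: bsize_def)

text \<open>The contributions of the blocks of a chain whose ends carry the weights \<open>p\<close> and \<open>q\<close>.\<close>

fun cval :: "nat \<Rightarrow> bool list \<Rightarrow> nat \<Rightarrow> nat" where
  "cval p [] q = 0"
| "cval p (s # S) q =
     p * (csize S + q) + (if s then p + (csize S + q) else 0) + cval (p + bsize s) S q"

text \<open>The sum of the distances from the left end, where the right end carries the weight \<open>q\<close>.\<close>

fun ctrans :: "bool list \<Rightarrow> nat \<Rightarrow> nat" where
  "ctrans [] q = 0"
| "ctrans (s # S) q = csize S + q + (if s then 1 else 0) + ctrans S q"

text \<open>The left weight enters every contribution linearly. Its coefficient is the distance sum
  from the left end, so moving a weight along a chain amounts to comparing values of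
  \<open>ctrans\<close>.\<close>

lemma cval_linear: "cval (p + r) S q = cval p S q + r * ctrans S q"
proof (induction S arbitrary: p)
  case (Cons s S)
  have "cval (p + r + bsize s) S q = cval (p + bsize s) S q + r * ctrans S q"
    using Cons[of "p + bsize s"] by (simp add: algebra_simps)
  then show ?case by (simp add: algebra_simps)
qed simp

lemma cval_append: "cval p (S @ S') q = cval p S (csize S' + q) + cval (p + csize S) S' q"
  by (induction S arbitrary: p) (auto simp: algebra_simps)

lemma cval_rev: "cval p (rev S) q = cval q S p"
proof (induction S arbitrary: p q)
  case (Cons s S)
  have "cval p (rev S @ [s]) q = cval p (rev S) (bsize s + q) + cval (p + csize S) [s] q"
    by (simp add: cval_append)
  then show ?case using Cons by (simp add: algebra_simps)
qed simp

lemma ctrans_linear: "ctrans S (q + r) = ctrans S q + length S * r"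
  by (induction S) (auto simp: algebra_simps)

lemma ctrans_append: "ctrans (S @ S') q = ctrans S (csize S' + q) + ctrans S' q"
  by (induction S) (auto simp: algebra_simps)

text \<open>In a chain of \<open>L\<close> blocks the distances of a bridge to the two ends add up
  to \<open>L - 1\<close>. The same holds for the edge of a triangle between its two attachment
  vertices, whereas the two edges at its free vertex have sum \<open>L\<close>; they account for
  \<open>2 * ntri S\<close>.\<close>

lemma ctrans_rev:
  "ctrans S 0 + ctrans (rev S) 0 + csize S = length S * csize S + 2 * ntri S"
proof (induction S)
  case (Cons s S)
  have "ctrans (rev S @ [s]) 0 = ctrans (rev S) 0 + length S * bsize s + (if s then 1 else 0)"
    using ctrans_linear[of "rev S" 0 "bsize s"] by (simp add: ctrans_append)
  then show ?case using Cons by (auto simp: algebra_simps)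
qed simp

lemma ntri_le_ctrans: "ntri S \<le> ctrans S q"
  by (induction S) auto

text \<open>Let \<open>m\<close> further edges hang at the start of \<open>S\<close>. A unit weight
  that moves from the start to the far end of \<open>S\<close> sees \<open>S\<close> from the other
  side and recedes from the \<open>m\<close> edges by \<open>length S\<close>. If \<open>S\<close>
  is the lighter part, the distance sum grows by at least \<open>csize S\<close>.\<close>

lemma ctrans_le:
  assumes "csize S \<le> m"
  shows "ctrans S 0 + csize S \<le> ctrans (rev S) 0 + length S * m"
proof (cases S)
  case (Cons s S')
  define L where "L = length S'"
  have L: "length S = Suc L" using Cons by (simp add: L_def)
  have *: "ctrans S 0 + ctrans (rev S) 0 + csize S = csize S + L * csize S + 2 * ntri S"
    using ctrans_rev[of S] L by simp
  have "L * csize S \<le> L * m" using assms by simp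
  moreover have "ntri S \<le> ctrans (rev S) 0"
    using ntri_le_ctrans[of "rev S"] by simp
  ultimately have "ctrans S 0 + csize S \<le> ctrans (rev S) 0 + (m + L * m)"
    using * assms by linarith
  then show ?thesis using L by simp
qed simp

section \<open>Merging chains at a weighted vertex\<close>

lemma cval_merge_zero:
  "cval (csize S2) S1 0 + cval (csize S1) S2 0 = cval 0 (rev S1 @ S2) 0"
  by (simp add: cval_append cval_rev)

text \<open>A weight \<open>a\<close> between two chains can be moved to one of the ends, because the sum of the
  distances is larger there.\<close>

lemma cval_merge_le:
  assumes "csize S1 \<le> csize S2"
  shows "cval (a + csize S2) S1 0 + cval (a + csize S1) S2 0 + a * csize S1
      \<le> cval a (rev S1 @ S2) 0"
proof -
  have "ctrans S1 0 + csize S1 \<le> ctrans (rev S1) 0 + length S1 * csize S2"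
    using assms by (rule ctrans_le)
  then have "ctrans S1 0 + ctrans S2 0 + csize S1 \<le> ctrans (rev S1 @ S2) 0"
    using ctrans_linear[of "rev S1" 0 "csize S2"] by (simp add: ctrans_append)
  then have "a * (ctrans S1 0 + ctrans S2 0 + csize S1) \<le> a * ctrans (rev S1 @ S2) 0"
    by simp
  moreover have "cval a (rev S1 @ S2) 0 = cval 0 (rev S1 @ S2) 0 + a * ctrans (rev S1 @ S2) 0"
    using cval_linear[of 0 a] by simp
  moreover have "cval (a + csize S2) S1 0 = cval (csize S2) S1 0 + a * ctrans S1 0"
    "cval (a + csize S1) S2 0 = cval (csize S1) S2 0 + a * ctrans S2 0"
    using cval_linear[of "csize S2" a] cval_linear[of "csize S1" a] by (simp_all add: add.commute)
  ultimately show ?thesis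
    using cval_merge_zero[of S2 S1] by (simp add: algebra_simps)
qed

text \<open>The weight goes to the end of the lighter chain, and the slack in
  \<open>cval_merge_le\<close> yields strictness. The last clauses describe the list in the cases
  where equality is possible: an empty chain leaves the other one unchanged, and for
  \<open>a = 0\<close> the result is a concatenation at the common vertex, read in one of two
  directions.\<close>

lemma cval_merge:
  obtains S where "ntri S = ntri S1 + ntri S2" "csize S = csize S1 + csize S2"
    "cval (a + csize S2) S1 0 + cval (a + csize S1) S2 0 \<le> cval a S 0"
    "0 < a \<Longrightarrow> S1 \<noteq> [] \<Longrightarrow> S2 \<noteq> [] \<Longrightarrow>
       cval (a + csize S2) S1 0 + cval (a + csize S1) S2 0 < cval a S 0"
    "S1 = [] \<Longrightarrow> S = S2" "S2 = [] \<Longrightarrow> S = S1"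
    "a = 0 \<Longrightarrow> S = rev S1 @ S2 \<or> S = rev S2 @ S1"
proof (cases "csize S1 \<le> csize S2")
  case True
  show ?thesis
  proof (rule that[of "rev S1 @ S2"])
    show "cval (a + csize S2) S1 0 + cval (a + csize S1) S2 0 \<le> cval a (rev S1 @ S2) 0"
      using cval_merge_le[OF True, of a] by linarith
    show "cval (a + csize S2) S1 0 + cval (a + csize S1) S2 0 < cval a (rev S1 @ S2) 0"
      if "0 < a" "S1 \<noteq> []"
    proof -
      have "0 < a * csize S1" using that by simp
      then show ?thesis using cval_merge_le[OF True, of a] by linarith
    qed
  qed (use True in simp_all)
next
  case False
  then have le: "csize S2 \<le> csize S1" by simp
  show ?thesis
  proof (rule that[of "rev S2 @ S1"])
    show "cval (a + csize S2) S1 0 + cval (a + csize S1) S2 0 \<le> cval a (rev S2 @ S1) 0"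
      using cval_merge_le[OF le, of a] by linarith
    show "cval (a + csize S2) S1 0 + cval (a + csize S1) S2 0 < cval a (rev S2 @ S1) 0"
      if "0 < a" "S2 \<noteq> []"
    proof -
      have "0 < a * csize S2" using that by simp
      then show ?thesis using cval_merge_le[OF le, of a] by linarith
    qed
  qed (use False in simp_all)
qed

text \<open>All chains hang at one vertex of weight \<open>a\<close> and each sees the others as
  additional weight there. In the induction step the new chain first joins the common weight, so the
  hypothesis is used with \<open>a + csize (T x)\<close>.\<close>

lemma cval_merge_family:
  assumes "finite A"
  shows "\<exists>S. ntri S = (\<Sum>y\<in>A. ntri (T y)) \<and> csize S = (\<Sum>y\<in>A. csize (T y)) \<and>
    (\<Sum>y\<in>A. cval (a + (\<Sum>z\<in>A - {y}. csize (T z))) (T y) 0) \<le> cval a S 0"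
  using assms
proof (induction A arbitrary: a)
  case empty
  then show ?case by (auto intro: exI[of _ "[]"])
next
  case (insert x A)
  let ?s = "\<lambda>B. \<Sum>z\<in>B. csize (T z)"
  obtain S1 where S1: "ntri S1 = (\<Sum>y\<in>A. ntri (T y))" "csize S1 = ?s A"
    "(\<Sum>y\<in>A. cval (a + csize (T x) + ?s (A - {y})) (T y) 0) \<le> cval (a + csize (T x)) S1 0"
    using insert.IH[of "a + csize (T x)"] by blast
  obtain S where S: "ntri S = ntri S1 + ntri (T x)" "csize S = csize S1 + csize (T x)"
    "cval (a + csize (T x)) S1 0 + cval (a + csize S1) (T x) 0 \<le> cval a S 0"
    by (rule cval_merge)
  have "?s (insert x A - {y}) = csize (T x) + ?s (A - {y})" if "y \<in> A" for y
  proof -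
    have "insert x A - {y} = insert x (A - {y})" using that insert by auto
    then show ?thesis using insert by simp
  qed
  then have "(\<Sum>y\<in>A. cval (a + ?s (insert x A - {y})) (T y) 0) =
      (\<Sum>y\<in>A. cval (a + csize (T x) + ?s (A - {y})) (T y) 0)"
    by (intro sum.cong) (auto simp: algebra_simps)
  moreover have "insert x A - {x} = A" using insert by auto
  ultimately have "(\<Sum>y\<in>insert x A. cval (a + ?s (insert x A - {y})) (T y) 0) \<le> cval a S 0"
    using insert S1 S by simp
  then show ?case using insert S1 S by (intro exI[of _ S]) simp
qed

text \<open>The weight \<open>a\<close> moves from the third corner of the triangle, which becomes a
  free vertex, to the far end of the lighter chain \<open>S1\<close>. Seen from the corner, both
  chains are one step away and the opposite edge adds 1. The slack \<open>a * length S1\<close> is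
  part of the gain from the three edges of the triangle, which recede as well.\<close>

lemma cval_triangle_le:
  assumes "csize S1 \<le> csize S2"
  shows "a * (csize S1 + csize S2) + csize S1 * csize S2 + (a + csize S1 + csize S2)
      + cval (a + 3 + csize S2) S1 0 + cval (a + 3 + csize S1) S2 0 + a * length S1
      \<le> cval a (rev S1 @ True # S2) 0"
proof -
  have lin: "cval (a + p) S q = cval p S q + a * ctrans S q" for p S q
    using cval_linear[of p a] by (simp add: add.commute)
  have "ctrans S1 0 + csize S1 \<le> ctrans (rev S1) 0 + length S1 * csize S2"
    using assms by (rule ctrans_le)
  then have "csize S1 + csize S2 + 1 + ctrans S1 0 + ctrans S2 0 + length S1
      \<le> ctrans (rev S1 @ True # S2) 0"
    using ctrans_linear[of "rev S1" 0 "3 + csize S2"]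
    by (simp add: ctrans_append algebra_simps)
  then have "a * (csize S1 + csize S2 + 1 + ctrans S1 0 + ctrans S2 0 + length S1)
      \<le> a * ctrans (rev S1 @ True # S2) 0"
    by (rule mult_le_mono2)
  moreover have "cval a (rev S1 @ True # S2) 0 =
      cval 0 (rev S1 @ True # S2) 0 + a * ctrans (rev S1 @ True # S2) 0"
    using lin[of 0] by simp
  moreover have "cval 0 (rev S1 @ True # S2) 0 = cval (3 + csize S2) S1 0 +
      csize S1 * csize S2 + (csize S1 + csize S2) + cval (3 + csize S1) S2 0"
    by (simp add: cval_append cval_rev algebra_simps)
  ultimately show ?thesis
    using lin[of "3 + csize S2" S1 0] lin[of "3 + csize S1" S2 0] by (simp add: algebra_simps)
qed

lemma cval_triangle:
  fixes a S1 S2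
  defines "W \<equiv> a * (csize S1 + csize S2) + csize S1 * csize S2 + (a + csize S1 + csize S2)
      + cval (a + 3 + csize S2) S1 0 + cval (a + 3 + csize S1) S2 0"
  obtains S where "ntri S = Suc (ntri S1 + ntri S2)" "csize S = 3 + csize S1 + csize S2"
    "W \<le> cval a S 0"
    "0 < a \<Longrightarrow> S1 \<noteq> [] \<Longrightarrow> S2 \<noteq> [] \<Longrightarrow> W < cval a S 0"
    "S1 = [] \<Longrightarrow> S = True # S2" "S2 = [] \<Longrightarrow> S = True # S1"
    "a = 0 \<Longrightarrow> S = rev S1 @ True # S2 \<or> S = rev S2 @ True # S1"
proof (cases "csize S1 \<le> csize S2")
  case True
  have le: "W + a * length S1 \<le> cval a (rev S1 @ True # S2) 0"
    unfolding W_def using cval_triangle_le[OF True, of a] by simp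
  show ?thesis
  proof (rule that[of "rev S1 @ True # S2"])
    show "W < cval a (rev S1 @ True # S2) 0" if "0 < a" "S1 \<noteq> []"
    proof -
      have "0 < a * length S1" using that by simp
      then show ?thesis using le by linarith
    qed
  qed (use True le in simp_all)
next
  case False
  then have "csize S2 \<le> csize S1" by simp
  from cval_triangle_le[OF this, of a]
  have le: "W + a * length S2 \<le> cval a (rev S2 @ True # S1) 0"
    unfolding W_def by (simp add: algebra_simps)
  show ?thesis
  proof (rule that[of "rev S2 @ True # S1"])
    show "W < cval a (rev S2 @ True # S1) 0" if "0 < a" "S2 \<noteq> []"
    proof -
      have "0 < a * length S2" using that by simp
      then show ?thesis using le by linarith
    qed
  qed (use False le in simp_all)
qed

section \<open>Optimal chains\<close>

text \<open>Moving the triangle from the left to the right of the bridges carries three edges across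
  \<open>l\<close> bridges, which changes the value by \<open>3 * l * (p - q)\<close>, while the
  product belonging to the triangle changes by \<open>l * (q - p)\<close>. The net change
  \<open>2 * l * (p - q)\<close> shows that a triangle gains by moving towards the lighter
  end.\<close>

lemma cval_swap:
  "cval p (replicate l False @ [True]) q + 2 * l * q
    = cval p (True # replicate l False) q + 2 * l * p"
proof -
  let ?F = "replicate l False"
  have sym: "cval a ?F b = cval b ?F a" for a b
    using cval_rev[of a ?F b] by simp
  have "cval p ?F (3 + q) = cval p ?F q + 3 * ctrans ?F p"
    using cval_linear[of q 3 ?F p] sym[of p "3 + q"] sym[of p q] by (metis add.commute)
  moreover have "cval (p + 3) ?F q = cval p ?F q + 3 * ctrans ?F q"
    by (rule cval_linear)
  moreover have "ctrans ?F q = ctrans ?F 0 + l * q"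
    using ctrans_linear[of ?F 0 q] by (simp only: add_0 length_replicate)
  moreover have "ctrans ?F p = ctrans ?F 0 + l * p"
    using ctrans_linear[of ?F 0 p] by (simp only: add_0 length_replicate)
  moreover have "cval p (?F @ [True]) q = cval p ?F (3 + q) + (p * q + l * q + p + l + q)"
    by (simp add: cval_append algebra_simps)
  moreover have "cval p (True # ?F) q = l * p + p * q + p + l + q + cval (p + 3) ?F q"
    by (simp add: algebra_simps)
  ultimately show ?thesis by linarith
qed

lemma cval_swap_context:
  "cval p (X @ replicate l False @ True # Y) q + 2 * l * (csize Y + q)
    = cval p (X @ True # replicate l False @ Y) q + 2 * l * (p + csize X)"
proof -
  have split: "cval p (X @ Z @ Y) q = cval p X (csize Z + (csize Y + q))
      + (cval (p + csize X) Z (csize Y + q) + cval (p + csize X + csize Z) Y q)" for Z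
    by (simp add: cval_append add.assoc)
  have "cval p (X @ replicate l False @ True # Y) q
      = cval p X (l + 3 + (csize Y + q))
        + (cval (p + csize X) (replicate l False @ [True]) (csize Y + q)
        + cval (p + csize X + (l + 3)) Y q)"
    using split[of "replicate l False @ [True]"] by simp
  moreover have "cval p (X @ True # replicate l False @ Y) q
      = cval p X (l + 3 + (csize Y + q))
        + (cval (p + csize X) (True # replicate l False) (csize Y + q)
        + cval (p + csize X + (l + 3)) Y q)"
    using split[of "True # replicate l False"] by (simp del: cval.simps add: add.commute)
  ultimately show ?thesis
    using cval_swap[of "p + csize X" l "csize Y + q"] by linarith
qed

definition optimal_chain :: "bool list \<Rightarrow> bool" where
  "optimal_chain S \<longleftrightarrow>
     (\<forall>S'. ntri S' = ntri S \<longrightarrow> csize S' = csize S \<longrightarrow> cval 0 S' 0 \<le> cval 0 S 0)"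

lemma optimal_chainD:
  "optimal_chain S \<Longrightarrow> ntri S' = ntri S \<Longrightarrow> csize S' = csize S \<Longrightarrow> cval 0 S' 0 \<le> cval 0 S 0"
  by (auto simp: optimal_chain_def)

text \<open>The two parameters determine the length of the list, so only finitely many lists
  compete.\<close>

lemma optimal_chain_exists:
  obtains S' where "optimal_chain S'" "ntri S' = ntri S" "csize S' = csize S"
proof -
  let ?A = "{S'. ntri S' = ntri S \<and> csize S' = csize S}"
  have "?A \<subseteq> {S'. set S' \<subseteq> UNIV \<and> length S' = length S}"
    by (auto simp: csize_eq_length)
  then have "finite ?A"
    by (rule finite_subset) (rule finite_lists_length_eq, simp)
  then have fin: "finite ((\<lambda>S. cval 0 S 0) ` ?A)" by simp
  moreover have "S \<in> ?A" by simp
  ultimately have "Max ((\<lambda>S. cval 0 S 0) ` ?A) \<in> (\<lambda>S. cval 0 S 0) ` ?A"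
    by (intro Max_in) blast+
  then obtain S' where S': "S' \<in> ?A" "Max ((\<lambda>S. cval 0 S 0) ` ?A) = cval 0 S' 0"
    by blast
  have "cval 0 R 0 \<le> cval 0 S' 0" if "R \<in> ?A" for R
    unfolding S'(2)[symmetric] using fin that by (intro Max_ge) blast+
  with S'(1)
  show ?thesis
    by (intro that[of S']) (auto simp: optimal_chain_def)
qed

lemma split_replicate_True:
  obtains i R where "S = replicate i True @ R" "R = [] \<or> (\<exists>R'. R = False # R')"
proof -
  have "takeWhile (\<lambda>b. b) S = replicate (length (takeWhile (\<lambda>b. b) S)) True"
    by (rule replicate_eqI) (auto dest: set_takeWhileD)
  moreover have "dropWhile (\<lambda>b. b) S = [] \<or> (\<exists>R'. dropWhile (\<lambda>b. b) S = False # R')"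
    using hd_dropWhile[of "\<lambda>b. b" S] by (cases "dropWhile (\<lambda>b. b) S") auto
  ultimately show ?thesis
    by (metis that takeWhile_dropWhile_id)
qed

lemma split_replicate_False:
  obtains i R where "S = replicate i False @ R" "R = [] \<or> (\<exists>R'. R = True # R')"
proof -
  obtain i R where R: "map Not S = replicate i True @ R" "R = [] \<or> (\<exists>R'. R = False # R')"
    by (rule split_replicate_True)
  then have "map Not (map Not S) = map Not (replicate i True @ R)" by simp
  then have "S = replicate i False @ map Not R" by (simp add: comp_def)
  with R(2) show ?thesis by (auto intro: that)
qed

text \<open>If a bridge followed the second run of triangles, that run would have bridges on both
  sides. Swapping its first triangle with the bridge before it shows that the part behind this
  triangle is no larger than the part before that bridge; swapping its last triangle with the next
  bridge shows the converse. Each part would then be bounded by a proper part of itself.\<close>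

lemma optimal_chain_form:
  assumes "optimal_chain S"
  obtains i l j where "S = replicate i True @ replicate l False @ replicate j True"
proof -
  obtain i R1 where R1: "S = replicate i True @ R1" "R1 = [] \<or> (\<exists>R'. R1 = False # R')"
    by (rule split_replicate_True)
  obtain l R2 where R2: "R1 = replicate l False @ R2" "R2 = [] \<or> (\<exists>R'. R2 = True # R')"
    by (rule split_replicate_False)
  obtain j R3 where R3: "R2 = replicate j True @ R3" "R3 = [] \<or> (\<exists>R'. R3 = False # R')"
    by (rule split_replicate_True)
  show ?thesis
  proof (cases R3)
    case Nil
    then show ?thesis using R1 R2 R3 that by auto
  next
    case (Cons r Y)
    then have r: "R3 = False # Y" using R3 by auto
    have "l \<noteq> 0" using R1 R2 R3 r by (cases l; cases j) auto
    then obtain l' where l': "l = Suc l'" by (cases l) auto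
    have "j \<noteq> 0" using R2 R3 r by (cases j) auto
    then obtain j' where j': "j = Suc j'" by (cases j) auto
    let ?X = "replicate i True @ replicate l' False"
    let ?X' = "replicate i True @ replicate l False @ replicate j' True"
    have S1: "S = ?X @ replicate 1 False @ True # (replicate j' True @ R3)"
      using R1 R2 R3 l' j' by (simp add: replicate_app_Cons_same)
    have S2: "S = ?X' @ True # replicate 1 False @ Y"
      using R1 R2 R3 l' j' r by (simp add: replicate_app_Cons_same)
    have "cval 0 (?X @ True # replicate 1 False @ (replicate j' True @ R3)) 0 \<le> cval 0 S 0"
      by (rule optimal_chainD[OF assms]) (simp_all add: S1)
    then have 1: "csize (replicate j' True @ R3) \<le> csize ?X"
      using cval_swap_context[of 0 ?X 1 "replicate j' True @ R3" 0] S1 by simp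
    have "cval 0 (?X' @ replicate 1 False @ True # Y) 0 \<le> cval 0 S 0"
      by (rule optimal_chainD[OF assms]) (simp_all add: S2)
    then have 2: "csize ?X' \<le> csize Y"
      using cval_swap_context[of 0 ?X' 1 Y 0] S2 by simp
    show ?thesis using 1 2 r l' by simp
  qed
qed

text \<open>One triangle is carried across the whole run of bridges. By the swap formula this gains
  \<open>6 * l\<close> times the difference of the numbers of the other triangles on the two sides,
  which is a real gain only for \<open>l > 0\<close>.\<close>

lemma optimal_chain_balanced:
  assumes "optimal_chain (replicate i True @ replicate l False @ replicate j True)" "0 < l"
  shows "i \<le> Suc j" "j \<le> Suc i"
proof -
  show "j \<le> Suc i"
  proof (cases j)
    case (Suc j')
    have "cval 0 (replicate i True @ True # replicate l False @ replicate j' True) 0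
        \<le> cval 0 (replicate i True @ replicate l False @ replicate j True) 0"
      by (rule optimal_chainD[OF assms(1)]) (simp_all add: Suc)
    moreover have "cval 0 (replicate i True @ replicate l False @ replicate j True) 0 + 6 * (l * j')
        = cval 0 (replicate i True @ True # replicate l False @ replicate j' True) 0 + 6 * (l * i)"
      using cval_swap_context[of 0 "replicate i True" l "replicate j' True" 0] Suc by simp
    ultimately have "\<not> l * i < l * j'" by linarith
    then show ?thesis using assms(2) Suc by simp
  qed simp
  show "i \<le> Suc j"
  proof (cases i)
    case (Suc i')
    have eq: "replicate i True @ replicate l False @ replicate j True
        = replicate i' True @ True # replicate l False @ replicate j True"
      using Suc by (simp add: replicate_app_Cons_same)
    have "cval 0 (replicate i' True @ replicate l False @ True # replicate j True) 0
        \<le> cval 0 (replicate i True @ replicate l False @ replicate j True) 0"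
      by (rule optimal_chainD[OF assms(1)]) (simp_all add: Suc)
    moreover have "cval 0 (replicate i' True @ replicate l False @ True # replicate j True) 0 + 6 * (l * j)
        = cval 0 (replicate i True @ replicate l False @ replicate j True) 0 + 6 * (l * i')"
      using cval_swap_context[of 0 "replicate i' True" l "replicate j True" 0] unfolding eq by simp
    ultimately have "\<not> l * j < l * i'" by linarith
    then show ?thesis using assms(2) Suc by simp
  qed simp
qed

definition saw_chain :: "nat \<Rightarrow> nat \<Rightarrow> nat \<Rightarrow> bool list" where
  "saw_chain i j l = replicate i True @ replicate l False @ replicate j True"

lemma saw_chain_simps [simp]:
  "csize (saw_chain i j l) = 3 * i + 3 * j + l" "ntri (saw_chain i j l) = i + j"
  "rev (saw_chain i j l) = saw_chain j i l"
  by (simp_all add: saw_chain_def)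

lemma optimal_chain_saw:
  assumes "optimal_chain S" "ntri S = k + k'" "csize S = 3 * (k + k') + l" "k \<le> k'" "k' \<le> Suc k"
  shows "S = saw_chain k k' l \<or> S = rev (saw_chain k k' l)"
proof -
  obtain i l' j where S: "S = replicate i True @ replicate l' False @ replicate j True"
    using assms(1) by (rule optimal_chain_form)
  have ij: "i + j = k + k'" "l' = l"
    using assms S by auto
  show ?thesis
  proof (cases "l = 0")
    \<comment> \<open>Without bridges the split of the triangles into two runs is arbitrary, but the
      list itself is not.\<close>
    case True
    then have "S = replicate (k + k') True"
      unfolding ij(1)[symmetric] using S ij(2) by (simp add: replicate_add)
    then show ?thesis using True by (simp add: saw_chain_def replicate_add)
  next
    case False
    then have "i \<le> Suc j" "j \<le> Suc i"
      using optimal_chain_balanced[of i l j] assms(1) S ij by auto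
    then have "(i = k \<and> j = k') \<or> (i = k' \<and> j = k)"
      using ij assms by linarith
    then show ?thesis using S ij by (auto simp: saw_chain_def)
  qed
qed

lemma cval_le_saw_chain:
  assumes "ntri S = k + k'" "csize S = 3 * (k + k') + l" "k \<le> k'" "k' \<le> Suc k"
  shows "cval 0 S 0 \<le> cval 0 (saw_chain k k' l) 0"
    and "cval 0 S 0 = cval 0 (saw_chain k k' l) 0 \<Longrightarrow>
      S = saw_chain k k' l \<or> S = rev (saw_chain k k' l)"
proof -
  obtain S' where S': "optimal_chain S'" "ntri S' = ntri S" "csize S' = csize S"
    by (rule optimal_chain_exists)
  have "S' = saw_chain k k' l \<or> S' = rev (saw_chain k k' l)"
    using S' assms by (intro optimal_chain_saw) simp_all
  then have eq: "cval 0 S' 0 = cval 0 (saw_chain k k' l) 0"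
    using cval_rev by metis
  show "cval 0 S 0 \<le> cval 0 (saw_chain k k' l) 0"
    using optimal_chainD[OF S'(1), of S] S' eq by simp
  assume "cval 0 S 0 = cval 0 (saw_chain k k' l) 0"
  then have "optimal_chain S"
    using S' eq by (simp add: optimal_chain_def)
  then show "S = saw_chain k k' l \<or> S = rev (saw_chain k k' l)"
    using assms by (rule optimal_chain_saw)
qed

text \<open>Expanding the products gives \<open>p * q\<close> for each block,
  \<open>3 * (p + q)\<close> for each pair of blocks and 9 for each triple. The last summand
  collects, for each triangle, the total weight outside it. For bridges the factor 3 becomes 1, 9
  becomes 1, and the last summand disappears.\<close>

lemma cval_replicate_True:
  "real (cval p (replicate k True) q) = real k * p * q + 3 * (real p + q) * k * (real k - 1) / 2
     + 3 * real k * (real k - 1) * (real k - 2) / 2 + k * (real p + q + 3 * real k - 3)"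
proof (induction k arbitrary: p)
  case (Suc k)
  show ?case using Suc[of "p + 3"] by (simp add: field_simps)
qed simp

lemma cval_replicate_False:
  "real (cval p (replicate l False) q) = real l * p * q + (real p + q) * l * (real l - 1) / 2
     + real l * (real l - 1) * (real l - 2) / 6"
proof (induction l arbitrary: p)
  case (Suc l)
  show ?case using Suc[of "Suc p"] by (simp add: field_simps)
qed simp

lemma cval_saw_chain:
  "real (cval 0 (saw_chain i j l) 0) =
     real (cval 0 (replicate i True) (l + 3 * j)) + real (cval (3 * i) (replicate l False) (3 * j))
     + real (cval (3 * i + l) (replicate j True) 0)"
  by (simp add: saw_chain_def cval_append mult.commute)

section \<open>Distances in glued graphs\<close>

lemma walk_betw_refl: "u \<in> verts G \<Longrightarrow> walk_betw G u [u] u"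
  by (simp add: walk_betw_def is_walk_def)

lemma walk_betw_edge:
  "{u, v} \<in> edges G \<Longrightarrow> u \<in> verts G \<Longrightarrow> v \<in> verts G \<Longrightarrow> walk_betw G u [u, v] v"
  by (simp add: walk_betw_def is_walk_def)

lemma walk_betw_append:
  assumes "walk_betw G u p v" "walk_betw G v q w"
  shows "walk_betw G u (p @ tl q) w"
proof (cases q)
  case Nil
  then show ?thesis using assms by (simp add: walk_betw_def is_walk_def)
next
  case (Cons a q')
  then show ?thesis
    using assms by (cases q') (auto simp: walk_betw_def is_walk_def successively_append_iff)
qed

lemma walk_betw_mono:
  assumes "walk_betw H u p v" "verts H \<subseteq> verts G" "edges H \<subseteq> edges G"
  shows "walk_betw G u p v"
  using assms by (auto simp: walk_betw_def is_walk_def elim!: successively_mono)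

lemma walk_betw_length: "walk_betw G u p v \<Longrightarrow> length p = Suc (length p - 1)"
  by (cases p) (auto simp: walk_betw_def is_walk_def)

lemma gdist_le: "walk_betw G u p v \<Longrightarrow> gdist G u v \<le> length p - 1"
  unfolding gdist_def by (rule Least_le) (metis walk_betw_length)

lemma walk_betw_gdist:
  assumes "walk_betw G u p v"
  obtains q where "walk_betw G u q v" "length q = Suc (gdist G u v)"
proof -
  have "\<exists>l q. walk_betw G u q v \<and> length q = Suc l"
    using assms walk_betw_length[OF assms] by (intro exI conjI)
  from LeastI_ex[OF this] show ?thesis
    using that by (auto simp: gdist_def)
qed

lemma connected_walk:
  assumes "connected_graph G" "u \<in> verts G" "v \<in> verts G"
  obtains p where "walk_betw G u p v"
  using assms by (auto simp: connected_graph_def)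

lemma lipschitz_walk:
  fixes f :: "'a \<Rightarrow> nat"
  assumes "walk_betw G u p v" "\<And>x y. {x, y} \<in> edges G \<Longrightarrow> f y \<le> f x + 1"
  shows "f v \<le> f u + (length p - 1)"
  using assms(1)
proof (induction p arbitrary: u)
  case Nil
  then show ?case by (simp add: walk_betw_def is_walk_def)
next
  case (Cons a p)
  show ?case
  proof (cases p)
    case Nil
    then show ?thesis using Cons.prems by (auto simp: walk_betw_def)
  next
    case (Cons b p')
    then have "walk_betw G b p v" "{u, b} \<in> edges G"
      using Cons.prems by (auto simp: walk_betw_def is_walk_def)
    then show ?thesis using Cons.IH[of b] assms(2)[of u b] Cons by simp
  qed
qed

text \<open>A function that grows by at most 1 along every edge bounds the distance from below, and
  a walk of matching length bounds it from above. With this certificate walks in glued graphs need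
  not be decomposed.\<close>

lemma gdist_eqI:
  fixes f :: "'a \<Rightarrow> nat"
  assumes "walk_betw G u p v" "length p = Suc (f v)" "f u = 0"
    "\<And>x y. {x, y} \<in> edges G \<Longrightarrow> f y \<le> f x + 1"
  shows "gdist G u v = f v"
proof -
  obtain q where q: "walk_betw G u q v" "length q = Suc (gdist G u v)"
    using assms(1) by (rule walk_betw_gdist)
  show ?thesis
    using lipschitz_walk[OF q(1), of f] assms(4) gdist_le[OF assms(1)] q(2) assms(2,3) by simp
qed

lemma gdist_refl [simp]: "u \<in> verts G \<Longrightarrow> gdist G u u = 0"
  using gdist_le[OF walk_betw_refl, of u G] by simp

lemma gdist_pos:
  assumes "connected_graph G" "u \<in> verts G" "v \<in> verts G" "u \<noteq> v"
  shows "0 < gdist G u v"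
proof -
  obtain p where "walk_betw G u p v" using assms by (auto elim: connected_walk)
  then obtain q where q: "walk_betw G u q v" "length q = Suc (gdist G u v)"
    by (rule walk_betw_gdist)
  show ?thesis
  proof (rule ccontr)
    assume "\<not> 0 < gdist G u v"
    then obtain a where "q = [a]" using q(2) by (auto simp: length_Suc_conv)
    then show False using q(1) assms(4) by (auto simp: walk_betw_def)
  qed
qed

lemma gdist_triangle:
  assumes "connected_graph G" "u \<in> verts G" "v \<in> verts G" "w \<in> verts G"
  shows "gdist G u w \<le> gdist G u v + gdist G v w"
proof -
  obtain p where "walk_betw G u p v" using assms by (auto elim: connected_walk)
  then obtain p where p: "walk_betw G u p v" "length p = Suc (gdist G u v)"
    by (rule walk_betw_gdist)
  obtain q where "walk_betw G v q w" using assms by (auto elim: connected_walk)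
  then obtain q where q: "walk_betw G v q w" "length q = Suc (gdist G v w)"
    by (rule walk_betw_gdist)
  show ?thesis using gdist_le[OF walk_betw_append[OF p(1) q(1)]] p(2) q(2) by simp
qed

lemma simple_edge:
  assumes "simple_graph G" "{u, v} \<in> edges G"
  shows "u \<in> verts G" "v \<in> verts G" "u \<noteq> v"
  using assms by (auto simp: simple_graph_def)

lemma simple_edgeE:
  assumes "simple_graph G" "e \<in> edges G"
  obtains u v where "e = {u, v}" "u \<noteq> v" "u \<in> verts G" "v \<in> verts G"
  using assms by (auto simp: simple_graph_def card_2_iff)

lemma simple_finite_edges: "simple_graph G \<Longrightarrow> finite (edges G)"
  by (rule finite_subset[of _ "Pow (verts G)"]) (auto simp: simple_graph_def)

lemma simple_finite_verts: "simple_graph G \<Longrightarrow> finite (verts G)"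
  by (simp add: simple_graph_def)

lemma gdist_edge_le:
  assumes "simple_graph G" "{u, v} \<in> edges G"
  shows "gdist G u v \<le> 1"
  using gdist_le[OF walk_betw_edge[of u v G]] simple_edge[OF assms] assms(2) by simp

lemma gdist_edge:
  assumes "simple_graph G" "connected_graph G" "{u, v} \<in> edges G"
  shows "gdist G u v = 1"
  using gdist_edge_le[OF assms(1,3)] gdist_pos[OF assms(2), of u v] simple_edge[OF assms(1,3)]
  by simp

lemma graph_union_simps [simp]:
  "verts (graph_union G H) = verts G \<union> verts H" "edges (graph_union G H) = edges G \<union> edges H"
  by (simp_all add: graph_union_def)

lemma graph_union_commute: "graph_union G H = graph_union H G"
  by (auto simp: graph_union_def)

lemma simple_graph_union: "simple_graph G \<Longrightarrow> simple_graph H \<Longrightarrow> simple_graph (graph_union G H)"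
  by (auto simp: simple_graph_def)

text \<open>The candidate for the distance from \<open>u\<close> is the distance in \<open>H\<close>
  on one part and the distance via \<open>x\<close> on the other. The formulas agree at
  \<open>x\<close>, the only common vertex, so the candidate varies by at most 1 along the edges of
  either part, and walks through \<open>x\<close> attain it.\<close>

lemma gdist_union:
  assumes "simple_graph H" "connected_graph H" "simple_graph B" "connected_graph B"
    and x: "verts H \<inter> verts B = {x}" and u: "u \<in> verts H"
  defines "U \<equiv> graph_union H B"
  shows "v \<in> verts H \<Longrightarrow> gdist U u v = gdist H u v"
    and "v \<in> verts B \<Longrightarrow> gdist U u v = gdist H u x + gdist B x v"
    and "v \<in> verts U \<Longrightarrow> \<exists>p. walk_betw U u p v"
proof -
  define f where "f y = (if y \<in> verts H then gdist H u y else gdist H u x + gdist B x y)" for y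
  have xx: "x \<in> verts H" "x \<in> verts B" using x by auto
  have fB: "f y = gdist H u x + gdist B x y" if "y \<in> verts B" for y
  proof (cases "y \<in> verts H")
    case True
    then have "y = x" using x that by auto
    then show ?thesis using xx by (simp add: f_def)
  qed (simp add: f_def)
  have lip: "f z \<le> f y + 1" if "{y, z} \<in> edges U" for y z
  proof (cases "{y, z} \<in> edges H")
    case True
    then show ?thesis
      using gdist_triangle[OF assms(2) u, of y z] gdist_edge_le[OF assms(1) True]
        simple_edge[OF assms(1) True] by (simp add: f_def)
  next
    case False
    then have e: "{y, z} \<in> edges B" using that by (simp add: U_def)
    then show ?thesis
      using gdist_triangle[OF assms(4) xx(2), of y z] gdist_edge_le[OF assms(3) e]
        simple_edge[OF assms(3) e] by (simp add: fB)
  qed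
  have inH: "\<exists>p. walk_betw U u p v \<and> length p = Suc (f v)" if v: "v \<in> verts H" for v
  proof -
    obtain p where "walk_betw H u p v" using assms(2) u v by (auto elim: connected_walk)
    then obtain p where "walk_betw H u p v" "length p = Suc (gdist H u v)"
      by (rule walk_betw_gdist)
    then show ?thesis
      using v by (auto simp: f_def U_def intro!: exI[of _ p] elim: walk_betw_mono)
  qed
  have inB: "\<exists>p. walk_betw U u p v \<and> length p = Suc (f v)" if v: "v \<in> verts B" for v
  proof -
    obtain p where p: "walk_betw U u p x" "length p = Suc (f x)" using inH xx by blast
    obtain q where "walk_betw B x q v" using assms(4) xx v by (auto elim: connected_walk)
    then obtain q where q: "walk_betw B x q v" "length q = Suc (gdist B x v)"
      by (rule walk_betw_gdist)
    have "walk_betw U x q v" using q(1) by (rule walk_betw_mono) (auto simp: U_def)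
    from walk_betw_append[OF p(1) this] show ?thesis
      using p(2) q(2) v xx by (auto simp: fB intro!: exI[of _ "p @ tl q"])
  qed
  have fu: "f u = 0" using u by (simp add: f_def)
  have eq: "gdist U u v = f v" if "v \<in> verts U" for v
    using inH inB that gdist_eqI[of U u _ v f] fu lip unfolding U_def by auto
  show "gdist U u v = gdist H u v" if "v \<in> verts H"
    using eq[of v] that by (simp add: f_def U_def)
  show "gdist U u v = gdist H u x + gdist B x v" if "v \<in> verts B"
    using eq[of v] fB that by (simp add: U_def)
  show "\<exists>p. walk_betw U u p v" if "v \<in> verts U"
    using that inH inB by (auto simp: U_def)
qed

lemma gdist_union_right:
  assumes "simple_graph H" "connected_graph H" "simple_graph B" "connected_graph B"
    "verts H \<inter> verts B = {x}" "u \<in> verts B" "v \<in> verts B"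
  shows "gdist (graph_union H B) u v = gdist B u v"
  using gdist_union(1)[of B H x u v] assms by (auto simp: graph_union_commute Int_commute)

lemma connected_graph_union:
  assumes "simple_graph H" "connected_graph H" "simple_graph B" "connected_graph B"
    and x: "verts H \<inter> verts B = {x}"
  shows "connected_graph (graph_union H B)"
proof -
  have x': "verts B \<inter> verts H = {x}" using x by auto
  have "\<exists>p. walk_betw (graph_union H B) u p v"
    if "u \<in> verts (graph_union H B)" "v \<in> verts (graph_union H B)" for u v
  proof (cases "u \<in> verts H")
    case True
    then show ?thesis using gdist_union(3)[OF assms] that by auto
  next
    case False
    then have "u \<in> verts B" using that by auto
    then show ?thesis
      using gdist_union(3)[OF assms(3,4,1,2) x', of u v] that
      by (simp add: graph_union_commute[of B H] Un_commute)
  qed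
  moreover have "verts (graph_union H B) \<noteq> {}" using x by auto
  ultimately show ?thesis unfolding connected_graph_def by blast
qed

section \<open>Distances of sets and weighted distance sums\<close>

definition sdist :: "'a ugraph \<Rightarrow> 'a set \<Rightarrow> 'a set \<Rightarrow> nat" where
  "sdist G I J = Min {gdist G u v | u v. u \<in> I \<and> v \<in> J}"

lemma sdist_image: "sdist G I J = Min ((\<lambda>(u, v). gdist G u v) ` (I \<times> J))"
  unfolding sdist_def by (rule arg_cong[of _ _ Min]) auto

lemma sdist_commute: "sdist G I J = sdist G J I"
  unfolding sdist_def by (rule arg_cong[of _ _ Min]) (metis gdist_commute)

lemma sdist_singletons [simp]: "sdist G {u} {v} = gdist G u v"
  by (simp add: sdist_image)

lemma sdist_le:
  "finite I \<Longrightarrow> finite J \<Longrightarrow> u \<in> I \<Longrightarrow> v \<in> J \<Longrightarrow> sdist G I J \<le> gdist G u v"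
  unfolding sdist_image by (rule Min_le) auto

lemma sdist_attained:
  assumes "finite I" "finite J" "I \<noteq> {}" "J \<noteq> {}"
  obtains u v where "u \<in> I" "v \<in> J" "sdist G I J = gdist G u v"
proof -
  have "sdist G I J \<in> (\<lambda>(u, v). gdist G u v) ` (I \<times> J)"
    unfolding sdist_image using assms by (intro Min_in) auto
  then show ?thesis using that by auto
qed

lemma sdist_eqI:
  assumes "finite I" "finite J" "u \<in> I" "v \<in> J" "gdist G u v = d"
    "\<And>u v. u \<in> I \<Longrightarrow> v \<in> J \<Longrightarrow> d \<le> gdist G u v"
  shows "sdist G I J = d"
  unfolding sdist_image by (rule Min_eqI) (use assms in auto)

lemma sdist_eq_0:
  assumes "finite I" "finite J" "u \<in> I" "u \<in> J" "u \<in> verts G"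
  shows "sdist G I J = 0"
  using sdist_le[OF assms(1-4), of G] assms(5) by simp

text \<open>Vertices appear as singletons, so that one double sum covers the distances between two
  edges, between an edge and a vertex, and between two vertices. In a simple graph the edges have
  two elements, which is how \<open>iweight\<close> tells the two kinds apart.\<close>

definition items :: "'a ugraph \<Rightarrow> 'a set set" where
  "items G = edges G \<union> (\<lambda>x. {x}) ` verts G"

definition iweight :: "('a \<Rightarrow> nat) \<Rightarrow> 'a set \<Rightarrow> nat" where
  "iweight \<omega> I = (if card I = 1 then \<omega> (the_elem I) else 1)"

text \<open>Twice the sum of the distances over the unordered pairs of edges and weighted vertices.
  In this sum adjacent edges have distance \<open>0\<close>, so that it is additive over the blocks of
  a graph.\<close>

definition wsum :: "'a ugraph \<Rightarrow> ('a \<Rightarrow> nat) \<Rightarrow> nat" where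
  "wsum G \<omega> = (\<Sum>I\<in>items G. iweight \<omega> I * (\<Sum>J\<in>items G. iweight \<omega> J * sdist G I J))"

definition mass :: "'a ugraph \<Rightarrow> ('a \<Rightarrow> nat) \<Rightarrow> nat" where
  "mass G \<omega> = card (edges G) + (\<Sum>x\<in>verts G. \<omega> x)"

lemma iweight_singleton [simp]: "iweight \<omega> {x} = \<omega> x"
  by (simp add: iweight_def)

lemma iweight_edge: "simple_graph G \<Longrightarrow> e \<in> edges G \<Longrightarrow> iweight \<omega> e = 1"
  by (auto simp: iweight_def simple_graph_def)

lemma finite_items: "simple_graph G \<Longrightarrow> finite (items G)"
  by (simp add: items_def simple_finite_edges simple_finite_verts)

lemma items_subset: "simple_graph G \<Longrightarrow> I \<in> items G \<Longrightarrow> I \<subseteq> verts G \<and> finite I \<and> I \<noteq> {}"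
  by (auto simp: items_def simple_graph_def intro: finite_subset)

lemma edges_singletons_disjoint: "simple_graph G \<Longrightarrow> edges G \<inter> (\<lambda>x. {x}) ` A = {}"
  by (fastforce simp: simple_graph_def)

lemma sum_items:
  assumes "simple_graph G"
  shows "(\<Sum>I\<in>items G. iweight \<omega> I * F I) = (\<Sum>e\<in>edges G. F e) + (\<Sum>x\<in>verts G. \<omega> x * F {x})"
proof -
  have "(\<Sum>I\<in>items G. iweight \<omega> I * F I) = (\<Sum>e\<in>edges G. iweight \<omega> e * F e)
      + (\<Sum>I\<in>(\<lambda>x. {x}) ` verts G. iweight \<omega> I * F I)"
    unfolding items_def
    using simple_finite_edges[OF assms] simple_finite_verts[OF assms]
      edges_singletons_disjoint[OF assms]
    by (intro sum.union_disjoint) simp_all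
  also have "(\<Sum>e\<in>edges G. iweight \<omega> e * F e) = (\<Sum>e\<in>edges G. F e)"
    using iweight_edge[OF assms] by (intro sum.cong) auto
  also have "(\<Sum>I\<in>(\<lambda>x. {x}) ` verts G. iweight \<omega> I * F I) = (\<Sum>x\<in>verts G. \<omega> x * F {x})"
    by (subst sum.reindex) (auto simp: inj_on_def)
  finally show ?thesis .
qed

lemma mass_items: "simple_graph G \<Longrightarrow> mass G \<omega> = (\<Sum>I\<in>items G. iweight \<omega> I)"
  using sum_items[of G \<omega> "\<lambda>_. 1"] by (simp add: mass_def)

lemma iweight_upd:
  "iweight (\<omega>(x := a)) I = (if I = {x} then a else iweight \<omega> I)"
  by (auto simp: iweight_def card_1_singleton_iff)

text \<open>The sum runs over ordered pairs, whence the factor 2. The term quadratic in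
  \<open>m\<close> vanishes because \<open>x\<close> has distance 0 from itself.\<close>

lemma wsum_add_weight:
  assumes "simple_graph G" "x \<in> verts G"
  shows "wsum G (\<omega>(x := \<omega> x + m))
    = wsum G \<omega> + 2 * (m * (\<Sum>I\<in>items G. iweight \<omega> I * sdist G I {x}))"
proof -
  let ?w = "iweight \<omega>" and ?A = "items G"
  define e where "e I = (if I = {x} then m else 0)" for I
  have w': "iweight (\<omega>(x := \<omega> x + m)) I = ?w I + e I" for I
    by (simp add: iweight_upd e_def)
  have fin: "finite ?A" and xA: "{x} \<in> ?A"
    using assms(2) by (auto simp: finite_items[OF assms(1)], simp add: items_def)
  have e: "(\<Sum>I\<in>?A. e I * F I) = m * F {x}" for F :: "'a set \<Rightarrow> nat"
  proof -
    have "(\<Sum>I\<in>?A. e I * F I) = (\<Sum>I\<in>?A. if I = {x} then m * F {x} else 0)"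
      by (intro sum.cong) (auto simp: e_def)
    also have "\<dots> = m * F {x}" using fin xA by simp
    finally show ?thesis .
  qed
  have inner: "(\<Sum>J\<in>?A. (?w J + e J) * sdist G I J)
      = (\<Sum>J\<in>?A. ?w J * sdist G I J) + m * sdist G I {x}" for I
    by (simp add: add_mult_distrib sum.distrib e)
  have "wsum G (\<omega>(x := \<omega> x + m))
      = (\<Sum>I\<in>?A. (?w I + e I) * ((\<Sum>J\<in>?A. ?w J * sdist G I J) + m * sdist G I {x}))"
    by (simp add: wsum_def w' inner)
  also have "\<dots> = wsum G \<omega> + (\<Sum>I\<in>?A. ?w I * (m * sdist G I {x}))
      + m * ((\<Sum>J\<in>?A. ?w J * sdist G {x} J) + m * sdist G {x} {x})"
    by (simp only: add_mult_distrib sum.distrib e) (simp add: add_mult_distrib2 sum.distrib wsum_def)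
  also have "(\<Sum>J\<in>?A. ?w J * sdist G {x} J) = (\<Sum>J\<in>?A. ?w J * sdist G J {x})"
    by (simp add: sdist_commute)
  also have "(\<Sum>I\<in>?A. ?w I * (m * sdist G I {x})) = m * (\<Sum>I\<in>?A. ?w I * sdist G I {x})"
    by (simp add: sum_distrib_left mult.left_commute)
  finally show ?thesis using assms(2) by (simp add: fun_upd_def)
qed

lemma sdist_union:
  assumes H: "simple_graph H" "connected_graph H" and B: "simple_graph B" "connected_graph B"
    and x: "verts H \<inter> verts B = {x}"
  shows "I \<in> items H \<Longrightarrow> J \<in> items H \<Longrightarrow> sdist (graph_union H B) I J = sdist H I J"
    and "I \<in> items B \<Longrightarrow> J \<in> items B \<Longrightarrow> sdist (graph_union H B) I J = sdist B I J"
    and "I \<in> items H \<Longrightarrow> J \<in> items B \<Longrightarrow>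
      sdist (graph_union H B) I J = sdist H I {x} + sdist B {x} J"
proof -
  note HB = H B x
  show "sdist (graph_union H B) I J = sdist H I J" if IJ: "I \<in> items H" "J \<in> items H"
  proof -
    have "gdist (graph_union H B) u v = gdist H u v" if "u \<in> I" "v \<in> J" for u v
      using gdist_union(1)[OF HB] items_subset[OF H(1) IJ(1)] items_subset[OF H(1) IJ(2)] that
      by blast
    then show ?thesis
      unfolding sdist_image by (intro arg_cong[of _ _ Min] image_cong) auto
  qed
  show "sdist (graph_union H B) I J = sdist B I J" if IJ: "I \<in> items B" "J \<in> items B"
  proof -
    have "gdist (graph_union H B) u v = gdist B u v" if "u \<in> I" "v \<in> J" for u v
      using gdist_union_right[OF HB] items_subset[OF B(1) IJ(1)] items_subset[OF B(1) IJ(2)] that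
      by blast
    then show ?thesis
      unfolding sdist_image by (intro arg_cong[of _ _ Min] image_cong) auto
  qed
  assume IJ: "I \<in> items H" "J \<in> items B"
  have I: "I \<subseteq> verts H" "finite I" "I \<noteq> {}" and J: "J \<subseteq> verts B" "finite J" "J \<noteq> {}"
    using items_subset[OF H(1) IJ(1)] items_subset[OF B(1) IJ(2)] by auto
  obtain u where u: "u \<in> I" "sdist H I {x} = gdist H u x"
    by (rule sdist_attained[of I "{x}" H]) (use I in auto)
  obtain v where v: "v \<in> J" "sdist B {x} J = gdist B x v"
    by (rule sdist_attained[of "{x}" J B]) (use J in auto)
  show "sdist (graph_union H B) I J = sdist H I {x} + sdist B {x} J"
  proof (rule sdist_eqI[OF I(2) J(2) u(1) v(1)])
    show "gdist (graph_union H B) u v = sdist H I {x} + sdist B {x} J"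
      using gdist_union(2)[OF HB, of u v] u v I J by auto
    show "sdist H I {x} + sdist B {x} J \<le> gdist (graph_union H B) u v" if "u \<in> I" "v \<in> J" for u v
    proof -
      have "u \<in> verts H" "v \<in> verts B" using that I J by blast+
      then show ?thesis
        using gdist_union(2)[OF HB, of u v] sdist_le[of I "{x}" u x H]
          sdist_le[of "{x}" J x v B] I J that by simp
    qed
  qed
qed

text \<open>Every connection between the parts passes through \<open>x\<close>, so each part sees
  the other as a mass concentrated at \<open>x\<close>. The weight of \<open>x\<close> itself is
  booked with \<open>H\<close>; it is erased in the mass of \<open>B\<close> and is contained in
  \<open>mass H \<omega>\<close>.\<close>

lemma wsum_union:
  assumes H: "simple_graph H" "connected_graph H" and B: "simple_graph B" "connected_graph B"
    and x: "verts H \<inter> verts B = {x}"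
  shows "wsum (graph_union H B) \<omega> = wsum H (\<omega>(x := \<omega> x + mass B (\<omega>(x := 0))))
    + wsum B (\<omega>(x := mass H \<omega>))"
proof -
  let ?U = "graph_union H B"
  let ?w = "iweight \<omega>" and ?A = "items H" and ?C = "items B - {{x}}"
  note HB = H B x
  have xx: "x \<in> verts H" "x \<in> verts B" using x by auto
  have it: "items ?U = ?A \<union> ?C"
    using xx by (auto simp: items_def)
  have disj: "?A \<inter> ?C = {}"
  proof -
    have "I = {x}" if I: "I \<in> items H" "I \<in> items B" for I
    proof -
      have "I \<subseteq> {x}" "I \<noteq> {}"
        using items_subset[OF H(1) I(1)] items_subset[OF B(1) I(2)] x by auto
      then show ?thesis by auto
    qed
    then show ?thesis by auto
  qed
  have fin: "finite ?A" "finite ?C" using H B by (simp_all add: finite_items)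
  have xB: "{x} \<in> items B" using xx by (simp add: items_def)
  \<comment> \<open>\<open>a\<close> and \<open>c\<close> are the distance sums to \<open>x\<close>
    in the two parts, \<open>mA\<close> and \<open>mC\<close> are the masses. The distance of a
    mixed pair splits at \<open>x\<close>, so each summand of \<open>a\<close> occurs with total
    weight \<open>mC\<close> and each summand of \<open>c\<close> with total weight
    \<open>mA\<close>.\<close>
  define a where "a = (\<Sum>I\<in>?A. ?w I * sdist H I {x})"
  define c where "c = (\<Sum>J\<in>?C. ?w J * sdist B {x} J)"
  define mA where "mA = (\<Sum>I\<in>?A. ?w I)"
  define mC where "mC = (\<Sum>J\<in>?C. ?w J)"
  have dAC: "sdist ?U I J = sdist H I {x} + sdist B {x} J" if "I \<in> ?A" "J \<in> ?C" for I J
    using sdist_union(3)[OF HB] that by simp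
  have 1: "(\<Sum>I\<in>?A. ?w I * (\<Sum>J\<in>?A. ?w J * sdist ?U I J)) = wsum H \<omega>"
    unfolding wsum_def by (intro sum.cong refl arg_cong2[of _ _ _ _ "(*)"])
      (use sdist_union(1)[OF HB] in auto)
  have 2: "(\<Sum>I\<in>?A. ?w I * (\<Sum>J\<in>?C. ?w J * sdist ?U I J)) = mC * a + mA * c"
  proof -
    have "(\<Sum>I\<in>?A. ?w I * (\<Sum>J\<in>?C. ?w J * sdist ?U I J))
        = (\<Sum>I\<in>?A. ?w I * (mC * sdist H I {x} + c))"
    proof (intro sum.cong refl arg_cong2[of _ _ _ _ "(*)"])
      fix I assume I: "I \<in> ?A"
      have "(\<Sum>J\<in>?C. ?w J * sdist ?U I J) = (\<Sum>J\<in>?C. ?w J * sdist H I {x} + ?w J * sdist B {x} J)"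
        using dAC[OF I] by (intro sum.cong refl) (simp add: add_mult_distrib2)
      then show "(\<Sum>J\<in>?C. ?w J * sdist ?U I J) = mC * sdist H I {x} + c"
        by (simp add: sum.distrib mC_def c_def sum_distrib_right)
    qed
    also have "\<dots> = mC * a + mA * c"
      by (simp add: add_mult_distrib2 sum.distrib a_def mA_def sum_distrib_left sum_distrib_right mult_ac)
    finally show ?thesis .
  qed
  have 3: "(\<Sum>J\<in>?C. ?w J * (\<Sum>I\<in>?A. ?w I * sdist ?U J I)) = mC * a + mA * c"
  proof -
    have "(\<Sum>J\<in>?C. ?w J * (\<Sum>I\<in>?A. ?w I * sdist ?U J I))
        = (\<Sum>J\<in>?C. \<Sum>I\<in>?A. ?w I * (?w J * sdist ?U I J))"
      by (simp add: sum_distrib_left mult_ac sdist_commute[of ?U])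
    also have "\<dots> = (\<Sum>I\<in>?A. \<Sum>J\<in>?C. ?w I * (?w J * sdist ?U I J))"
      by (rule sum.swap)
    also have "\<dots> = mC * a + mA * c"
      using 2 by (simp add: sum_distrib_left)
    finally show ?thesis .
  qed
  define w0 where "w0 = \<omega>(x := 0)"
  have w0: "iweight w0 I = (if I = {x} then 0 else ?w I)" for I
    by (simp add: w0_def iweight_upd)
  have drop: "(\<Sum>I\<in>items B. iweight w0 I * F I) = (\<Sum>I\<in>?C. ?w I * F I)" for F :: "'a set \<Rightarrow> nat"
  proof -
    have "(\<Sum>I\<in>items B. iweight w0 I * F I)
        = iweight w0 {x} * F {x} + (\<Sum>I\<in>?C. iweight w0 I * F I)"
      using finite_items[OF B(1)] xB by (rule sum.remove)
    also have "iweight w0 {x} = 0" by (simp add: w0 del: iweight_singleton)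
    also have "(\<Sum>I\<in>?C. iweight w0 I * F I) = (\<Sum>I\<in>?C. ?w I * F I)"
      by (intro sum.cong refl) (simp add: w0 del: iweight_singleton)
    finally show ?thesis by simp
  qed
  have 4: "(\<Sum>I\<in>?C. ?w I * (\<Sum>J\<in>?C. ?w J * sdist ?U I J)) = wsum B w0"
  proof -
    have "wsum B w0 = (\<Sum>I\<in>?C. ?w I * (\<Sum>J\<in>?C. ?w J * sdist B I J))"
      unfolding wsum_def by (simp add: drop)
    also have "\<dots> = (\<Sum>I\<in>?C. ?w I * (\<Sum>J\<in>?C. ?w J * sdist ?U I J))"
      by (intro sum.cong refl arg_cong2[of _ _ _ _ "(*)"]) (use sdist_union(2)[OF HB] in auto)
    finally show ?thesis by simp
  qed
  have "wsum ?U \<omega> = wsum H \<omega> + (mC * a + mA * c) + ((mC * a + mA * c) + wsum B w0)"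
    unfolding wsum_def[of ?U] it
    by (simp add: sum.union_disjoint[OF fin disj] add_mult_distrib2 sum.distrib 1 2 3 4)
  moreover have "mass B w0 = mC"
    using drop[of "\<lambda>_. 1"] by (simp add: mass_items B mC_def)
  then have "wsum H (\<omega>(x := \<omega> x + mass B w0)) = wsum H \<omega> + 2 * (mC * a)"
    using wsum_add_weight[OF H(1) xx(1)] by (simp add: a_def)
  moreover have "wsum B (\<omega>(x := mass H \<omega>)) = wsum B w0 + 2 * (mA * c)"
  proof -
    have "(\<Sum>I\<in>items B. iweight w0 I * sdist B I {x}) = c"
      by (simp add: drop c_def sdist_commute)
    then show ?thesis
      using wsum_add_weight[OF B(1) xx(2), of w0 "mass H \<omega>"]
      by (simp add: w0_def mass_items[OF H(1)] mA_def)
  qed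
  ultimately show ?thesis by (simp add: w0_def)
qed

text \<open>Each ordered pair of distinct edges has edge distance one more than its
  \<open>sdist\<close>, and the diagonal contributes nothing to either sum. Adding the number of
  edges on the left avoids a truncated difference.\<close>

lemma edge_wiener_wsum:
  assumes "simple_graph G"
  shows "2 * edge_wiener G + card (edges G) = wsum G (\<lambda>_. 0) + card (edges G) * card (edges G)"
proof -
  let ?E = "edges G"
  have fin: "finite ?E" using assms by (rule simple_finite_edges)
  have ed: "edge_dist G f g + (if g = f then 1 else 0) = sdist G f g + 1" if f: "f \<in> ?E" for f g
  proof (cases "f = g")
    case True
    obtain u v where "f = {u, v}" "u \<in> verts G" by (rule simple_edgeE[OF assms f])
    then have "sdist G f f = 0" by (intro sdist_eq_0[of _ _ u]) auto
    then show ?thesis using True by (simp add: edge_dist_def)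
  qed (simp add: edge_dist_def sdist_def)
  have "(\<Sum>g\<in>?E. edge_dist G f g) + 1 = (\<Sum>g\<in>?E. sdist G f g) + card ?E" if f: "f \<in> ?E" for f
  proof -
    have "(\<Sum>g\<in>?E. edge_dist G f g) + 1 = (\<Sum>g\<in>?E. edge_dist G f g + (if g = f then 1 else 0))"
      using f fin by (simp add: sum.distrib)
    also have "\<dots> = (\<Sum>g\<in>?E. sdist G f g + 1)" by (simp only: ed[OF f])
    also have "\<dots> = (\<Sum>g\<in>?E. sdist G f g) + card ?E"
      by (simp only: sum.distrib) simp
    finally show ?thesis .
  qed
  then have "(\<Sum>f\<in>?E. (\<Sum>g\<in>?E. edge_dist G f g) + 1) = (\<Sum>f\<in>?E. (\<Sum>g\<in>?E. sdist G f g) + card ?E)"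
    by (intro sum.cong) auto
  moreover have "wsum G (\<lambda>_. 0) = (\<Sum>f\<in>?E. \<Sum>g\<in>?E. sdist G f g)"
    by (simp add: wsum_def sum_items[OF assms])
  moreover have "(\<Sum>f\<in>?E. (\<Sum>g\<in>?E. edge_dist G f g) + 1)
      = (\<Sum>f\<in>?E. \<Sum>g\<in>?E. edge_dist G f g) + card ?E"
    by (simp only: sum.distrib) simp
  moreover have "(\<Sum>f\<in>?E. (\<Sum>g\<in>?E. sdist G f g) + card ?E)
      = (\<Sum>f\<in>?E. \<Sum>g\<in>?E. sdist G f g) + card ?E * card ?E"
    by (simp add: sum.distrib)
  ultimately show ?thesis
    using edge_wiener_double_sum[OF fin] by linarith
qed

lemma wsum_expand:
  assumes "simple_graph G"
  shows "wsum G \<omega> = (\<Sum>e\<in>edges G. \<Sum>e'\<in>edges G. sdist G e e')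
    + 2 * (\<Sum>x\<in>verts G. \<omega> x * (\<Sum>e\<in>edges G. sdist G {x} e))
    + (\<Sum>x\<in>verts G. \<Sum>y\<in>verts G. \<omega> x * \<omega> y * gdist G x y)"
proof -
  have "(\<Sum>e\<in>edges G. \<Sum>y\<in>verts G. \<omega> y * sdist G e {y})
      = (\<Sum>y\<in>verts G. \<omega> y * (\<Sum>e\<in>edges G. sdist G {y} e))"
    by (subst sum.swap) (simp add: sum_distrib_left sdist_commute)
  moreover have "(\<Sum>x\<in>verts G. \<omega> x * (\<Sum>y\<in>verts G. \<omega> y * gdist G x y))
      = (\<Sum>x\<in>verts G. \<Sum>y\<in>verts G. \<omega> x * \<omega> y * gdist G x y)"
    by (simp add: sum_distrib_left mult.assoc)
  ultimately show ?thesis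
    by (simp add: wsum_def sum_items[OF assms] sum.distrib add_mult_distrib2)
qed

section \<open>Weighted cycles\<close>

lemma mod_shift_back: "i < c \<Longrightarrow> d \<le> c \<Longrightarrow> ((i + d) mod c + (c - d)) mod c = (i :: nat)"
  by (simp only: mod_add_left_eq) simp

lemma sum_rotate:
  fixes F :: "nat \<Rightarrow> 'b :: comm_monoid_add"
  assumes "i < c"
  shows "(\<Sum>d<c. F ((i + d) mod c)) = (\<Sum>j<c. F j)"
proof (rule sum.reindex_bij_witness[of _ "\<lambda>j. (j + (c - i)) mod c" "\<lambda>d. (i + d) mod c"])
  fix d assume "d \<in> {..<c}"
  then show "((i + d) mod c + (c - i)) mod c = d"
    using assms mod_shift_back[of d c i] by (simp only: lessThan_iff add.commute less_imp_le)
next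
  fix j assume "j \<in> {..<c}"
  then show "(i + (j + (c - i)) mod c) mod c = j"
    using assms by (simp add: mod_add_right_eq)
qed (use assms in auto)

definition cycle_edge :: "'a list \<Rightarrow> nat \<Rightarrow> 'a set" where
  "cycle_edge q i = {q ! i, q ! (Suc i mod length q)}"

lemma verts_cycle_subgraph [simp]: "verts (cycle_subgraph q) = set q"
  by (simp add: cycle_subgraph_def)

lemma edges_cycle_subgraph: "edges (cycle_subgraph q) = cycle_edge q ` {..<length q}"
  by (auto simp: cycle_subgraph_def cycle_edge_def)

context
  fixes q :: "'a list"
  assumes dist: "distinct q" and len: "3 \<le> length q"
begin

lemma cycle_nonempty: "q \<noteq> []"
  using len by auto

lemma cycle_edge_inj: "inj_on (cycle_edge q) {..<length q}"
proof (rule inj_onI)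
  fix i j assume ij: "i \<in> {..<length q}" "j \<in> {..<length q}" "cycle_edge q i = cycle_edge q j"
  have lt: "Suc i mod length q < length q" "Suc j mod length q < length q" using cycle_nonempty by simp_all
  have "i = j \<or> (i = Suc j mod length q \<and> j = Suc i mod length q)"
    using ij lt dist nth_eq_iff_index_eq[OF dist] by (auto simp: cycle_edge_def doubleton_eq_iff)
  moreover have False if "i = Suc j mod length q" "j = Suc i mod length q"
  proof -
    have "Suc (Suc i) mod length q = i" using that by (simp add: mod_Suc_eq)
    then show False using ij(1) len
      by (cases "Suc (Suc i) < length q") (auto simp: mod_if split: if_splits)
  qed
  ultimately show "i = j" by blast
qed

lemma card_edges_cycle: "card (edges (cycle_subgraph q)) = length q"
  by (simp add: edges_cycle_subgraph card_image[OF cycle_edge_inj])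

lemma simple_graph_cycle: "simple_graph (cycle_subgraph q)"
proof -
  have "q ! i \<noteq> q ! (Suc i mod length q)" if "i < length q" for i
  proof -
    have "i \<noteq> Suc i mod length q" using that len by (cases "Suc i < length q") (auto simp: mod_if)
    moreover have "Suc i mod length q < length q" using cycle_nonempty by simp
    ultimately show ?thesis using that nth_eq_iff_index_eq[OF dist] by blast
  qed
  moreover have "q ! (Suc i mod length q) \<in> set q" for i
    using cycle_nonempty by (intro nth_mem) simp
  ultimately show ?thesis
    by (auto simp: simple_graph_def edges_cycle_subgraph cycle_edge_def)
qed

lemma walk_cycle:
  assumes "i < length q"
  shows "\<exists>p. walk_betw (cycle_subgraph q) (q ! i) p (q ! ((i + d) mod length q)) \<and> length p = Suc d"
proof (induction d)
  case 0
  show ?case using assms by (intro exI[of _ "[q ! i]"]) (auto intro: walk_betw_refl)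
next
  case (Suc d)
  then obtain p where p: "walk_betw (cycle_subgraph q) (q ! i) p (q ! ((i + d) mod length q))" "length p = Suc d"
    by blast
  let ?j = "(i + d) mod length q"
  have j: "?j < length q" using cycle_nonempty by simp
  have "{q ! ?j, q ! (Suc ?j mod length q)} \<in> edges (cycle_subgraph q)"
    using j by (auto simp: edges_cycle_subgraph cycle_edge_def)
  from walk_betw_edge[OF this]
  have "walk_betw (cycle_subgraph q) (q ! ?j) [q ! ?j, q ! ((i + Suc d) mod length q)] (q ! ((i + Suc d) mod length q))"
    using j cycle_nonempty by (simp add: mod_Suc_eq)
  from walk_betw_append[OF p(1) this] show ?case using p(2)
    by (intro exI[of _ "p @ [q ! ((i + Suc d) mod length q)]"]) simp
qed

lemma connected_cycle: "connected_graph (cycle_subgraph q)"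
proof -
  have "\<exists>p. walk_betw (cycle_subgraph q) u p v" if uv: "u \<in> set q" "v \<in> set q" for u v
  proof -
    obtain i where i: "i < length q" "u = q ! i"
      using uv(1) by (metis in_set_conv_nth)
    obtain j where j: "j < length q" "v = q ! j"
      using uv(2) by (metis in_set_conv_nth)
    note ij = i j
    have "(i + (j + (length q - i))) mod length q = j" using ij by simp
    then show ?thesis using walk_cycle[OF ij(1), of "j + (length q - i)"] ij by auto
  qed
  moreover have "set q \<noteq> {}" using len by auto
  ultimately show ?thesis by (simp add: connected_graph_def)
qed

lemma gdist_cycle:
  assumes "i < length q"
  shows "gdist (cycle_subgraph q) (q ! i) (q ! ((i + d) mod length q)) \<le> d"
  using walk_cycle[OF assms, of d] gdist_le by fastforce

lemma gdist_cycle_back: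
  assumes "i < length q" "d \<le> length q"
  shows "gdist (cycle_subgraph q) (q ! i) (q ! ((i + d) mod length q)) \<le> length q - d"
proof -
  have "((i + d) mod length q + (length q - d)) mod length q = i"
    using assms by (rule mod_shift_back)
  then show ?thesis
    using gdist_cycle[of "(i + d) mod length q" "length q - d"] cycle_nonempty gdist_commute[of "cycle_subgraph q"] by simp
qed

end

text \<open>The edge that starts \<open>d\<close> steps after a vertex of a cycle of length
  \<open>c\<close> is reached by \<open>d\<close> steps forwards or \<open>c - 1 - d\<close> steps
  backwards, so this is the distance sum from a vertex to the edges. Seen from an edge, contract
  that edge: the sum becomes \<open>gapsum (c - 1)\<close>.\<close>

definition gapsum :: "nat \<Rightarrow> nat" where
  "gapsum c = (\<Sum>d<c. min d (c - 1 - d))"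

lemma gapsum_Suc_Suc: "gapsum (Suc (Suc c)) = gapsum c + c"
proof -
  have "gapsum (Suc (Suc c)) = (\<Sum>d<Suc c. min d (Suc c - d))"
    unfolding gapsum_def by simp
  also have "\<dots> = (\<Sum>d<c. min (Suc d) (Suc c - Suc d))"
    by (subst sum.lessThan_Suc_shift) simp
  also have "\<dots> = (\<Sum>d<c. min d (c - 1 - d) + 1)"
    by (intro sum.cong) auto
  also have "\<dots> = gapsum c + c"
    unfolding gapsum_def by (simp only: sum.distrib) simp
  finally show ?thesis .
qed

lemma gapsum_le: "4 * gapsum (Suc c) \<le> c * c"
proof (induction c rule: less_induct)
  case (less c)
  consider "c = 0" | "c = 1" | d where "c = Suc (Suc d)" by (metis One_nat_def not0_implies_Suc)
  then show ?case
  proof cases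
    case 3
    then show ?thesis using less[of d] by (simp add: gapsum_Suc_Suc)
  qed (simp_all add: gapsum_def)
qed

context
  fixes q :: "'a list" and \<omega> :: "'a \<Rightarrow> nat"
  assumes dist: "distinct q" and len: "3 \<le> length q"
begin

lemmas cycle_nonempty' = cycle_nonempty[OF dist len]

lemma sum_edges_cycle:
  assumes "i < length q"
  shows "(\<Sum>e\<in>edges (cycle_subgraph q). F e)
    = (\<Sum>d<length q. F (cycle_edge q ((i + d) mod length q)) :: nat)"
  by (simp add: edges_cycle_subgraph sum.reindex[OF cycle_edge_inj[OF dist len]]
      sum_rotate[OF assms, of "\<lambda>j. F (cycle_edge q j)"])

lemma sum_verts_cycle:
  assumes "i < length q"
  shows "(\<Sum>x\<in>set q. F x) = (\<Sum>d<length q. F (q ! ((i + d) mod length q)) :: nat)"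
proof -
  have "(\<Sum>x\<in>set q. F x) = (\<Sum>j<length q. F (q ! j))"
    using sum.reindex_bij_betw[OF bij_betw_nth[OF dist refl refl], of F] by simp
  then show ?thesis by (simp add: sum_rotate[OF assms, of "\<lambda>j. F (q ! j)"])
qed

lemma vertex_edges_cycle:
  assumes i: "i < length q"
  shows "(\<Sum>e\<in>edges (cycle_subgraph q). sdist (cycle_subgraph q) {q ! i} e) \<le> gapsum (length q)"
proof -
  let ?C = "cycle_subgraph q" and ?c = "length q"
  have "sdist ?C {q ! i} (cycle_edge q ((i + d) mod ?c)) \<le> min d (?c - 1 - d)" if "d < ?c" for d
  proof -
    let ?e = "cycle_edge q ((i + d) mod ?c)"
    have "sdist ?C {q ! i} ?e \<le> gdist ?C (q ! i) (q ! ((i + d) mod ?c))"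
      by (rule sdist_le) (auto simp: cycle_edge_def)
    moreover have "sdist ?C {q ! i} ?e \<le> gdist ?C (q ! i) (q ! ((i + Suc d) mod ?c))"
      by (rule sdist_le) (auto simp: cycle_edge_def mod_Suc_eq)
    ultimately show ?thesis
      using gdist_cycle[OF dist len i, of d] gdist_cycle_back[OF dist len i, of "Suc d"] that
      by simp
  qed
  then show ?thesis
    unfolding sum_edges_cycle[OF i] gapsum_def by (intro sum_mono) auto
qed

lemma edge_edges_cycle:
  assumes i: "i < length q"
  shows "(\<Sum>e\<in>edges (cycle_subgraph q). sdist (cycle_subgraph q) (cycle_edge q i) e)
    \<le> gapsum (length q - 1)"
proof -
  let ?C = "cycle_subgraph q" and ?c = "length q"
  let ?F = "\<lambda>d. sdist ?C (cycle_edge q i) (cycle_edge q ((i + d) mod ?c))"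
  have "?F (Suc d) \<le> min d (?c - 1 - 1 - d)" if "d < ?c - 1" for d
  proof -
    \<comment> \<open>Forward steps start at the second end of the given edge and backward steps at
      the first one, so the edge behaves like one vertex of a cycle that is shorter by 1.\<close>
    let ?i = "Suc i mod ?c"
    have i': "?i < ?c" using cycle_nonempty' by simp
    have "?F (Suc d) \<le> gdist ?C (q ! ?i) (q ! ((i + Suc d) mod ?c))"
      by (rule sdist_le) (auto simp: cycle_edge_def)
    moreover have "(i + Suc d) mod ?c = (?i + d) mod ?c"
      by (simp add: mod_add_left_eq)
    moreover have "?F (Suc d) \<le> gdist ?C (q ! i) (q ! ((i + Suc (Suc d)) mod ?c))"
      by (rule sdist_le) (auto simp: cycle_edge_def mod_Suc_eq)
    ultimately show ?thesis
      using gdist_cycle[OF dist len i', of d] gdist_cycle_back[OF dist len i, of "Suc (Suc d)"] that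
      by (simp add: Suc_le_eq less_diff_conv)
  qed
  then have "(\<Sum>d<?c - 1. ?F (Suc d)) \<le> gapsum (?c - 1)"
    unfolding gapsum_def by (intro sum_mono) auto
  moreover have "?F 0 = 0"
    using i by (intro sdist_eq_0[of _ _ "q ! i"]) (auto simp: cycle_edge_def)
  moreover have "(\<Sum>d<?c. ?F d) = ?F 0 + (\<Sum>d<?c - 1. ?F (Suc d))"
  proof -
    have "Suc (?c - 1) = ?c" using len by simp
    then show ?thesis using sum.lessThan_Suc_shift[of ?F "?c - 1"] by simp
  qed
  ultimately show ?thesis
    unfolding sum_edges_cycle[OF i] by linarith
qed

text \<open>The cyclic autocorrelation of the weights sorts the ordered pairs of vertices by their
  offset. Its invariance under rotation of both positions is what makes averaging over cuts
  possible.\<close>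

definition autocorr :: "nat \<Rightarrow> nat" where
  "autocorr d = (\<Sum>i<length q. \<omega> (q ! i) * \<omega> (q ! ((i + d) mod length q)))"

lemma vertices_cycle:
  "(\<Sum>x\<in>set q. \<Sum>y\<in>set q. \<omega> x * \<omega> y * gdist (cycle_subgraph q) x y)
    \<le> (\<Sum>d<length q. min d (length q - d) * autocorr d)"
proof -
  let ?C = "cycle_subgraph q" and ?c = "length q"
  have "(\<Sum>x\<in>set q. \<Sum>y\<in>set q. \<omega> x * \<omega> y * gdist ?C x y)
      = (\<Sum>i<?c. \<Sum>y\<in>set q. \<omega> (q ! i) * \<omega> y * gdist ?C (q ! i) y)"
    using sum.reindex_bij_betw[OF bij_betw_nth[OF dist refl refl],
        of "\<lambda>x. \<Sum>y\<in>set q. \<omega> x * \<omega> y * gdist ?C x y"] by simp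
  also have "\<dots> = (\<Sum>i<?c. \<Sum>d<?c. \<omega> (q ! i) * \<omega> (q ! ((i + d) mod ?c))
      * gdist ?C (q ! i) (q ! ((i + d) mod ?c)))"
    by (intro sum.cong refl sum_verts_cycle) auto
  also have "\<dots> \<le> (\<Sum>i<?c. \<Sum>d<?c. \<omega> (q ! i) * \<omega> (q ! ((i + d) mod ?c)) * min d (?c - d))"
    using gdist_cycle[OF dist len] gdist_cycle_back[OF dist len]
    by (intro sum_mono mult_le_mono2) auto
  also have "\<dots> = (\<Sum>d<?c. min d (?c - d) * autocorr d)"
    by (subst sum.swap) (simp add: autocorr_def sum_distrib_left mult_ac)
  finally show ?thesis .
qed

text \<open>Each of the \<open>c\<close> rotations of a fixed half cuts the cycle; a pair of vertices at
  distance \<open>\<delta>\<close> is separated by at least \<open>2 * \<delta>\<close> of these cuts.\<close>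

lemma cuts_cycle:
  fixes h defines "h \<equiv> length q div 2"
  shows "(\<Sum>d<length q. min d (length q - d) * autocorr d)
    \<le> (\<Sum>k<length q. (\<Sum>s<h. \<omega> (q ! ((k + s) mod length q)))
        * (\<Sum>r\<in>{h..<length q}. \<omega> (q ! ((k + r) mod length q))))"
proof -
  let ?c = "length q"
  let ?w = "\<lambda>i. \<omega> (q ! (i mod ?c))"
  let ?P = "{..<h} \<times> {h..<?c}"
  have corr: "(\<Sum>k<?c. ?w (k + s) * ?w (k + r)) = autocorr (r - s)" if "s < h" "h \<le> r" for s r
  proof -
    have "s < ?c" using that h_def by linarith
    have "autocorr (r - s) = (\<Sum>k<?c. ?w k * ?w (k + (r - s)))"
      by (simp add: autocorr_def)
    also have "\<dots> = (\<Sum>k<?c. ?w ((s + k) mod ?c) * ?w ((s + k) mod ?c + (r - s)))"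
      by (rule sum_rotate[OF \<open>s < ?c\<close>, symmetric])
    also have "\<dots> = (\<Sum>k<?c. ?w (k + s) * ?w (k + r))"
    proof (intro sum.cong refl)
      fix k
      have "s + k + (r - s) = k + r" using that by simp
      then have "((s + k) mod ?c + (r - s)) mod ?c = (k + r) mod ?c"
        by (simp only: mod_add_left_eq)
      then show "?w ((s + k) mod ?c) * ?w ((s + k) mod ?c + (r - s)) = ?w (k + s) * ?w (k + r)"
        by (simp add: add.commute)
    qed
    finally show ?thesis by simp
  qed
  have "(\<Sum>k<?c. (\<Sum>s<h. ?w (k + s)) * (\<Sum>r\<in>{h..<?c}. ?w (k + r)))
      = (\<Sum>k<?c. \<Sum>(s, r)\<in>?P. ?w (k + s) * ?w (k + r))"
    by (simp add: sum_product sum.cartesian_product)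
  also have "\<dots> = (\<Sum>(s, r)\<in>?P. \<Sum>k<?c. ?w (k + s) * ?w (k + r))"
    by (subst sum.swap) (simp add: case_prod_unfold)
  also have "\<dots> = (\<Sum>p\<in>?P. autocorr (snd p - fst p))"
    using corr by (intro sum.cong) auto
  also have "\<dots> = (\<Sum>d<?c. \<Sum>p\<in>{p \<in> ?P. snd p - fst p = d}. autocorr (snd p - fst p))"
    by (rule sum.group[symmetric]) auto
  also have "\<dots> = (\<Sum>d<?c. card {p \<in> ?P. snd p - fst p = d} * autocorr d)"
    by (intro sum.cong) auto
  also have "\<dots> \<ge> (\<Sum>d<?c. min d (?c - d) * autocorr d)"
  proof (intro sum_mono mult_le_mono1)
    fix d assume "d \<in> {..<?c}"
    \<comment> \<open>These are the \<open>s\<close> for which position \<open>s\<close> lies in the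
      half, \<open>s + d\<close> lies outside it, and no wrap-around occurs. Since \<open>h\<close>
      is half of the length, rounded down, their number is at least \<open>min d (c - d)\<close> for
      the length \<open>c\<close>.\<close>
    let ?I = "{h - d..<min h (?c - d)}"
    have "(\<lambda>s. (s, s + d)) ` ?I \<subseteq> {p \<in> ?P. snd p - fst p = d}" by auto
    then have "card ((\<lambda>s. (s, s + d)) ` ?I) \<le> card {p \<in> ?P. snd p - fst p = d}"
      by (intro card_mono) auto
    moreover have "card ((\<lambda>s. (s, s + d)) ` ?I) = min h (?c - d) - (h - d)"
      by (subst card_image) (auto simp: inj_on_def)
    moreover have "min d (?c - d) \<le> min h (?c - d) - (h - d)"
      using \<open>d \<in> {..<?c}\<close> unfolding h_def by (auto simp: min_def)
    ultimately show "min d (?c - d) \<le> card {p \<in> ?P. snd p - fst p = d}" by linarith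
  qed
  finally show ?thesis .
qed

text \<open>Some cut is at least as good as the average of all rotations, so the distance sum of the
  vertex pairs is at most \<open>length q\<close> times the product of the weights of its two sides.
  Only these two total weights remain, which makes the cycle comparable with a chain with weighted
  ends.\<close>

lemma wsum_cycle_le:
  obtains U where "U \<subseteq> set q"
    "wsum (cycle_subgraph q) \<omega> \<le> length q * gapsum (length q - 1)
      + 2 * ((sum \<omega> U + sum \<omega> (set q - U)) * gapsum (length q))
      + length q * (sum \<omega> U * sum \<omega> (set q - U))"
proof -
  let ?C = "cycle_subgraph q" and ?c = "length q"
  define h where "h = ?c div 2"
  let ?L = "\<lambda>k. \<Sum>s<h. \<omega> (q ! ((k + s) mod ?c))"
  let ?R = "\<lambda>k. \<Sum>r\<in>{h..<?c}. \<omega> (q ! ((k + r) mod ?c))"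
  define Y where "Y = (\<Sum>x\<in>set q. \<Sum>y\<in>set q. \<omega> x * \<omega> y * gdist ?C x y)"
  have "Y \<le> (\<Sum>k<?c. ?L k * ?R k)"
    using vertices_cycle cuts_cycle unfolding Y_def h_def by linarith
  moreover have "(\<Sum>k<?c. ?L k * ?R k) < Y" if "\<And>k. k < ?c \<Longrightarrow> ?c * (?L k * ?R k) < Y"
  proof -
    have "?c * (\<Sum>k<?c. ?L k * ?R k) = (\<Sum>k<?c. ?c * (?L k * ?R k))"
      by (rule sum_distrib_left)
    also have "\<dots> < (\<Sum>k<?c. Y)"
      using cycle_nonempty' by (intro sum_strict_mono that) auto
    finally have "?c * (\<Sum>k<?c. ?L k * ?R k) < ?c * Y" by simp
    then show ?thesis by simp
  qed
  ultimately obtain k where k: "k < ?c" "Y \<le> ?c * (?L k * ?R k)"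
    by (meson not_le)
  let ?g = "\<lambda>s. q ! ((k + s) mod ?c)"
  have inj: "inj_on ?g {..<?c}"
  proof (rule inj_onI)
    fix s r assume sr: "s \<in> {..<?c}" "r \<in> {..<?c}" "?g s = ?g r"
    have "(k + s) mod ?c < ?c" "(k + r) mod ?c < ?c" using cycle_nonempty' by simp_all
    then have eq: "(k + s) mod ?c = (k + r) mod ?c" using sr nth_eq_iff_index_eq[OF dist] by blast
    have "((u + k) mod ?c + (?c - k)) mod ?c = u" if "u < ?c" for u
      using k that by (intro mod_shift_back) auto
    then show "s = r" using sr eq by (metis lessThan_iff add.commute)
  qed
  define U where "U = ?g ` {..<h}"
  have img: "?g ` {..<?c} = set q"
  proof (rule card_subset_eq)
    show "?g ` {..<?c} \<subseteq> set q" using cycle_nonempty' by (auto intro!: nth_mem)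
    show "card (?g ` {..<?c}) = card (set q)"
      by (simp add: card_image[OF inj] distinct_card[OF dist])
  qed simp
  have hc: "h \<le> ?c" by (simp add: h_def)
  have compl: "set q - U = ?g ` {h..<?c}"
  proof -
    have eq: "{..<?c} - {..<h} = {h..<?c}" by auto
    have "{..<h} \<subseteq> {..<?c}" using hc by simp
    then have "?g ` ({..<?c} - {..<h}) = ?g ` {..<?c} - ?g ` {..<h}"
      by (intro inj_on_image_set_diff[OF inj]) auto
    then show ?thesis unfolding U_def img eq by simp
  qed
  have L: "sum \<omega> U = ?L k"
    unfolding U_def using hc by (subst sum.reindex) (auto intro: inj_on_subset[OF inj])
  have R: "sum \<omega> (set q - U) = ?R k"
    unfolding compl by (subst sum.reindex) (auto intro: inj_on_subset[OF inj])
  have U: "U \<subseteq> set q" using img hc unfolding U_def by (metis image_mono lessThan_subset_iff)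
  have tot: "sum \<omega> (set q) = sum \<omega> U + sum \<omega> (set q - U)"
    using U by (simp add: sum.subset_diff[OF U] add.commute)
  have E: "(\<Sum>e\<in>edges ?C. \<Sum>e'\<in>edges ?C. sdist ?C e e') \<le> ?c * gapsum (?c - 1)"
  proof -
    have "(\<Sum>e\<in>edges ?C. \<Sum>e'\<in>edges ?C. sdist ?C e e') \<le> (\<Sum>e\<in>edges ?C. gapsum (?c - 1))"
      using edge_edges_cycle by (intro sum_mono) (auto simp: edges_cycle_subgraph)
    then show ?thesis by (simp add: card_edges_cycle[OF dist len])
  qed
  have V: "(\<Sum>x\<in>set q. \<omega> x * (\<Sum>e\<in>edges ?C. sdist ?C {x} e)) \<le> sum \<omega> (set q) * gapsum ?c"
    unfolding sum_distrib_right using vertex_edges_cycle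
    by (intro sum_mono mult_le_mono2) (auto simp: in_set_conv_nth)
  have "wsum ?C \<omega> \<le> ?c * gapsum (?c - 1) + 2 * (sum \<omega> (set q) * gapsum ?c) + ?c * (?L k * ?R k)"
    unfolding wsum_expand[OF simple_graph_cycle[OF dist len]]
    using E V k(2) unfolding Y_def by simp
  then show ?thesis
    using that[OF U] unfolding tot L R by simp
qed

end

text \<open>\<open>R\<close> is the bound for the weighted cycle with side weights \<open>A\<close>
  and \<open>B\<close>; \<open>V\<close> belongs to a chain that also has \<open>c\<close> edges,
  with its triangle at the lighter end. The second hypothesis excludes the unweighted 4-cycle, where
  \<open>R = 4\<close> and \<open>V = 2\<close>. For the unweighted pentagon both are 10.\<close>

lemma cval_connection:
  fixes A B c :: nat
  assumes "4 \<le> c" "5 \<le> A + B + c" "A \<le> B"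
  defines "R \<equiv> c * gapsum (c - 1) + 2 * ((A + B) * gapsum c) + c * (A * B)"
    and "V \<equiv> 2 * cval A (True # replicate (c - 3) False) B"
  shows "R \<le> V" and "R = V \<Longrightarrow> A = 0 \<and> B = 0 \<and> c = 5"
proof -
  have g: "gapsum 3 = 1" "gapsum 4 = 2" "gapsum 5 = 4"
    by (simp_all add: gapsum_def numeral_eq_Suc)
  have "R < V \<or> (R = V \<and> A = 0 \<and> B = 0 \<and> c = 5)"
  proof -
    have "c = 4 \<or> c = 5 \<or> c = (c - 6) + 6" using assms(1) by linarith
    then consider "c = 4" | "c = 5" | N where "c = N + 6" by blast
    then show ?thesis
    proof cases
      case 1
      \<comment> \<open>In this case \<open>V - R = 4 * B - 2\<close>, so it matters that the
        heavier side has positive weight.\<close>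
      have B1: "1 < B * 2" using 1 assms(2,3) by presburger
      have "replicate (4 - 3) False = [False]" by simp
      then show ?thesis using assms(2,3) 1 g B1 unfolding R_def V_def by (simp add: algebra_simps)
    next
      case 2
      \<comment> \<open>Here \<open>V - R = A * B + 8 * B\<close>, which vanishes only for
        \<open>B = 0\<close>, and then also \<open>A = 0\<close>.\<close>
      have "replicate (5 - 3) False = [False, False]" by (simp add: numeral_eq_Suc)
      then show ?thesis using assms(2,3) 2 g unfolding R_def V_def
        by (auto simp: algebra_simps)
    next
      case 3
      \<comment> \<open>From length 6 on the estimate \<open>gapsum_le\<close> is good enough.
        Writing \<open>c = N + 6\<close> and \<open>B = A + D\<close>, the difference to
        \<open>V\<close> becomes a polynomial in \<open>A\<close>, \<open>D\<close> and
        \<open>N\<close> with nonnegative coefficients and constant term 2.\<close>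
      define D where "D = B - A"
      have B: "B = A + D" using assms(3) by (simp add: D_def)
      have "4 * gapsum c \<le> (N + 5) * (N + 5)" "4 * gapsum (c - 1) \<le> (N + 4) * (N + 4)"
        using gapsum_le[of "N + 5"] gapsum_le[of "N + 4"] 3 by (simp_all add: eval_nat_numeral)
      then have "4 * real (gapsum c) \<le> real ((N + 5) * (N + 5))"
        "4 * real (gapsum (c - 1)) \<le> real ((N + 4) * (N + 4))"
        by linarith+
      then have g: "real (gapsum c) \<le> real ((N + 5) * (N + 5)) / 4"
        "real (gapsum (c - 1)) \<le> real ((N + 4) * (N + 4)) / 4"
        by simp_all
      have "real R \<le> real c * (real ((N + 4) * (N + 4)) / 4)
          + 2 * (real (A + B) * (real ((N + 5) * (N + 5)) / 4)) + real (c * (A * B))"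
        unfolding R_def of_nat_add of_nat_mult of_nat_numeral
        using g[unfolded of_nat_add of_nat_mult of_nat_numeral]
        by (intro add_mono mult_left_mono) simp_all
      also have "\<dots> < real V"
      proof -
        have "real V = 2 * (real A * (real (N + 3) + B) + (real A + N + 3 + B))
            + 2 * real (cval (A + 3) (replicate (N + 3) False) B)"
          by (simp add: V_def 3 add.commute)
        also have "\<dots> = real c * (real ((N + 4) * (N + 4)) / 4)
          + 2 * (real (A + B) * (real ((N + 5) * (N + 5)) / 4)) + real (c * (A * B))
          + (2 + 15 * real A + 2 * real A * real A + 1 * real A * real A * real N + 2 * real A * real D + 1 * real A * real D * real N + 8 * real A * real N + 1 * real A * real N * real N + 27 / 2 * real D + 6 * real D * real N + 1 / 2 * real D * real N * real N + 14 / 3 * real N + 3 / 2 * real N * real N + 1 / 12 * real N * real N * real N)"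
          unfolding cval_replicate_False B 3 by (simp add: field_simps)
        also have "\<dots> > real c * (real ((N + 4) * (N + 4)) / 4)
          + 2 * (real (A + B) * (real ((N + 5) * (N + 5)) / 4)) + real (c * (A * B))"
          unfolding less_add_same_cancel1
          by (intro add_pos_nonneg mult_nonneg_nonneg divide_nonneg_nonneg) simp_all
        finally show ?thesis .
      qed
      finally show ?thesis by simp
    qed
  qed
  then show "R \<le> V" and "R = V \<Longrightarrow> A = 0 \<and> B = 0 \<and> c = 5" by auto
qed

section \<open>Chains and blocks as graphs\<close>

lemma wsum_cong:
  assumes "simple_graph G" "\<And>x. x \<in> verts G \<Longrightarrow> \<omega> x = \<omega>' x"
  shows "wsum G \<omega> = wsum G \<omega>'"
  unfolding wsum_expand[OF assms(1)] using assms(2) by (simp cong: sum.cong)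

lemma mass_cong: "(\<And>x. x \<in> verts G \<Longrightarrow> \<omega> x = \<omega>' x) \<Longrightarrow> mass G \<omega> = mass G \<omega>'"
  by (simp add: mass_def)

definition edge_graph :: "'a \<Rightarrow> 'a \<Rightarrow> 'a ugraph" where
  "edge_graph u v = ({u, v}, {{u, v}})"

definition triangle_graph :: "'a \<Rightarrow> 'a \<Rightarrow> 'a \<Rightarrow> 'a ugraph" where
  "triangle_graph u v z = ({u, v, z}, {{u, v}, {u, z}, {v, z}})"

lemma edge_graph_simps [simp]:
  "verts (edge_graph u v) = {u, v}" "edges (edge_graph u v) = {{u, v}}"
  by (simp_all add: edge_graph_def)

lemma triangle_graph_simps [simp]:
  "verts (triangle_graph u v z) = {u, v, z}" "edges (triangle_graph u v z) = {{u, v}, {u, z}, {v, z}}"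
  by (simp_all add: triangle_graph_def)

lemma edge_graph_commute: "edge_graph u v = edge_graph v u"
  by (auto simp: edge_graph_def)

lemma triangle_graph_perm:
  "triangle_graph u v z = triangle_graph v u z" "triangle_graph u v z = triangle_graph u z v"
  by (auto simp: triangle_graph_def)

lemma complete_connected:
  assumes "simple_graph G" "verts G \<noteq> {}"
    "\<And>u v. u \<in> verts G \<Longrightarrow> v \<in> verts G \<Longrightarrow> u \<noteq> v \<Longrightarrow> {u, v} \<in> edges G"
  shows "connected_graph G"
  unfolding connected_graph_def using assms walk_betw_refl walk_betw_edge by metis

lemma edge_graph_simple: "u \<noteq> v \<Longrightarrow> simple_graph (edge_graph u v)"
  by (simp add: simple_graph_def)

lemma edge_graph_connected: "u \<noteq> v \<Longrightarrow> connected_graph (edge_graph u v)"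
  by (rule complete_connected[OF edge_graph_simple]) auto

lemma triangle_graph_simple: "distinct [u, v, z] \<Longrightarrow> simple_graph (triangle_graph u v z)"
  by (auto simp: simple_graph_def)

lemma triangle_graph_connected: "distinct [u, v, z] \<Longrightarrow> connected_graph (triangle_graph u v z)"
  by (rule complete_connected[OF triangle_graph_simple]) auto

lemma wsum_edge_graph:
  assumes "u \<noteq> v"
  shows "wsum (edge_graph u v) \<omega> = 2 * (\<omega> u * \<omega> v)"
proof -
  let ?G = "edge_graph u v"
  have d: "gdist ?G u v = 1"
    by (rule gdist_edge) (use assms edge_graph_simple edge_graph_connected in auto)
  have s: "sdist ?G I J = 0" if IJ: "I \<inter> J \<noteq> {}" "I \<subseteq> {u, v}" "J \<subseteq> {u, v}" for I J
  proof -
    obtain w where "w \<in> I" "w \<in> J" using IJ(1) by auto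
    then show ?thesis using IJ by (intro sdist_eq_0[of _ _ w]) (auto intro: finite_subset)
  qed
  show ?thesis
    using assms gdist_commute[of ?G v u]
    by (simp add: wsum_expand[OF edge_graph_simple[OF assms]] s d mult.commute)
qed

lemma wsum_triangle_graph:
  assumes "distinct [u, v, z]"
  shows "wsum (triangle_graph u v z) \<omega>
    = 2 * (\<omega> u * \<omega> v + \<omega> u * \<omega> z + \<omega> v * \<omega> z + (\<omega> u + \<omega> v + \<omega> z))"
proof -
  let ?G = "triangle_graph u v z"
  have uvz: "u \<noteq> v" "u \<noteq> z" "v \<noteq> z" "v \<noteq> u" "z \<noteq> u" "z \<noteq> v" using assms by auto
  have d: "gdist ?G a b = 1" if "a \<in> {u, v, z}" "b \<in> {u, v, z}" "a \<noteq> b" for a b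
    by (rule gdist_edge[OF triangle_graph_simple triangle_graph_connected]; use assms that in auto)
  have s: "sdist ?G I J = 0" if IJ: "I \<inter> J \<noteq> {}" "I \<subseteq> {u, v, z}" "J \<subseteq> {u, v, z}" for I J
  proof -
    obtain w where "w \<in> I" "w \<in> J" using IJ(1) by auto
    then show ?thesis using IJ by (intro sdist_eq_0[of _ _ w]) (auto intro: finite_subset)
  qed
  have s1: "sdist ?G {a} {b, c} = 1" if "a \<in> {u, v, z}" "b \<in> {u, v, z}" "c \<in> {u, v, z}" "a \<noteq> b" "a \<noteq> c" for a b c
    using d[OF that(1,2,4)] d[OF that(1,3,5)] by (intro sdist_eqI[of _ _ a b]) auto
  have ne: "{u, v} \<noteq> {u, z}" "{u, v} \<noteq> {v, z}" "{u, z} \<noteq> {v, z}"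
    using uvz by (auto simp: doubleton_eq_iff)
  have E: "(\<Sum>e\<in>edges ?G. \<Sum>e'\<in>edges ?G. sdist ?G e e') = 0"
    by (intro sum.neutral ballI s) auto
  have s0: "sdist ?G {a} {a, b} = 0" "sdist ?G {a} {b, a} = 0"
    if "a \<in> {u, v, z}" "b \<in> {u, v, z}" for a b
    using that by (auto intro!: s)
  have V: "(\<Sum>e\<in>edges ?G. sdist ?G {x} e) = 1" if "x \<in> verts ?G" for x
  proof -
    have "(\<Sum>e\<in>edges ?G. sdist ?G {x} e)
        = sdist ?G {x} {u, v} + sdist ?G {x} {u, z} + sdist ?G {x} {v, z}"
      using ne by simp
    moreover have "x = u \<or> x = v \<or> x = z" using that by simp
    ultimately show ?thesis
      using s0[of u v] s0[of u z] s0[of v z] s0[of v u] s0[of z u] s0[of z v]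
        s1[of u v z] s1[of v u z] s1[of z u v] uvz by (elim disjE) simp_all
  qed
  have "(\<Sum>x\<in>verts ?G. \<omega> x * (\<Sum>e\<in>edges ?G. sdist ?G {x} e)) = (\<Sum>x\<in>verts ?G. \<omega> x)"
    by (rule sum.cong[OF refl]) (simp only: V nat_mult_1_right)
  then have "wsum ?G \<omega> = 2 * (\<Sum>x\<in>verts ?G. \<omega> x)
      + (\<Sum>x\<in>verts ?G. \<Sum>y\<in>verts ?G. \<omega> x * \<omega> y * gdist ?G x y)"
    unfolding wsum_expand[OF triangle_graph_simple[OF assms]] E by (simp only: add_0)
  also have "\<dots> = 2 * (\<omega> u * \<omega> v + \<omega> u * \<omega> z + \<omega> v * \<omega> z + (\<omega> u + \<omega> v + \<omega> z))"
    using uvz by (simp add: d algebra_simps)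
  finally show ?thesis .
qed

section \<open>Chains as graphs\<close>

definition link :: "bool \<Rightarrow> 'a ugraph \<Rightarrow> 'a \<Rightarrow> 'a \<Rightarrow> bool" where
  "link s B u v \<longleftrightarrow> (if s then \<exists>z. distinct [u, v, z] \<and> B = triangle_graph u v z
     else u \<noteq> v \<and> B = edge_graph u v)"

lemma link_commute: "link s B u v \<longleftrightarrow> link s B v u"
  unfolding link_def using edge_graph_commute triangle_graph_perm(1)
  by (auto simp: edge_graph_commute[of u v] triangle_graph_perm(1)[of u v])

lemma linkE:
  assumes "link s B u v"
  obtains "\<not> s" "u \<noteq> v" "B = edge_graph u v"
  | z where "s" "distinct [u, v, z]" "B = triangle_graph u v z"
  using assms by (cases s) (auto simp: link_def)

lemma link_simple: "link s B u v \<Longrightarrow> simple_graph B"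
  by (erule linkE) (metis edge_graph_simple triangle_graph_simple)+

lemma link_connected: "link s B u v \<Longrightarrow> connected_graph B"
  by (erule linkE) (metis edge_graph_connected triangle_graph_connected)+

lemma link_verts: "link s B u v \<Longrightarrow> u \<in> verts B \<and> v \<in> verts B \<and> u \<noteq> v"
  by (erule linkE) simp_all

lemma link_card_edges: "link s B u v \<Longrightarrow> card (edges B) = bsize s"
  by (auto simp: link_def card_insert_if doubleton_eq_iff split: if_splits)

text \<open>Each attachment vertex of a triangle has exactly one edge at distance 1, the opposite
  one. This is the origin of the extra summand for triangles in \<open>cval\<close>. The factor 2
  comes from counting ordered pairs.\<close>

lemma link_wsum:
  assumes "link s B u v" "\<And>z. z \<in> verts B \<Longrightarrow> z \<noteq> u \<Longrightarrow> z \<noteq> v \<Longrightarrow> \<omega> z = 0"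
  shows "wsum B \<omega> = 2 * (\<omega> u * \<omega> v + (if s then \<omega> u + \<omega> v else 0))"
  using assms(1)
proof (cases rule: linkE)
  case (2 z)
  then have "\<omega> z = 0" using assms(2)[of z] by auto
  with 2 show ?thesis by (simp add: wsum_triangle_graph)
qed (simp add: wsum_edge_graph)

text \<open>A relation instead of a function, because one graph has several readings: from either
  end, and with different choices of the free vertex in a terminal triangle. The equality case has
  to accept all of them.\<close>

inductive chain_graph :: "'a ugraph \<Rightarrow> 'a \<Rightarrow> bool list \<Rightarrow> 'a \<Rightarrow> bool" where
  Nil: "chain_graph ({u}, {}) u [] u"
| Cons: "link s B u v \<Longrightarrow> chain_graph X v S w \<Longrightarrow> verts B \<inter> verts X = {v} \<Longrightarrow>
    chain_graph (graph_union B X) u (s # S) w"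

lemma chain_graph_Nil_iff: "chain_graph X u [] w \<longleftrightarrow> w = u \<and> X = ({u}, {})"
  by (auto intro: chain_graph.Nil elim: chain_graph.cases)

lemma single_graph_simple: "simple_graph ({u}, {})"
  by (simp add: simple_graph_def)

lemma single_graph_connected: "connected_graph ({u}, {})"
  by (rule complete_connected[OF single_graph_simple]) auto

lemma chain_graph_verts: "chain_graph X u S w \<Longrightarrow> u \<in> verts X \<and> w \<in> verts X"
  by (induction rule: chain_graph.induct) (auto dest: link_verts)

lemma chain_graph_simple: "chain_graph X u S w \<Longrightarrow> simple_graph X"
  by (induction rule: chain_graph.induct)
     (auto simp: single_graph_simple intro!: simple_graph_union dest: link_simple)

lemma chain_graph_connected: "chain_graph X u S w \<Longrightarrow> connected_graph X"
proof (induction rule: chain_graph.induct)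
  case (Cons s B u v X S w)
  then show ?case
    using chain_graph_simple[OF Cons(2)] link_simple[OF Cons(1)] link_connected[OF Cons(1)]
    by (intro connected_graph_union[of B X v]) auto
qed (rule single_graph_connected)

lemma edges_disjoint:
  assumes "simple_graph H" "simple_graph B" "verts H \<inter> verts B = {x}"
  shows "edges H \<inter> edges B = {}"
proof -
  have False if e: "e \<in> edges H" "e \<in> edges B" for e
  proof -
    have "e \<subseteq> verts H" "e \<subseteq> verts B" "card e = 2"
      using assms(1,2) e by (auto simp: simple_graph_def)
    then have "e \<subseteq> {x}" "card e = 2" using assms(3) by blast+
    then have "2 \<le> card {x}" by (metis card_mono finite.emptyI finite_insert)
    then show False by simp
  qed
  then show ?thesis by auto
qed

lemma card_edges_union:
  assumes "simple_graph H" "simple_graph B" "verts H \<inter> verts B = {x}"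
  shows "card (edges (graph_union H B)) = card (edges H) + card (edges B)"
  using assms by (simp add: card_Un_disjoint simple_finite_edges edges_disjoint)

lemma chain_graph_card_edges: "chain_graph X u S w \<Longrightarrow> card (edges X) = csize S"
proof (induction rule: chain_graph.induct)
  case (Cons s B u v X S w)
  then show ?case
    using card_edges_union[OF link_simple[OF Cons(1)] chain_graph_simple[OF Cons(2)] Cons(3)]
      link_card_edges[OF Cons(1)] by simp
qed simp

lemma chain_graph_single: "link s B u v \<Longrightarrow> chain_graph B u [s] v"
proof -
  assume l: "link s B u v"
  have "chain_graph (graph_union B ({v}, {})) u [s] v"
    by (rule chain_graph.Cons[OF l chain_graph.Nil]) (use link_verts[OF l] in auto)
  moreover have "graph_union B ({v}, {}) = B"
    using link_verts[OF l] by (intro prod_eqI) auto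
  ultimately show ?thesis by simp
qed

lemma chain_graph_append:
  assumes "chain_graph X u S v" "chain_graph Y v T w" "verts X \<inter> verts Y = {v}"
  shows "chain_graph (graph_union X Y) u (S @ T) w"
  using assms
proof (induction rule: chain_graph.induct)
  case (Nil u)
  have "graph_union ({u}, {}) Y = Y"
    using chain_graph_verts[OF Nil(1)] by (intro prod_eqI) auto
  then show ?case using Nil by simp
next
  case (Cons s B u v' X S v)
  have v: "v \<in> verts X" "v' \<in> verts X" using chain_graph_verts[OF Cons(2)] by auto
  have XY: "verts X \<inter> verts Y = {v}"
    using Cons.prems(2) v chain_graph_verts[OF Cons.prems(1)] by auto
  have BXY: "verts B \<inter> verts (graph_union X Y) = {v'}"
    using Cons.hyps(3) Cons.prems(2) v by auto
  have "chain_graph (graph_union B (graph_union X Y)) u (s # S @ T) w"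
    by (rule chain_graph.Cons[OF Cons.hyps(1) Cons.IH[OF Cons.prems(1) XY] BXY])
  moreover have "graph_union B (graph_union X Y) = graph_union (graph_union B X) Y"
    by (auto simp: graph_union_def)
  ultimately show ?case by simp
qed

lemma chain_graph_rev: "chain_graph X u S w \<Longrightarrow> chain_graph X w (rev S) u"
proof (induction rule: chain_graph.induct)
  case (Cons s B u v X S w)
  have "chain_graph B v [s] u"
    using Cons(1) by (intro chain_graph_single) (simp add: link_commute)
  from chain_graph_append[OF Cons.IH this] show ?case
    using Cons(3) by (simp add: graph_union_commute Int_commute)
qed (simp add: chain_graph.Nil)

text \<open>Cutting behind the first block turns the rest into the weight \<open>csize S\<close> at
  \<open>v\<close> for that block, and turns the block together with \<open>p\<close> into the
  weight \<open>p + bsize s\<close> for the rest. This is the recursion of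
  \<open>cval\<close>.\<close>

lemma wsum_chain_graph:
  "chain_graph X u S w \<Longrightarrow> wsum X ((\<lambda>_. 0)(u := p)) = 2 * cval p S 0"
proof (induction arbitrary: p rule: chain_graph.induct)
  case (Nil u)
  then show ?case by (simp add: wsum_expand[OF single_graph_simple])
next
  case (Cons s B u v X S w)
  let ?\<omega> = "(\<lambda>_. 0)(u := p) :: 'a \<Rightarrow> nat"
  note B = link_simple[OF Cons(1)] link_connected[OF Cons(1)]
  note X = chain_graph_simple[OF Cons(2)] chain_graph_connected[OF Cons(2)]
  have uv: "u \<in> verts B" "v \<in> verts B" "u \<noteq> v" "v \<in> verts X"
    using link_verts[OF Cons(1)] chain_graph_verts[OF Cons(2)] by auto
  have uX: "u \<notin> verts X" using uv Cons(3) by auto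
  have mB: "mass B ?\<omega> = bsize s + p"
    using uv simple_finite_verts[OF B(1)] by (simp add: mass_def link_card_edges[OF Cons(1)])
  have "mass X (?\<omega>(v := 0)) = mass X (\<lambda>_. 0)"
    by (rule mass_cong) (use uX in auto)
  then have mX: "mass X (?\<omega>(v := 0)) = csize S"
    by (simp add: mass_def chain_graph_card_edges[OF Cons(2)])
  have "wsum X (?\<omega>(v := mass B ?\<omega>)) = wsum X ((\<lambda>_. 0)(v := p + bsize s))"
    by (rule wsum_cong[OF X(1)]) (use uX mB in auto)
  then have "wsum X (?\<omega>(v := mass B ?\<omega>)) = 2 * cval (p + bsize s) S 0"
    using Cons.IH by simp
  moreover have "wsum B (?\<omega>(v := ?\<omega> v + mass X (?\<omega>(v := 0))))
      = 2 * (p * csize S + (if s then p + csize S else 0))"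
    using uv by (subst link_wsum[OF Cons(1)]) (auto simp: mX)
  ultimately show ?case
    unfolding wsum_union[OF B X Cons(3), of ?\<omega>] by simp
qed

section \<open>Blocks and generated cacti\<close>

definition block :: "'a ugraph \<Rightarrow> nat \<Rightarrow> bool" where
  "block B s \<longleftrightarrow> (s = 0 \<and> (\<exists>x y. x \<noteq> y \<and> B = edge_graph x y)) \<or>
     (s = 1 \<and> (\<exists>q. distinct q \<and> 3 \<le> length q \<and> B = cycle_subgraph q))"

inductive cactus_gen :: "'a ugraph \<Rightarrow> nat \<Rightarrow> bool" where
  single: "cactus_gen ({v}, {}) 0"
| glue: "cactus_gen H t \<Longrightarrow> block B s \<Longrightarrow> verts H \<inter> verts B = {x} \<Longrightarrow>
    cactus_gen (graph_union H B) (t + s)"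

lemma block_simple: "block B s \<Longrightarrow> simple_graph B"
  and block_connected: "block B s \<Longrightarrow> connected_graph B"
  by (auto simp: block_def edge_graph_simple edge_graph_connected simple_graph_cycle connected_cycle)

lemma block_card: "block B s \<Longrightarrow> card (edges B) + 1 = card (verts B) + s"
  and block_card_ge: "block B s \<Longrightarrow> 2 * s + 1 \<le> card (verts B)"
  by (auto simp: block_def card_edges_cycle distinct_card)

lemma cactus_gen_simple: "cactus_gen H t \<Longrightarrow> simple_graph H"
  by (induction rule: cactus_gen.induct) (metis single_graph_simple simple_graph_union block_simple)+

lemma cactus_gen_connected: "cactus_gen H t \<Longrightarrow> connected_graph H"
proof (induction rule: cactus_gen.induct)
  case (glue H t B s x)
  then show ?case
    by (intro connected_graph_union[of H B x])
       (auto simp: cactus_gen_simple block_simple block_connected)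
qed (rule single_graph_connected)

lemma cactus_gen_card:
  "cactus_gen H t \<Longrightarrow> card (edges H) + 1 = card (verts H) + t \<and> 2 * t + 1 \<le> card (verts H)"
proof (induction rule: cactus_gen.induct)
  case (glue H t B s x)
  have fin: "finite (verts H)" "finite (verts B)"
    using glue by (auto simp: simple_finite_verts cactus_gen_simple block_simple)
  have "card (verts (graph_union H B)) + 1 = card (verts H) + card (verts B)"
    using card_Un_Int[OF fin] glue(3) by simp
  then show ?case
    using conjunct1[OF glue.IH] conjunct2[OF glue.IH] block_card[OF glue(2)] block_card_ge[OF glue(2)]
      card_edges_union[OF cactus_gen_simple[OF glue(1)] block_simple[OF glue(2)] glue(3)]
    by simp
qed simp

section \<open>Replacing blocks by chains\<close>

text \<open>The chains \<open>S y\<close> hang at the vertices \<open>y\<close> of \<open>H\<close>. They enter the weighted sum only through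
  their sizes; \<open>K\<close> is a realization by disjoint graphs, needed for the equality case.\<close>

definition decorated :: "'a ugraph \<Rightarrow> ('a \<Rightarrow> 'a ugraph) \<Rightarrow> ('a \<Rightarrow> bool list) \<Rightarrow> bool" where
  "decorated H K S \<longleftrightarrow> (\<forall>y\<in>verts H. \<exists>e. chain_graph (K y) y (S y) e) \<and>
     (\<forall>y\<in>verts H. \<forall>z\<in>verts H. y \<noteq> z \<longrightarrow> verts (K y) \<inter> verts (K z) = {})"

definition realize :: "'a ugraph \<Rightarrow> ('a \<Rightarrow> 'a ugraph) \<Rightarrow> 'a ugraph" where
  "realize H K = (\<Union>y\<in>verts H. verts (K y), edges H \<union> (\<Union>y\<in>verts H. edges (K y)))"

definition five_cycle :: "'a ugraph \<Rightarrow> bool" where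
  "five_cycle B \<longleftrightarrow> (\<exists>q. distinct q \<and> length q = 5 \<and> B = cycle_subgraph q)"

text \<open>The part of the distance sum that changes when the block and its chains are exchanged
  for one chain at \<open>x\<close>. The parameter \<open>A\<close> stands for everything else at
  \<open>x\<close>; a chain sees this weight, the edges of the block and the other chains as one
  weight at its own start.\<close>

definition block_value :: "'a ugraph \<Rightarrow> 'a \<Rightarrow> nat \<Rightarrow> ('a \<Rightarrow> bool list) \<Rightarrow> nat" where
  "block_value B x A S = wsum B ((\<lambda>y. csize (S y))(x := A))
    + 2 * (\<Sum>y\<in>verts B - {x}.
        cval (A + card (edges B) + (\<Sum>z\<in>verts B - {x} - {y}. csize (S z))) (S y) 0)"

text \<open>The chain \<open>P\<close> at \<open>x\<close> dominates the block \<open>B\<close> with the chains \<open>S y\<close>. Without a weight at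
  \<open>x\<close> there may be equality although \<open>x\<close> is not an end of the chain.\<close>

definition block_chain :: "'a ugraph \<Rightarrow> nat \<Rightarrow> 'a \<Rightarrow> nat \<Rightarrow> ('a \<Rightarrow> bool list) \<Rightarrow> bool list \<Rightarrow> bool" where
  "block_chain B s x A S P \<longleftrightarrow>
     ntri P = s + (\<Sum>y\<in>verts B - {x}. ntri (S y)) \<and>
     csize P = card (edges B) + (\<Sum>y\<in>verts B - {x}. csize (S y)) \<and>
     block_value B x A S \<le> 2 * cval A P 0 \<and>
     (block_value B x A S = 2 * cval A P 0 \<longrightarrow>
        (A = 0 \<and> five_cycle B \<and> (\<forall>y\<in>verts B - {x}. S y = [])) \<or>
        (\<forall>K. K x = ({x}, {}) \<longrightarrow> decorated B K (S(x := [])) \<longrightarrow>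
           (\<exists>w. chain_graph (realize B K) x P w) \<or>
           (A = 0 \<and> (\<exists>u w. chain_graph (realize B K) u P w))))"

lemma decoratedD:
  assumes "decorated H K S"
  shows "y \<in> verts H \<Longrightarrow> \<exists>e. chain_graph (K y) y (S y) e"
    and "y \<in> verts H \<Longrightarrow> z \<in> verts H \<Longrightarrow> y \<noteq> z \<Longrightarrow> verts (K y) \<inter> verts (K z) = {}"
    and "y \<in> verts H \<Longrightarrow> y \<in> verts (K y)"
    and "y \<in> verts H \<Longrightarrow> verts (K y) \<inter> verts H = {y}"
proof -
  show 1: "\<exists>e. chain_graph (K y) y (S y) e" if "y \<in> verts H" for y
    using assms that by (auto simp: decorated_def)
  show 2: "verts (K y) \<inter> verts (K z) = {}" if "y \<in> verts H" "z \<in> verts H" "y \<noteq> z" for y z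
    using assms that by (auto simp: decorated_def)
  show 3: "y \<in> verts (K y)" if "y \<in> verts H" for y
    using 1[OF that] by (auto dest: chain_graph_verts)
  show "verts (K y) \<inter> verts H = {y}" if "y \<in> verts H"
    using 2[OF that] 3 that by blast
qed

lemma block_chain_edge:
  assumes "x \<noteq> y"
  shows "block_chain (edge_graph x y) 0 x A S (False # S y)"
proof -
  let ?B = "edge_graph x y"
  have V: "verts ?B - {x} = {y}" using assms by auto
  have val: "block_value ?B x A S = 2 * cval A (False # S y) 0"
    unfolding block_value_def V using assms by (simp add: wsum_edge_graph)
  have "\<exists>w. chain_graph (realize ?B K) x (False # S y) w"
    if K: "K x = ({x}, {})" "decorated ?B K (S(x := []))" for K
  proof -
    obtain e where e: "chain_graph (K y) y (S y) e"
      using decoratedD(1)[OF K(2), of y] assms by auto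
    have "verts ?B \<inter> verts (K y) = {y}"
      using decoratedD(4)[OF K(2), of y] by auto
    moreover have "link False ?B x y" using assms by (simp add: link_def)
    ultimately have "chain_graph (graph_union ?B (K y)) x (False # S y) e"
      using e by (intro chain_graph.Cons)
    moreover have "realize ?B K = graph_union ?B (K y)"
      using K(1) chain_graph_verts[OF e] by (intro prod_eqI) (auto simp: realize_def)
    ultimately show ?thesis by auto
  qed
  then show ?thesis unfolding block_chain_def V using val by auto
qed

text \<open>If nothing hangs at \<open>y\<close>, then \<open>y\<close> can be the free vertex and
  the chain starts at \<open>x\<close>. In general \<open>x\<close> is taken as the free vertex and
  the chain runs from one decoration through the triangle into the other, so \<open>x\<close> need
  not be an end.\<close>

lemma chain_graph_triangle:
  assumes K: "decorated (triangle_graph x y z) K (S(x := []))" "K x = ({x}, {})"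
    and d: "distinct [x, y, z]"
  shows "S y = [] \<Longrightarrow> \<exists>w. chain_graph (realize (triangle_graph x y z) K) x (True # S z) w"
    and "\<exists>u w. chain_graph (realize (triangle_graph x y z) K) u (rev (S y) @ True # S z) w"
proof -
  let ?B = "triangle_graph x y z"
  obtain e where e: "chain_graph (K y) y (S y) e"
    using decoratedD(1)[OF K(1), of y] d by auto
  obtain e' where e': "chain_graph (K z) z (S z) e'"
    using decoratedD(1)[OF K(1), of z] d by auto
  have y: "y \<in> verts (K y)" "verts (K y) \<inter> verts ?B = {y}"
    using decoratedD(3,4)[OF K(1), of y] by auto
  have z: "z \<in> verts (K z)" "verts ?B \<inter> verts (K z) = {z}"
    using decoratedD(3,4)[OF K(1), of z] by auto
  have yz: "verts (K y) \<inter> verts (K z) = {}"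
    using decoratedD(2)[OF K(1), of y z] d by auto
  show "\<exists>w. chain_graph (realize ?B K) x (True # S z) w" if "S y = []"
  proof -
    have "link True ?B x z"
      using d triangle_graph_perm(2)[of x y z] by (auto simp: link_def intro!: exI[of _ y])
    then have "chain_graph (graph_union ?B (K z)) x (True # S z) e'"
      using e' z(2) by (rule chain_graph.Cons)
    moreover have "K y = ({y}, {})"
      using e that by (simp add: chain_graph_Nil_iff)
    then have "realize ?B K = graph_union ?B (K z)"
      using K(2) z(1) by (intro prod_eqI) (auto simp: realize_def)
    ultimately show ?thesis by auto
  qed
  have "link True ?B y z"
    using d triangle_graph_perm(1)[of x y z] triangle_graph_perm(2)[of y x z]
    by (auto simp: link_def intro!: exI[of _ x])
  then have *: "chain_graph (graph_union ?B (K z)) y (True # S z) e'"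
    using e' z(2) by (rule chain_graph.Cons)
  have "verts (K y) \<inter> verts (graph_union ?B (K z)) = {y}"
    using y yz by auto
  from chain_graph_append[OF chain_graph_rev[OF e] * this]
  have "chain_graph (graph_union (K y) (graph_union ?B (K z))) e (rev (S y) @ True # S z) e'" .
  moreover have "realize ?B K = graph_union (K y) (graph_union ?B (K z))"
    using K(2) y(1) z(1) by (intro prod_eqI) (auto simp: realize_def)
  ultimately show "\<exists>u w. chain_graph (realize ?B K) u (rev (S y) @ True # S z) w" by auto
qed

lemma block_chain_triangle:
  assumes d: "distinct [x, y, z]"
  shows "\<exists>P. block_chain (triangle_graph x y z) 1 x A S P"
proof -
  let ?B = "triangle_graph x y z"
  define W where "W = A * (csize (S y) + csize (S z)) + csize (S y) * csize (S z)
    + (A + csize (S y) + csize (S z))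
    + cval (A + 3 + csize (S z)) (S y) 0 + cval (A + 3 + csize (S y)) (S z) 0"
  obtain P where P: "ntri P = Suc (ntri (S y) + ntri (S z))"
    "csize P = 3 + csize (S y) + csize (S z)" "W \<le> cval A P 0"
    "0 < A \<Longrightarrow> S y \<noteq> [] \<Longrightarrow> S z \<noteq> [] \<Longrightarrow> W < cval A P 0"
    "S y = [] \<Longrightarrow> P = True # S z" "S z = [] \<Longrightarrow> P = True # S y"
    "A = 0 \<Longrightarrow> P = rev (S y) @ True # S z \<or> P = rev (S z) @ True # S y"
    proof (rule cval_triangle[where ?S1.0 = "S y" and ?S2.0 = "S z" and ?a = A, folded W_def],
      goal_cases)
    case (1 P)
    then show ?thesis by (intro that[of P]) blast+
  qed
  have ne: "y \<noteq> x" "z \<noteq> x" "y \<noteq> z" using d by auto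
  have V: "verts ?B - {x} = {y, z}" using d by auto
  have Vy: "{y, z} - {y} = {z}" "{y, z} - {z} = {y}" using d by auto
  have c: "card (edges ?B) = 3" using d by (auto simp: card_insert_if doubleton_eq_iff)
  have val: "block_value ?B x A S = 2 * W"
    unfolding block_value_def V c wsum_triangle_graph[OF d] W_def
    using ne by (simp add: Vy algebra_simps)
  have perm: "?B = triangle_graph x z y" by (rule triangle_graph_perm(2))
  have "(\<exists>w. chain_graph (realize ?B K) x P w) \<or> (A = 0 \<and> (\<exists>u w. chain_graph (realize ?B K) u P w))"
    if eq: "W = cval A P 0" and K: "K x = ({x}, {})" "decorated ?B K (S(x := []))" for K
  proof -
    note 1 = chain_graph_triangle[OF K(2,1) d]
    have d': "distinct [x, z, y]" using d by auto
    note 2 = chain_graph_triangle[of x z y, folded perm, OF K(2,1) d']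
    show ?thesis
    proof (cases "S y = [] \<or> S z = []")
      case True
      then show ?thesis using 1(1) 2(1) P(5,6) by metis
    next
      case False
      \<comment> \<open>Two nonempty chains and a positive weight would make the inequality
        strict.\<close>
      then have "A = 0" using P(4) eq by auto
      then show ?thesis using 1(2) 2(2) P(7) by metis
    qed
  qed
  then have "block_chain ?B 1 x A S P"
    unfolding block_chain_def V using P d val c by auto
  then show ?thesis by blast
qed

text \<open>A cut separates the side \<open>U\<close> of \<open>x\<close> from the rest
  \<open>R\<close>. The chains of each side are merged into one, the cycle becomes the connection
  \<open>Q\<close> between the sides, and at \<open>x\<close> the two halves are merged once more
  with weight \<open>A\<close>. Equality leads to the pentagon alternative, since the connection is
  strictly better otherwise.\<close>

lemma block_chain_cycle:
  assumes d: "distinct q" and c: "4 \<le> length q" and x: "x \<in> set q"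
    and M: "5 \<le> A + (\<Sum>y\<in>set q - {x}. csize (S y)) + length q"
  shows "\<exists>P. block_chain (cycle_subgraph q) 1 x A S P"
proof -
  let ?B = "cycle_subgraph q" and ?c = "length q" and ?s = "\<lambda>y. csize (S y)"
  define \<omega> where "\<omega> = ?s(x := A)"
  have c3: "3 \<le> ?c" using c by simp
  define bd where "bd a b = ?c * gapsum (?c - 1) + 2 * ((a + b) * gapsum ?c) + ?c * (a * b)" for a b
  obtain U0 where U0: "U0 \<subseteq> set q" "wsum ?B \<omega> \<le> bd (sum \<omega> U0) (sum \<omega> (set q - U0))"
    unfolding bd_def by (rule wsum_cycle_le[OF d c3, of \<omega>])
  \<comment> \<open>The bound is symmetric in the two sides, so \<open>U\<close> may be the one that
    contains \<open>x\<close>.\<close>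
  define U where "U = (if x \<in> U0 then U0 else set q - U0)"
  define R where "R = set q - U"
  have U: "U \<subseteq> set q" "x \<in> U" "wsum ?B \<omega> \<le> bd (sum \<omega> U) (sum \<omega> R)"
    using U0 x by (auto simp: U_def R_def bd_def double_diff add.commute mult.commute)
  have fin: "finite U" "finite R" using U(1) by (auto simp: R_def intro: finite_subset)
  define L where "L = U - {x}"
  have parts: "set q - {x} = L \<union> R" "L \<inter> R = {}" "x \<notin> L" "x \<notin> R" "finite L" "finite R"
    using U fin by (auto simp: L_def R_def)
  define l where "l = (\<Sum>y\<in>L. ?s y)"
  define r where "r = (\<Sum>y\<in>R. ?s y)"
  have sU: "sum \<omega> U = A + l"
  proof -
    have "sum \<omega> U = \<omega> x + sum \<omega> L" unfolding L_def using fin(1) U(2) by (rule sum.remove)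
    also have "sum \<omega> L = l" unfolding l_def using parts by (intro sum.cong) (auto simp: \<omega>_def)
    finally show ?thesis by (simp add: \<omega>_def)
  qed
  have sR: "sum \<omega> R = r"
    unfolding r_def using parts by (intro sum.cong) (auto simp: \<omega>_def)
  have sumLR: "(\<Sum>y\<in>set q - {x}. F y) = (\<Sum>y\<in>L. F y) + (\<Sum>y\<in>R. F y :: nat)" for F
    unfolding parts(1) using parts by (intro sum.union_disjoint)
  have M': "5 \<le> A + l + r + ?c" using M by (simp add: sumLR l_def r_def)
  \<comment> \<open>The triangle is placed next to the lighter of the two sides, as in the
    comparison of the cycle with its connection.\<close>
  define Q where "Q = (if A + l \<le> r then True # replicate (?c - 3) False
    else rev (True # replicate (?c - 3) False))"
  have Q: "ntri Q = 1" "csize Q = ?c"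
    using c by (auto simp: Q_def)
  have QV: "bd (A + l) r \<le> 2 * cval (A + l) Q r"
    "bd (A + l) r = 2 * cval (A + l) Q r \<Longrightarrow> A + l = 0 \<and> r = 0 \<and> ?c = 5"
  proof -
    have "bd (A + l) r \<le> 2 * cval (A + l) Q r \<and>
      (bd (A + l) r = 2 * cval (A + l) Q r \<longrightarrow> A + l = 0 \<and> r = 0 \<and> ?c = 5)"
    proof (cases "A + l \<le> r")
      case True
      then show ?thesis
        using cval_connection[OF c, of "A + l" r] M' by (simp add: bd_def Q_def)
    next
      case False
      let ?T = "True # replicate (?c - 3) False"
      have "5 \<le> r + (A + l) + ?c" "r \<le> A + l" using M' False by simp_all
      note cc = cval_connection[OF c this]
      have "bd (A + l) r = bd r (A + l)" by (simp add: bd_def add.commute mult.commute)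
      moreover have "cval (A + l) Q r = cval r ?T (A + l)"
        unfolding Q_def using False cval_rev[of "A + l" ?T r] by (simp only: if_False)
      moreover have "bd r (A + l) \<le> 2 * cval r ?T (A + l)"
        using cc(1) by (simp only: bd_def)
      moreover have "A + l = 0 \<and> r = 0 \<and> ?c = 5" if "bd r (A + l) = 2 * cval r ?T (A + l)"
        using cc(2)[OF that[unfolded bd_def]] by simp
      ultimately show ?thesis by (simp only:) blast
    qed
    then show "bd (A + l) r \<le> 2 * cval (A + l) Q r"
      "bd (A + l) r = 2 * cval (A + l) Q r \<Longrightarrow> A + l = 0 \<and> r = 0 \<and> ?c = 5" by auto
  qed
  obtain SR where SR: "ntri SR = (\<Sum>y\<in>R. ntri (S y))" "csize SR = r"
    "(\<Sum>y\<in>R. cval (A + l + ?c + (\<Sum>z\<in>R - {y}. ?s z)) (S y) 0) \<le> cval (A + l + ?c) SR 0"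
    using cval_merge_family[OF parts(6), of S "A + l + ?c"] unfolding r_def by blast
  obtain SL where SL: "ntri SL = (\<Sum>y\<in>L. ntri (S y))" "csize SL = l"
    "(\<Sum>y\<in>L. cval (A + ?c + r + (\<Sum>z\<in>L - {y}. ?s z)) (S y) 0) \<le> cval (A + ?c + r) SL 0"
    using cval_merge_family[OF parts(5), of S "A + ?c + r"] unfolding l_def by blast
  obtain P where P: "ntri P = ntri (Q @ SR) + ntri SL" "csize P = csize (Q @ SR) + csize SL"
    "cval (A + csize SL) (Q @ SR) 0 + cval (A + csize (Q @ SR)) SL 0 \<le> cval A P 0"
    by (rule cval_merge)
  have app: "cval (A + l) (Q @ SR) 0 = cval (A + l) Q r + cval (A + l + ?c) SR 0"
    by (simp add: cval_append Q SR(2))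
  have others: "(\<Sum>z\<in>set q - {x} - {y}. ?s z) = l + (\<Sum>z\<in>R - {y}. ?s z)" if "y \<in> R" for y
  proof -
    have "set q - {x} - {y} = L \<union> (R - {y})" using parts that by auto
    moreover have "L \<inter> (R - {y}) = {}" using parts by auto
    ultimately show ?thesis using parts by (simp add: sum.union_disjoint l_def)
  qed
  have others': "(\<Sum>z\<in>set q - {x} - {y}. ?s z) = r + (\<Sum>z\<in>L - {y}. ?s z)" if "y \<in> L" for y
  proof -
    have "set q - {x} - {y} = R \<union> (L - {y})" using parts that by auto
    moreover have "R \<inter> (L - {y}) = {}" using parts by auto
    ultimately show ?thesis using parts by (simp add: sum.union_disjoint r_def)
  qed
  have "block_value ?B x A S = wsum ?B \<omega>
      + 2 * ((\<Sum>y\<in>L. cval (A + ?c + r + (\<Sum>z\<in>L - {y}. ?s z)) (S y) 0)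
        + (\<Sum>y\<in>R. cval (A + l + ?c + (\<Sum>z\<in>R - {y}. ?s z)) (S y) 0))"
  proof -
    have "(\<Sum>y\<in>L. cval (A + ?c + (\<Sum>z\<in>set q - {x} - {y}. ?s z)) (S y) 0)
        = (\<Sum>y\<in>L. cval (A + ?c + r + (\<Sum>z\<in>L - {y}. ?s z)) (S y) 0)"
      using others' by (intro sum.cong) (auto simp: add.assoc)
    moreover have "(\<Sum>y\<in>R. cval (A + ?c + (\<Sum>z\<in>set q - {x} - {y}. ?s z)) (S y) 0)
        = (\<Sum>y\<in>R. cval (A + l + ?c + (\<Sum>z\<in>R - {y}. ?s z)) (S y) 0)"
      using others by (intro sum.cong) (auto simp: add_ac)
    ultimately show ?thesis
      unfolding block_value_def \<omega>_def verts_cycle_subgraph card_edges_cycle[OF d c3] sumLR by simp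
  qed
  then have val: "block_value ?B x A S + 2 * cval (A + l) Q r \<le> bd (A + l) r + 2 * cval A P 0"
    using U(3) SR(3) SL(3) P(3) unfolding sU sR app Q(2) SR(2) SL(2)
    by (simp add: app Q SR(2) add.assoc)
  have "A = 0 \<and> five_cycle ?B \<and> (\<forall>y\<in>set q - {x}. S y = [])"
    if "block_value ?B x A S = 2 * cval A P 0"
  proof -
    \<comment> \<open>The total gain bounds the gain of the connection alone from above; if it is 0,
      so is the latter.\<close>
    have "A + l = 0 \<and> r = 0 \<and> ?c = 5"
      using val that QV by linarith
    then show ?thesis
      using d parts by (auto simp: five_cycle_def l_def r_def)
  qed
  then have "block_chain ?B 1 x A S P"
    using val QV(1) P(1,2) SR(1,2) SL(1,2) Q sumLR[of "\<lambda>y. ntri (S y)"] sumLR[of ?s]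
    by (auto simp: block_chain_def card_edges_cycle[OF d c3] l_def r_def)
  then show ?thesis by blast
qed

lemma cycle_subgraph_3: "cycle_subgraph [a, b, c] = triangle_graph a b c"
proof (intro prod_eqI)
  have "{..<length [a, b, c]} = {0, 1, 2}" by auto
  moreover have "{c, a} = {a, c}" by auto
  ultimately show "snd (cycle_subgraph [a, b, c]) = snd (triangle_graph a b c)"
    by (auto simp: edges_cycle_subgraph cycle_edge_def)
qed simp

lemma block_chain_exists:
  assumes B: "block B s" and x: "x \<in> verts B"
    and M: "s = 0 \<or> 5 \<le> A + (\<Sum>y\<in>verts B - {x}. csize (S y)) + card (edges B)"
  shows "\<exists>P. block_chain B s x A S P"
proof -
  consider a b where "s = 0" "a \<noteq> b" "B = edge_graph a b"
    | q where "s = 1" "distinct q" "3 \<le> length q" "B = cycle_subgraph q"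
    using B by (auto simp: block_def)
  then show ?thesis
  proof cases
    case 1
    then have "\<exists>y. x \<noteq> y \<and> B = edge_graph x y"
      using x by (metis edge_graph_commute edge_graph_simps(1) insert_iff singletonD)
    then show ?thesis using block_chain_edge 1 by metis
  next
    case 2
    show ?thesis
    proof (cases "length q = 3")
      case True
      then obtain a b c where q: "q = [a, b, c]"
        by (auto simp: length_Suc_conv numeral_3_eq_3)
      have "\<exists>y z. distinct [x, y, z] \<and> B = triangle_graph x y z"
        using 2 x triangle_graph_perm unfolding q by (fastforce simp: cycle_subgraph_3)
      then show ?thesis using block_chain_triangle 2 by metis
    next
      case False
      then show ?thesis
        using 2 x M card_edges_cycle[OF 2(2,3)] block_chain_cycle[of q x A S] by simp
    qed
  qed
qed

lemma chain_graph_trivial: "\<exists>e. chain_graph ({x}, {}) x [] e"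
  by (rule exI, rule chain_graph.Nil)

section \<open>Peeling off leaf blocks\<close>

lemma realize_split:
  assumes K: "decorated B K S" and x: "x \<in> verts B"
  defines "K' \<equiv> K(x := ({x}, {}))"
  shows "decorated B K' (S(x := []))"
    and "realize B K = graph_union (realize B K') (K x)"
    and "verts (realize B K') \<inter> verts (K x) = {x}"
proof -
  note D = decoratedD[OF K]
  have "x \<notin> verts (K z)" if "z \<in> verts B" "z \<noteq> x" for z
    using D(2)[OF x that(1)] D(3)[OF x] that by auto
  then show "decorated B K' (S(x := []))"
    using D x chain_graph_trivial[of x] by (auto simp: decorated_def K'_def)
  show "realize B K = graph_union (realize B K') (K x)"
    using D(3)[OF x] x by (intro prod_eqI) (auto simp: realize_def K'_def split: if_splits)
  show "verts (realize B K') \<inter> verts (K x) = {x}"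
  proof -
    have "verts (realize B K') = insert x (\<Union>y\<in>verts B - {x}. verts (K y))"
      using x by (auto simp: realize_def K'_def split: if_splits)
    moreover have "verts (K y) \<inter> verts (K x) = {}" if "y \<in> verts B - {x}" for y
      using D(2)[OF _ x] that by blast
    ultimately show ?thesis using D(3)[OF x] by blast
  qed
qed

lemma block_card_edges_pos: "block B s \<Longrightarrow> 0 < card (edges B)"
  by (auto simp: block_def card_edges_cycle)

text \<open>Here \<open>a\<close> is the weight at \<open>x\<close> from outside the block and its
  chains. The chain hanging at \<open>x\<close> first counts as weight, so
  \<open>A = a + csize (S x)\<close>; the block with its other chains becomes \<open>P\<close>, and
  then \<open>P\<close> and \<open>S x\<close> are merged at \<open>x\<close> with weight
  \<open>a\<close>.\<close>

lemma leaf_block: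
  assumes B: "block B s" and x: "x \<in> verts B"
    and M: "s = 0 \<or> 5 \<le> a + card (edges B) + (\<Sum>y\<in>verts B. csize (S y))"
  defines "val \<equiv> wsum B ((\<lambda>y. csize (S y))(x := a + csize (S x)))
      + 2 * (\<Sum>y\<in>verts B. cval (a + card (edges B) + (\<Sum>z\<in>verts B - {y}. csize (S z))) (S y) 0)"
  obtains S' where "ntri S' = s + (\<Sum>y\<in>verts B. ntri (S y))"
    "csize S' = card (edges B) + (\<Sum>y\<in>verts B. csize (S y))"
    "val \<le> 2 * cval a S' 0"
    "val = 2 * cval a S' 0 \<Longrightarrow> (a = 0 \<and> five_cycle B \<and> (\<forall>y\<in>verts B. S y = [])) \<or>
      (\<forall>K. decorated B K S \<longrightarrow> (0 < a \<longrightarrow> (\<exists>w. chain_graph (realize B K) x S' w)) \<and>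
        (\<exists>u w. chain_graph (realize B K) u S' w))"
proof -
  let ?s = "\<lambda>y. csize (S y)"
  have fin: "finite (verts B)" using B by (intro simple_finite_verts block_simple)
  define A where "A = a + ?s x"
  have split: "(\<Sum>y\<in>verts B. F y) = F x + (\<Sum>y\<in>verts B - {x}. F y :: nat)" for F
    using fin x by (rule sum.remove)
  have "s = 0 \<or> 5 \<le> A + (\<Sum>y\<in>verts B - {x}. ?s y) + card (edges B)"
    using M by (auto simp: split A_def)
  then obtain P where P: "block_chain B s x A S P"
    using block_chain_exists[OF B x] by blast
  have P1: "ntri P = s + (\<Sum>y\<in>verts B - {x}. ntri (S y))"
    and P2: "csize P = card (edges B) + (\<Sum>y\<in>verts B - {x}. ?s y)"
    and P3: "block_value B x A S \<le> 2 * cval A P 0"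
    and P4: "block_value B x A S = 2 * cval A P 0 \<Longrightarrow>
        (A = 0 \<and> five_cycle B \<and> (\<forall>y\<in>verts B - {x}. S y = [])) \<or>
        (\<forall>K. K x = ({x}, {}) \<longrightarrow> decorated B K (S(x := [])) \<longrightarrow>
           (\<exists>w. chain_graph (realize B K) x P w) \<or>
           (A = 0 \<and> (\<exists>u w. chain_graph (realize B K) u P w)))"
    using P unfolding block_chain_def by blast+
  have Pne: "P \<noteq> []" using P2 block_card_edges_pos[OF B] by auto
  obtain S' where S': "ntri S' = ntri P + ntri (S x)" "csize S' = csize P + ?s x"
    and S'_le: "cval (a + ?s x) P 0 + cval (a + csize P) (S x) 0 \<le> cval a S' 0"
    and S'_less: "0 < a \<Longrightarrow> P \<noteq> [] \<Longrightarrow> S x \<noteq> [] \<Longrightarrow>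
       cval (a + ?s x) P 0 + cval (a + csize P) (S x) 0 < cval a S' 0"
    and S'_Nil: "S x = [] \<Longrightarrow> S' = P"
    and S'_0: "a = 0 \<Longrightarrow> S' = rev P @ S x \<or> S' = rev (S x) @ P"
  proof (rule cval_merge[of P "S x" a], goal_cases)
    case (1 S')
    then show ?thesis by (intro that[of S']) blast+
  qed
  have val: "val = block_value B x A S + 2 * cval (a + csize P) (S x) 0"
  proof -
    have "(\<Sum>y\<in>verts B - {x}. cval (a + card (edges B) + (\<Sum>z\<in>verts B - {y}. ?s z)) (S y) 0)
        = (\<Sum>y\<in>verts B - {x}. cval (A + card (edges B) + (\<Sum>z\<in>verts B - {x} - {y}. ?s z)) (S y) 0)"
    proof (intro sum.cong refl)
      fix y assume y: "y \<in> verts B - {x}"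
      have "(\<Sum>z\<in>verts B - {y}. ?s z) = ?s x + (\<Sum>z\<in>verts B - {y} - {x}. ?s z)"
        using fin x y by (intro sum.remove) auto
      moreover have "verts B - {y} - {x} = verts B - {x} - {y}" by auto
      ultimately show "cval (a + card (edges B) + (\<Sum>z\<in>verts B - {y}. ?s z)) (S y) 0
          = cval (A + card (edges B) + (\<Sum>z\<in>verts B - {x} - {y}. ?s z)) (S y) 0"
        by (simp add: A_def add_ac)
    qed
    then show ?thesis
      unfolding val_def split[of "\<lambda>y. cval _ (S y) 0"] block_value_def P2 A_def
      by (subst split) (simp add: add_ac)
  qed
  show ?thesis
  proof (rule that[of S'])
    show "ntri S' = s + (\<Sum>y\<in>verts B. ntri (S y))"
      using S'(1) P1 by (simp add: split)
    show "csize S' = card (edges B) + (\<Sum>y\<in>verts B. ?s y)"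
      using S'(2) P2 by (simp add: split)
    show "val \<le> 2 * cval a S' 0"
      using S'_le P3 unfolding val A_def by linarith
  next
    assume "val = 2 * cval a S' 0"
    then have eq: "block_value B x A S = 2 * cval A P 0"
      "cval (a + ?s x) P 0 + cval (a + csize P) (S x) 0 = cval a S' 0"
      using S'_le P3 unfolding val A_def by linarith+
    consider "A = 0" "five_cycle B" "\<forall>y\<in>verts B - {x}. S y = []"
      | "\<forall>K. K x = ({x}, {}) \<longrightarrow> decorated B K (S(x := [])) \<longrightarrow>
           (\<exists>w. chain_graph (realize B K) x P w) \<or>
           (A = 0 \<and> (\<exists>u w. chain_graph (realize B K) u P w))"
      using P4[OF eq(1)] by blast
    then show "(a = 0 \<and> five_cycle B \<and> (\<forall>y\<in>verts B. S y = [])) \<or>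
      (\<forall>K. decorated B K S \<longrightarrow> (0 < a \<longrightarrow> (\<exists>w. chain_graph (realize B K) x S' w)) \<and>
        (\<exists>u w. chain_graph (realize B K) u S' w))"
    proof cases
      case 1
      then show ?thesis by (auto simp: A_def)
    next
      case 2
      have "(0 < a \<longrightarrow> (\<exists>w. chain_graph (realize B K) x S' w)) \<and>
        (\<exists>u w. chain_graph (realize B K) u S' w)" if K: "decorated B K S" for K
      proof -
        let ?K = "K(x := ({x}, {}))"
        note R = realize_split[OF K x]
        have D: "(\<exists>w. chain_graph (realize B ?K) x P w) \<or>
           (A = 0 \<and> (\<exists>u w. chain_graph (realize B ?K) u P w))"
          using 2 R(1) by simp
        obtain e where e: "chain_graph (K x) x (S x) e"
          using decoratedD(1)[OF K x] by blast
        show ?thesis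
        proof (cases "S x = []")
          case True
          then have "K = ?K" using e by (auto simp: chain_graph_Nil_iff)
          then show ?thesis using D S'_Nil[OF True] True unfolding A_def by auto
        next
          case False
          \<comment> \<open>With a nonempty chain at \<open>x\<close> the weight \<open>A\<close> is
            positive, so \<open>P\<close> is realized starting at \<open>x\<close> and can be joined
            to \<open>S x\<close> there. Equality in the merge then forces \<open>a = 0\<close>, so
            no starting vertex is prescribed and either direction of the joined chain will
            do.\<close>
          then have "A \<noteq> 0" by (simp add: A_def)
          then obtain w where w: "chain_graph (realize B ?K) x P w" using D by blast
          have a: "a = 0" using S'_less[OF _ Pne False] eq(2) by linarith
          have 1: "chain_graph (realize B K) w (rev P @ S x) e"
            unfolding R(2) by (rule chain_graph_append[OF chain_graph_rev[OF w] e R(3)])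
          have "rev (rev P @ S x) = rev (S x) @ P" by simp
          then have 2: "chain_graph (realize B K) e (rev (S x) @ P) w"
            using chain_graph_rev[OF 1] by simp
          show ?thesis using S'_0[OF a] 1 2 a by auto
        qed
      qed
      then show ?thesis by blast
    qed
  qed
qed

lemma wsum_single: "wsum ({v}, {}) \<omega> = 0"
  by (simp add: wsum_expand[OF single_graph_simple])

definition deco_value :: "'a ugraph \<Rightarrow> ('a \<Rightarrow> bool list) \<Rightarrow> nat" where
  "deco_value H S = wsum H (\<lambda>y. csize (S y))
     + 2 * (\<Sum>y\<in>verts H. cval (card (edges H) + (\<Sum>z\<in>verts H - {y}. csize (S z))) (S y) 0)"

text \<open>The decoration \<open>S\<close> is arbitrary in the induction because peeling a block
  replaces the chain at its root. The replacement has as many edges as the block with its chains, so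
  the total that is assumed to be at least 5 stays the same.\<close>

theorem deco_value_le_chain:
  assumes "cactus_gen H t"
    and "t = 0 \<or> 5 \<le> card (edges H) + (\<Sum>y\<in>verts H. csize (S y))"
  shows "\<exists>S'. ntri S' = t + (\<Sum>y\<in>verts H. ntri (S y)) \<and>
    csize S' = card (edges H) + (\<Sum>y\<in>verts H. csize (S y)) \<and>
    deco_value H S \<le> 2 * cval 0 S' 0 \<and>
    (deco_value H S = 2 * cval 0 S' 0 \<longrightarrow>
      (five_cycle H \<and> (\<forall>y\<in>verts H. S y = [])) \<or>
      (\<forall>K. decorated H K S \<longrightarrow> (\<exists>u w. chain_graph (realize H K) u S' w)))"
  using assms
proof (induction arbitrary: S rule: cactus_gen.induct)
  case (single v)
  have "\<exists>u w. chain_graph (realize ({v}, {}) K) u (S v) w" if "decorated ({v}, {}) K S" for K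
    using that by (auto simp: decorated_def realize_def)
  then show ?case by (intro exI[of _ "S v"]) (auto simp: deco_value_def wsum_single)
next
  case (glue H t B s x)
  let ?s = "\<lambda>y. csize (S y)"
  let ?U = "graph_union H B"
  note H = cactus_gen_simple[OF glue.hyps(1)] cactus_gen_connected[OF glue.hyps(1)]
  note B = block_simple[OF glue.hyps(2)] block_connected[OF glue.hyps(2)]
  have x: "x \<in> verts H" "x \<in> verts B" using glue.hyps(3) by auto
  have finH: "finite (verts H)" and finB: "finite (verts B)"
    using H B by (auto simp: simple_finite_verts)
  have VU: "verts ?U = (verts H - {x}) \<union> verts B" "(verts H - {x}) \<inter> verts B = {}"
    using glue.hyps(3) by auto
  have VU': "verts ?U = verts H \<union> (verts B - {x})" "verts H \<inter> (verts B - {x}) = {}"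
    using glue.hyps(3) by auto
  have sumU: "(\<Sum>y\<in>verts ?U. F y) = (\<Sum>y\<in>verts H - {x}. F y) + (\<Sum>y\<in>verts B. F y :: nat)" for F
    unfolding VU(1) using VU(2) finH finB by (intro sum.union_disjoint) auto
  have sumU': "(\<Sum>y\<in>verts ?U. F y) = (\<Sum>y\<in>verts H. F y) + (\<Sum>y\<in>verts B - {x}. F y :: nat)" for F
    unfolding VU'(1) using VU'(2) finH finB by (intro sum.union_disjoint) auto
  have cU: "card (edges ?U) = card (edges H) + card (edges B)"
    using card_edges_union[OF H(1) B(1) glue.hyps(3)] .
  define a where "a = card (edges H) + (\<Sum>y\<in>verts H - {x}. ?s y)"
  define valB where "valB = wsum B (?s(x := a + ?s x))
      + 2 * (\<Sum>y\<in>verts B. cval (a + card (edges B) + (\<Sum>z\<in>verts B - {y}. ?s z)) (S y) 0)"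
  have MB: "s = 0 \<or> 5 \<le> a + card (edges B) + (\<Sum>y\<in>verts B. ?s y)"
    using glue.prems unfolding a_def sumU cU by auto
  obtain S2 where S2: "ntri S2 = s + (\<Sum>y\<in>verts B. ntri (S y))"
    "csize S2 = card (edges B) + (\<Sum>y\<in>verts B. ?s y)"
    "valB \<le> 2 * cval a S2 0"
    "valB = 2 * cval a S2 0 \<Longrightarrow> (a = 0 \<and> five_cycle B \<and> (\<forall>y\<in>verts B. S y = [])) \<or>
      (\<forall>K. decorated B K S \<longrightarrow> (0 < a \<longrightarrow> (\<exists>w. chain_graph (realize B K) x S2 w)) \<and>
        (\<exists>u w. chain_graph (realize B K) u S2 w))"
  proof (rule leaf_block[OF glue.hyps(2) x(2) MB, folded valB_def], goal_cases)
    case (1 S')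
    then show ?thesis by (intro that[of S']) blast+
  qed
  show ?case
  proof (cases "card (edges H) = 0")
    case True
    \<comment> \<open>Now \<open>H\<close> is the single vertex \<open>x\<close> and nothing lies
      outside the block. Only here can the pentagon alternative hold.\<close>
    have "card (verts H) = 1 \<and> t = 0"
      using cactus_gen_card[OF glue.hyps(1)] True x(1) finH by auto
    then have V: "verts H = {x}" and t: "t = 0" using x(1) by (auto simp: card_1_singleton_iff)
    have E: "edges H = {}" using True simple_finite_edges[OF H(1)] by simp
    have U: "?U = B" using V E x(2) by (intro prod_eqI) auto
    have a0: "a = 0" using V E by (simp add: a_def)
    have "deco_value B S = valB"
      unfolding deco_value_def valB_def a0 by (simp add: fun_upd_idem)
    then show ?thesis
      unfolding U t using S2 by (intro exI[of _ S2]) (auto simp: a0)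
  next
    case False
    then have a_pos: "0 < a" by (simp add: a_def)
    define S1 where "S1 = S(x := S2)"
    have sumH: "(\<Sum>y\<in>verts H. F y) = F x + (\<Sum>y\<in>verts H - {x}. F y :: nat)" for F
      using finH x(1) by (rule sum.remove)
    have S1_other: "(\<Sum>y\<in>verts H - {x}. F (S1 y)) = (\<Sum>y\<in>verts H - {x}. F (S y) :: nat)"
      for F :: "bool list \<Rightarrow> nat"
      by (intro sum.cong) (auto simp: S1_def)
    have S1_x [simp]: "S1 x = S2" by (simp add: S1_def)
    have tot: "card (edges H) + (\<Sum>y\<in>verts H. csize (S1 y)) = card (edges ?U) + (\<Sum>y\<in>verts ?U. ?s y)"
      unfolding sumU cU sumH[of "\<lambda>y. csize (S1 y)"] by (simp add: S1_other S2(2))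
    have "t = 0 \<or> 5 \<le> card (edges H) + (\<Sum>y\<in>verts H. csize (S1 y))"
      using glue.prems unfolding tot by auto
    from glue.IH[OF this] obtain S' where S': "ntri S' = t + (\<Sum>y\<in>verts H. ntri (S1 y))"
      "csize S' = card (edges H) + (\<Sum>y\<in>verts H. csize (S1 y))"
      "deco_value H S1 \<le> 2 * cval 0 S' 0"
      "deco_value H S1 = 2 * cval 0 S' 0 \<Longrightarrow> (five_cycle H \<and> (\<forall>y\<in>verts H. S1 y = [])) \<or>
        (\<forall>K. decorated H K S1 \<longrightarrow> (\<exists>u w. chain_graph (realize H K) u S' w))"
      by blast
    \<comment> \<open>Peeling exchanges \<open>valB\<close> for the value of the new chain at
      \<open>x\<close>. Every other chain sees the same weight as before, namely the total number of
      edges minus its own.\<close>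
    have val: "deco_value ?U S + 2 * cval a S2 0 = deco_value H S1 + valB"
    proof -
      have "wsum ?U ?s = wsum H (?s(x := ?s x + mass B (?s(x := 0)))) + wsum B (?s(x := mass H ?s))"
        by (rule wsum_union[OF H B glue.hyps(3)])
      moreover have "mass H ?s = a + ?s x"
        by (simp add: mass_def sumH a_def)
      moreover have "?s x + mass B (?s(x := 0)) = csize S2"
      proof -
        have "(\<Sum>y\<in>verts B. (?s(x := 0)) y) = (\<Sum>y\<in>verts B - {x}. ?s y)"
          by (simp add: sum.remove[OF finB x(2)])
        then show ?thesis
          by (simp add: mass_def S2(2) sum.remove[OF finB x(2), of ?s])
      qed
      moreover have "?s(x := csize S2) = (\<lambda>y. csize (S1 y))" by (auto simp: S1_def)
      ultimately have w: "wsum ?U ?s = wsum H (\<lambda>y. csize (S1 y)) + wsum B (?s(x := a + ?s x))"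
        by simp
      let ?c = "\<lambda>G T y. cval (card (edges G) + (\<Sum>z\<in>verts G - {y}. csize (T z))) (T y) 0"
      have "?c ?U S y = ?c H S1 y" if y: "y \<in> verts H - {x}" for y
      proof -
        have "?s y + (\<Sum>z\<in>verts ?U - {y}. ?s z) = (\<Sum>z\<in>verts ?U. ?s z)"
          using y finH finB by (intro sum.remove[symmetric]) auto
        moreover have "csize (S1 y) + (\<Sum>z\<in>verts H - {y}. csize (S1 z)) = (\<Sum>z\<in>verts H. csize (S1 z))"
          using y finH by (intro sum.remove[symmetric]) auto
        moreover have "S1 y = S y" using y by (simp add: S1_def)
        ultimately have "card (edges ?U) + (\<Sum>z\<in>verts ?U - {y}. ?s z)
            = card (edges H) + (\<Sum>z\<in>verts H - {y}. csize (S1 z))"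
          using tot by simp
        then show ?thesis using \<open>S1 y = S y\<close> by simp
      qed
      moreover have "?c ?U S y = cval (a + card (edges B) + (\<Sum>z\<in>verts B - {y}. ?s z)) (S y) 0"
        if y: "y \<in> verts B" for y
      proof -
        have "?s y + (\<Sum>z\<in>verts ?U - {y}. ?s z) = (\<Sum>z\<in>verts ?U. ?s z)"
          using y finH finB by (intro sum.remove[symmetric]) auto
        moreover have "?s y + (\<Sum>z\<in>verts B - {y}. ?s z) = (\<Sum>z\<in>verts B. ?s z)"
          using y finB by (intro sum.remove[symmetric]) auto
        ultimately have "card (edges ?U) + (\<Sum>z\<in>verts ?U - {y}. ?s z)
            = a + card (edges B) + (\<Sum>z\<in>verts B - {y}. ?s z)"
          using sumU[of ?s] unfolding a_def cU by simp
        then show ?thesis by simp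
      qed
      moreover have "?c H S1 x = cval a S2 0"
        by (simp add: a_def S1_other[of csize])
      ultimately have "(\<Sum>y\<in>verts ?U. ?c ?U S y) + cval a S2 0 = (\<Sum>y\<in>verts H. ?c H S1 y)
          + (\<Sum>y\<in>verts B. cval (a + card (edges B) + (\<Sum>z\<in>verts B - {y}. ?s z)) (S y) 0)"
        unfolding sumU[of "?c ?U S"] sumH[of "?c H S1"] by simp
      then show ?thesis unfolding deco_value_def valB_def w by simp
    qed
    have realize: "\<exists>u w. chain_graph (realize ?U K) u S' w"
      if eq: "deco_value ?U S = 2 * cval 0 S' 0" and K: "decorated ?U K S" for K
    proof -
      have eqs: "deco_value H S1 = 2 * cval 0 S' 0" "valB = 2 * cval a S2 0"
        using eq val S'(3) S2(3) by linarith+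
      \<comment> \<open>The positive \<open>a\<close> excludes the pentagon and makes the new chain
        start at \<open>x\<close>, so that its realization can serve as the decoration of
        \<open>H\<close> at \<open>x\<close>. As this chain is nonempty, the pentagon alternative is
        excluded for \<open>H\<close> as well.\<close>
      have "decorated B K S" using K by (auto simp: decorated_def)
      then obtain w where w: "chain_graph (realize B K) x S2 w"
        using S2(4)[OF eqs(2)] a_pos by auto
      define K1 where "K1 = K(x := realize B K)"
      have K1x: "verts (realize B K) = (\<Union>y\<in>verts B. verts (K y))" by (simp add: realize_def)
      have disj: "verts (K y) \<inter> verts (realize B K) = {}" if "y \<in> verts H" "y \<noteq> x" for y
      proof -
        have "y \<notin> verts B" using that glue.hyps(3) by auto
        then have "verts (K y) \<inter> verts (K z) = {}" if "z \<in> verts B" for z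
          using decoratedD(2)[OF K, of y z] \<open>y \<in> verts H\<close> that by auto
        then show ?thesis unfolding K1x by blast
      qed
      have "decorated H K1 S1"
        unfolding decorated_def
      proof (intro conjI ballI impI)
        show "\<exists>e. chain_graph (K1 y) y (S1 y) e" if "y \<in> verts H" for y
          using w decoratedD(1)[OF K, of y] that by (auto simp: K1_def S1_def)
        show "verts (K1 y) \<inter> verts (K1 z) = {}" if "y \<in> verts H" "z \<in> verts H" "y \<noteq> z" for y z
          using disj[of y] disj[of z] decoratedD(2)[OF K, of y z] that
          by (auto simp: K1_def Int_commute)
      qed
      moreover have "S1 x \<noteq> []"
        using S2(2) block_card_edges_pos[OF glue.hyps(2)] by auto
      ultimately obtain u w' where "chain_graph (realize H K1) u S' w'"
        using S'(4)[OF eqs(1)] x(1) by blast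
      moreover have "realize H K1 = realize ?U K"
      proof -
        have img_v: "(\<Union>y\<in>verts H. verts (K1 y)) = verts (realize B K) \<union> (\<Union>y\<in>verts H - {x}. verts (K y))"
        proof -
          have "(\<Union>y\<in>verts H - {x}. verts (K1 y)) = (\<Union>y\<in>verts H - {x}. verts (K y))"
            by (intro SUP_cong) (auto simp: K1_def)
          moreover have "(\<Union>y\<in>verts H. verts (K1 y)) = verts (K1 x) \<union> (\<Union>y\<in>verts H - {x}. verts (K1 y))"
            using x(1) by blast
          ultimately show ?thesis by (simp add: K1_def)
        qed
        have img_e: "(\<Union>y\<in>verts H. edges (K1 y)) = edges (realize B K) \<union> (\<Union>y\<in>verts H - {x}. edges (K y))"
        proof -
          have "(\<Union>y\<in>verts H - {x}. edges (K1 y)) = (\<Union>y\<in>verts H - {x}. edges (K y))"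
            by (intro SUP_cong) (auto simp: K1_def)
          moreover have "(\<Union>y\<in>verts H. edges (K1 y)) = edges (K1 x) \<union> (\<Union>y\<in>verts H - {x}. edges (K1 y))"
            using x(1) by blast
          ultimately show ?thesis by (simp add: K1_def)
        qed
        show ?thesis
          unfolding realize_def[of H] realize_def[of ?U] img_v img_e VU(1)
          by (auto simp: realize_def)
      qed
      ultimately show ?thesis by auto
    qed
    have "ntri S' = t + s + (\<Sum>y\<in>verts ?U. ntri (S y))"
      using S'(1) S2(1) S1_other[of ntri] unfolding sumU sumH[of "\<lambda>y. ntri (S1 y)"] by simp
    moreover have "deco_value ?U S \<le> 2 * cval 0 S' 0"
      using val S'(3) S2(3) by linarith
    ultimately show ?thesis
      using S'(2) realize unfolding tot by (intro exI[of _ S']) blast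
  qed
qed

theorem cactus_gen_bound:
  assumes "cactus_gen G t" "t = 0 \<or> 5 \<le> card (edges G)"
  obtains S where "ntri S = t" "csize S = card (edges G)" "wsum G (\<lambda>_. 0) \<le> 2 * cval 0 S 0"
    "wsum G (\<lambda>_. 0) = 2 * cval 0 S 0 \<Longrightarrow> five_cycle G \<or> (\<exists>u w. chain_graph G u S w)"
proof -
  let ?S = "\<lambda>_ :: 'a. [] :: bool list" and ?K = "\<lambda>y :: 'a. ({y}, {}) :: 'a ugraph"
  have val: "deco_value G ?S = wsum G (\<lambda>_. 0)" by (simp add: deco_value_def)
  have "decorated G ?K ?S" using chain_graph_trivial by (auto simp: decorated_def)
  moreover have "realize G ?K = G" by (intro prod_eqI) (auto simp: realize_def)
  moreover obtain S where "ntri S = t" "csize S = card (edges G)"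
    "deco_value G ?S \<le> 2 * cval 0 S 0"
    "deco_value G ?S = 2 * cval 0 S 0 \<Longrightarrow> five_cycle G \<or>
      (\<forall>K. decorated G K ?S \<longrightarrow> (\<exists>u w. chain_graph (realize G K) u S w))"
    using deco_value_le_chain[OF assms(1), of ?S] assms(2) by auto
  ultimately show ?thesis
    unfolding val by (metis that)
qed

section \<open>Cacti are generated by blocks\<close>

lemma walk_betw_split:
  assumes "walk_betw G u (xs @ a # ys) v"
  shows "walk_betw G u (xs @ [a]) a" "walk_betw G a (a # ys) v"
proof -
  let ?P = "\<lambda>x y. {x, y} \<in> edges G"
  have "successively ?P (xs @ a # ys)" "set (xs @ a # ys) \<subseteq> verts G"
    "hd (xs @ a # ys) = u" "last (xs @ a # ys) = v"
    using assms by (auto simp: walk_betw_def is_walk_def)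
  then show "walk_betw G u (xs @ [a]) a" "walk_betw G a (a # ys) v"
    using successively_append_iff[of ?P xs "a # ys"] successively_append_iff[of ?P xs "[a]"]
    by (auto simp: walk_betw_def is_walk_def hd_append)
qed

lemma distinct_walk:
  assumes "walk_betw G u p v"
  obtains q where "walk_betw G u q v" "distinct q"
  using assms
proof (induction "length p" arbitrary: p thesis rule: less_induct)
  case less
  show ?case
  proof (cases "distinct p")
    case True
    then show ?thesis using less.prems by blast
  next
    case False
    then obtain xs ys zs a where p: "p = xs @ [a] @ ys @ [a] @ zs"
      using not_distinct_decomp by blast
    have w: "walk_betw G u (xs @ a # ys @ a # zs) v" "walk_betw G u ((xs @ a # ys) @ a # zs) v"
      using less.prems(2) p by simp_all
    note walk_betw_split(1)[OF w(1)] walk_betw_split(2)[OF w(2)]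
    then have "walk_betw G u (xs @ [a] @ zs) v"
      using walk_betw_append[of G u "xs @ [a]" a "a # zs" v] by simp
    then show ?thesis using less.hyps[of "xs @ [a] @ zs"] less.prems(1) p by auto
  qed
qed

lemma walk_crossing:
  assumes "walk_betw G u p v" "u \<in> A" "v \<notin> A"
  obtains x y where "x \<in> A" "y \<notin> A" "{x, y} \<in> edges G"
  using assms
proof (induction p arbitrary: u thesis)
  case Nil
  then show ?case by (simp add: walk_betw_def is_walk_def)
next
  case (Cons a p)
  show ?case
  proof (cases p)
    case Nil
    then show ?thesis using Cons.prems by (auto simp: walk_betw_def)
  next
    case (Cons b p')
    then have b: "walk_betw G b p v" "{u, b} \<in> edges G"
      using Cons.prems by (auto simp: walk_betw_def is_walk_def)
    show ?thesis
    proof (cases "b \<in> A")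
      case True
      then show ?thesis using Cons.IH[OF _ b(1)] Cons.prems by blast
    next
      case False
      then show ?thesis using Cons.prems b(2) by blast
    qed
  qed
qed

lemma cycle_edge_last:
  assumes "q \<noteq> []"
  shows "{last q, hd q} \<in> edges (cycle_subgraph q)"
proof -
  have "cycle_edge q (length q - 1) = {last q, hd q}"
    using assms by (simp add: cycle_edge_def last_conv_nth hd_conv_nth)
  then show ?thesis using assms unfolding edges_cycle_subgraph by (metis diff_less imageI
      length_greater_0_conv lessThan_iff zero_less_one)
qed

lemma cycle_edge_Suc: "Suc i < length q \<Longrightarrow> {q ! i, q ! Suc i} \<in> edges (cycle_subgraph q)"
  unfolding edges_cycle_subgraph by (rule image_eqI[of _ _ i]) (auto simp: cycle_edge_def)

lemma cycle_edge_append: "{x, y} \<in> edges (cycle_subgraph (xs @ x # y # ys))"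
  using cycle_edge_Suc[of "length xs" "xs @ x # y # ys"] by (simp add: nth_append)

lemma edges_cycleE:
  assumes "e \<in> edges (cycle_subgraph q)"
  obtains i where "Suc i < length q" "e = {q ! i, q ! Suc i}" | "q \<noteq> []" "e = {last q, hd q}"
proof -
  obtain i where i: "i < length q" "e = cycle_edge q i"
    using assms by (auto simp: edges_cycle_subgraph)
  then have q: "q \<noteq> []" by auto
  show ?thesis
  proof (cases "Suc i < length q")
    case True
    then show ?thesis using that(1) i by (simp add: cycle_edge_def)
  next
    case False
    then have "Suc i = length q" using i by simp
    then have "i = length q - 1" "Suc i mod length q = 0" by simp_all
    then show ?thesis using that(2)[OF q] i q
      by (simp add: cycle_edge_def last_conv_nth hd_conv_nth)
  qed
qed

lemma cycle_seq_iff: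
  "cycle_seq G q \<longleftrightarrow> distinct q \<and> 3 \<le> length q \<and> set q \<subseteq> verts G \<and>
     edges (cycle_subgraph q) \<subseteq> edges G"
proof
  assume q: "cycle_seq G q"
  have "e \<in> edges G" if "e \<in> edges (cycle_subgraph q)" for e
    using that q by (elim edges_cycleE) (auto simp: cycle_seq_def is_walk_def successively_conv_nth)
  then show "distinct q \<and> 3 \<le> length q \<and> set q \<subseteq> verts G \<and> edges (cycle_subgraph q) \<subseteq> edges G"
    using q by (auto simp: cycle_seq_def is_walk_def)
next
  assume q: "distinct q \<and> 3 \<le> length q \<and> set q \<subseteq> verts G \<and> edges (cycle_subgraph q) \<subseteq> edges G"
  then have "q \<noteq> []" by auto
  moreover have "successively (\<lambda>x y. {x, y} \<in> edges G) q"
    unfolding successively_conv_nth using q cycle_edge_Suc[of _ q] by blast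
  ultimately show "cycle_seq G q"
    using q cycle_edge_last[of q] by (auto simp: cycle_seq_def is_walk_def)
qed

lemma cyclesE:
  assumes "C \<in> cycles G"
  obtains q where "C = cycle_subgraph q" "distinct q" "3 \<le> length q" "set q \<subseteq> verts G"
    "edges (cycle_subgraph q) \<subseteq> edges G"
  using assms by (auto simp: cycles_def cycle_seq_iff)

lemma cyclesI:
  "distinct q \<Longrightarrow> 3 \<le> length q \<Longrightarrow> set q \<subseteq> verts G \<Longrightarrow> edges (cycle_subgraph q) \<subseteq> edges G \<Longrightarrow>
    cycle_subgraph q \<in> cycles G"
  by (auto simp: cycles_def cycle_seq_iff)

lemma cycle_subgraph_rotate: "cycle_subgraph (rotate k q) = cycle_subgraph q"
proof (cases "q = []")
  case False
  have "cycle_edge (rotate k q) i = cycle_edge q ((k + i) mod length q)" if "i < length q" for i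
    using that False by (simp add: cycle_edge_def nth_rotate mod_Suc_eq mod_add_right_eq)
  then have "edges (cycle_subgraph (rotate k q)) = (\<lambda>i. cycle_edge q ((k + i) mod length q)) ` {..<length q}"
    by (auto simp: edges_cycle_subgraph)
  also have "\<dots> = cycle_edge q ` {..<length q}"
  proof (intro equalityI subsetI)
    fix e assume "e \<in> cycle_edge q ` {..<length q}"
    then obtain j where j: "j < length q" "e = cycle_edge q j" by auto
    let ?i = "(j + (length q - k mod length q)) mod length q"
    have "(k + ?i) mod length q = (k mod length q + (j + (length q - k mod length q))) mod length q"
      by (simp only: mod_add_right_eq mod_add_left_eq)
    also have "k mod length q + (j + (length q - k mod length q)) = j + length q"
    proof -
      have "r + (j + (n - r)) = j + n" if "r \<le> n" for r n :: nat using that by simp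
      moreover have "k mod length q \<le> length q"
        using mod_less_divisor[of "length q" k] False by (simp add: less_imp_le)
      ultimately show ?thesis by blast
    qed
    finally have "(k + ?i) mod length q = j" using j by simp
    moreover have "?i < length q" using False by simp
    ultimately show "e \<in> (\<lambda>i. cycle_edge q ((k + i) mod length q)) ` {..<length q}"
      using j by (intro image_eqI[of _ _ ?i]) simp_all
  qed (use False in auto)
  finally show ?thesis by (intro prod_eqI) (simp_all add: edges_cycle_subgraph)
qed simp

lemma cycle_rotate_to:
  assumes "C \<in> cycles G" "x \<in> verts C"
  obtains p where "C = cycle_subgraph (x # p)" "distinct (x # p)" "3 \<le> length (x # p)"
    "set (x # p) \<subseteq> verts G" "edges (cycle_subgraph (x # p)) \<subseteq> edges G"
proof -
  obtain q where q: "C = cycle_subgraph q" "distinct q" "3 \<le> length q" "set q \<subseteq> verts G"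
    "edges (cycle_subgraph q) \<subseteq> edges G"
    using assms(1) by (rule cyclesE)
  obtain k where k: "k < length q" "q ! k = x"
    using assms(2) q(1) by (auto simp: in_set_conv_nth)
  have "hd (rotate k q) = x"
    using k q(3) by (subst hd_rotate_conv_nth) auto
  moreover have "rotate k q \<noteq> []" using k by auto
  ultimately obtain p where p: "rotate k q = x # p" by (metis list.collapse)
  then have C: "cycle_subgraph (x # p) = cycle_subgraph q"
    using cycle_subgraph_rotate[of k q] by simp
  have "distinct (x # p)" "length (x # p) = length q" "set (x # p) = set q"
    using q(2) unfolding p[symmetric] by simp_all
  then show ?thesis using that[of p] q C by simp
qed

lemma finite_cycles: "simple_graph G \<Longrightarrow> finite (cycles G)"
proof (rule finite_subset)
  show "cycles G \<subseteq> Pow (verts G) \<times> Pow (edges G)"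
    by (auto elim!: cyclesE simp: cycle_subgraph_def)
qed (simp add: simple_finite_edges simple_finite_verts)

lemma cycle_edges_nonempty: "C \<in> cycles G \<Longrightarrow> edges C \<noteq> {}"
proof (elim cyclesE)
  fix q assume "C = cycle_subgraph q" "3 \<le> length q"
  then have "q \<noteq> []" "C = cycle_subgraph q" by auto
  then show "edges C \<noteq> {}" using cycle_edge_last by blast
qed

section \<open>Growing closed subgraphs of a cactus\<close>

definition closed_subgraph :: "'a ugraph \<Rightarrow> 'a ugraph \<Rightarrow> nat \<Rightarrow> bool" where
  "closed_subgraph G H s \<longleftrightarrow> cactus_gen H s \<and> verts H \<subseteq> verts G \<and> edges H \<subseteq> edges G \<and>
     (\<forall>C\<in>cycles G. edges C \<inter> edges H \<noteq> {} \<longrightarrow> edges C \<subseteq> edges H) \<and>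
     s = card {C \<in> cycles G. edges C \<subseteq> edges H}"

text \<open>A missing edge between two vertices of \<open>H\<close> would close a path of
  \<open>H\<close> to a cycle that shares an edge with \<open>H\<close> without lying in
  \<open>H\<close>.\<close>

lemma closed_subgraph_chord:
  assumes H: "closed_subgraph G H s" and xz: "x \<in> verts H" "z \<in> verts H" "x \<noteq> z"
    and e: "{x, z} \<in> edges G"
  shows "{x, z} \<in> edges H"
proof (rule ccontr)
  assume nH: "{x, z} \<notin> edges H"
  have gen: "cactus_gen H s" and sub: "verts H \<subseteq> verts G" "edges H \<subseteq> edges G"
    using H by (auto simp: closed_subgraph_def)
  obtain p where "walk_betw H z p x"
    using cactus_gen_connected[OF gen] xz by (auto elim: connected_walk)
  then obtain P where P: "walk_betw H z P x" "distinct P" by (rule distinct_walk)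
  \<comment> \<open>Since \<open>{x, z}\<close> is assumed not to be an edge of \<open>H\<close>,
    the path does not go from \<open>z\<close> directly to \<open>x\<close>; this provides the third
    vertex of the cycle.\<close>
  then obtain b P' where P': "P = z # b # P'" "{z, b} \<in> edges H" "b \<noteq> x"
  proof -
    obtain P1 where P1: "P = z # P1"
      using P(1) by (cases P) (auto simp: walk_betw_def is_walk_def)
    then obtain b P' where bP: "P1 = b # P'"
      using P(1) xz by (cases P1) (auto simp: walk_betw_def)
    have "{z, b} \<in> edges H" using P(1) P1 bP by (auto simp: walk_betw_def is_walk_def)
    then show ?thesis using that P1 bP nH by (auto simp: insert_commute)
  qed
  have "P' \<noteq> []" using P(1) P'(1,3) by (auto simp: walk_betw_def)
  have lp: "last P = x" "hd P = z" using P(1) by (auto simp: walk_betw_def)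
  have "is_walk G P" using walk_betw_mono[OF P(1) sub] by (simp add: walk_betw_def)
  then have "cycle_seq G P"
    using P(2) P'(1) \<open>P' \<noteq> []\<close> lp e by (cases P') (auto simp: cycle_seq_def)
  then have C: "cycle_subgraph P \<in> cycles G" by (auto simp: cycles_def)
  have "{z, b} \<in> edges (cycle_subgraph P)"
    using cycle_edge_append[of z b "[]" P'] P'(1) by simp
  then have "edges (cycle_subgraph P) \<subseteq> edges H"
    using H C P'(2) unfolding closed_subgraph_def by blast
  moreover have "{x, z} \<in> edges (cycle_subgraph P)"
    using cycle_edge_last[of P] P'(1) lp by auto
  ultimately show False using nH by blast
qed

text \<open>A path outside \<open>H\<close> between distinct vertices of \<open>H\<close>, continued
  inside \<open>H\<close>, is a cycle that shares an edge with \<open>H\<close>. Closedness would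
  put it into \<open>H\<close> completely, including the vertices of \<open>R\<close>.\<close>

lemma closed_subgraph_detour:
  assumes H: "closed_subgraph G H s" and xz: "x \<in> verts H" "z \<in> verts H" "x \<noteq> z"
    and R: "is_walk G R" "distinct R" "set R \<inter> verts H = {}"
    and e: "{x, hd R} \<in> edges G" "{last R, z} \<in> edges G"
  shows False
proof -
  have gen: "cactus_gen H s" and sub: "verts H \<subseteq> verts G" "edges H \<subseteq> edges G"
    using H by (auto simp: closed_subgraph_def)
  obtain p where "walk_betw H z p x"
    using cactus_gen_connected[OF gen] xz by (auto elim: connected_walk)
  then obtain P where P: "walk_betw H z P x" "distinct P" by (rule distinct_walk)
  then obtain b P' where P': "P = z # b # P'" "{z, b} \<in> edges H"
  proof -
    obtain P1 where P1: "P = z # P1"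
      using P(1) by (cases P) (auto simp: walk_betw_def is_walk_def)
    then obtain b P' where bP: "P1 = b # P'"
      using P(1) xz by (cases P1) (auto simp: walk_betw_def)
    have "{z, b} \<in> edges H" using P(1) P1 bP by (auto simp: walk_betw_def is_walk_def)
    then show ?thesis using that P1 bP by auto
  qed
  have lp: "last P = x" "hd P = z" "P \<noteq> []" using P(1) by (auto simp: walk_betw_def is_walk_def)
  have Rne: "R \<noteq> []" using R(1) by (simp add: is_walk_def)
  have PH: "set P \<subseteq> verts H" using P(1) by (auto simp: walk_betw_def is_walk_def)
  have "is_walk G P" using walk_betw_mono[OF P(1) sub] by (simp add: walk_betw_def)
  then have "is_walk G (P @ R)"
    using R(1) e(1) lp Rne by (auto simp: is_walk_def successively_append_iff)
  moreover have "distinct (P @ R)" using P(2) R PH by auto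
  moreover have "3 \<le> length (P @ R)" using P'(1) Rne by (cases R) auto
  moreover have "{last (P @ R), hd (P @ R)} \<in> edges G" using e(2) lp Rne by simp
  ultimately have C: "cycle_subgraph (P @ R) \<in> cycles G" by (auto simp: cycles_def cycle_seq_def)
  have "{z, b} \<in> edges (cycle_subgraph (P @ R))"
    using cycle_edge_append[of z b "[]" "P' @ R"] P'(1) by simp
  then have "edges (cycle_subgraph (P @ R)) \<subseteq> edges H"
    using H C P'(2) unfolding closed_subgraph_def by blast
  moreover have "P @ R = butlast P @ x # hd R # tl R"
    using lp Rne append_butlast_last_id[OF lp(3)] by (metis append.assoc append_Cons append_Nil list.collapse)
  then have "{x, hd R} \<in> edges (cycle_subgraph (P @ R))"
    using cycle_edge_append[of x "hd R" "butlast P" "tl R"] by simp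
  ultimately have "hd R \<in> verts H"
    using simple_edge(2)[OF cactus_gen_simple[OF gen]] by blast
  then show False using R(3) hd_in_set[OF Rne] by auto
qed

text \<open>An edge that leaves \<open>H\<close> is added alone if it lies on no cycle, and
  otherwise together with a cycle \<open>C\<close> through it. A return of \<open>C\<close> to
  \<open>H\<close> would be a detour, so \<open>C\<close> is glued at a single vertex. In a cactus
  no other cycle shares an edge with \<open>C\<close>, so the number of cycles inside grows by
  exactly one.\<close>

lemma closed_subgraph_grow:
  assumes G: "cactus G" and H: "closed_subgraph G H s" and ne: "H \<noteq> G"
  obtains H' s' where "closed_subgraph G H' s'" "card (edges H) < card (edges H')"
proof -
  have gen: "cactus_gen H s" and sub: "verts H \<subseteq> verts G" "edges H \<subseteq> edges G"
    and cl: "\<And>C. C \<in> cycles G \<Longrightarrow> edges C \<inter> edges H \<noteq> {} \<Longrightarrow> edges C \<subseteq> edges H"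
    and s: "s = card {C \<in> cycles G. edges C \<subseteq> edges H}"
    using H by (auto simp: closed_subgraph_def)
  have sG: "simple_graph G" and cG: "connected_graph G"
    and cact: "\<And>C D. C \<in> cycles G \<Longrightarrow> D \<in> cycles G \<Longrightarrow> C \<noteq> D \<Longrightarrow> card (verts C \<inter> verts D) \<le> 1"
    using G by (auto simp: cactus_def)
  have sH: "simple_graph H" using gen by (rule cactus_gen_simple)
  have "verts H \<noteq> {}" using cactus_gen_connected[OF gen] by (simp add: connected_graph_def)
  have "\<exists>x y. x \<in> verts H \<and> {x, y} \<in> edges G \<and> {x, y} \<notin> edges H"
  proof (cases "verts H = verts G")
    case True
    then have "edges H \<noteq> edges G" using ne prod_eqI by blast
    then obtain e where "e \<in> edges G" "e \<notin> edges H" using sub by blast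
    then show ?thesis using True by (metis simple_edgeE[OF sG])
  next
    case False
    then obtain w where w: "w \<in> verts G" "w \<notin> verts H" using sub by blast
    obtain v where v: "v \<in> verts H" using \<open>verts H \<noteq> {}\<close> by blast
    obtain p where "walk_betw G v p w" using cG v w sub by (auto elim: connected_walk)
    then obtain x y where "x \<in> verts H" "y \<notin> verts H" "{x, y} \<in> edges G"
      using v w(2) by (rule walk_crossing)
    then show ?thesis using simple_edge(2)[OF sH] by blast
  qed
  then obtain x y where x: "x \<in> verts H" and e: "{x, y} \<in> edges G" "{x, y} \<notin> edges H" by blast
  have xy: "x \<noteq> y" "y \<in> verts G" using simple_edge[OF sG e(1)] by auto
  have y: "y \<notin> verts H" using closed_subgraph_chord[OF H x _ xy(1) e(1)] e(2) by blast
  have larger: "card (edges H) < card (edges (graph_union H B))" if "{x, y} \<in> edges B" "edges B \<subseteq> edges G" for B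
  proof (rule psubset_card_mono)
    show "finite (edges (graph_union H B))"
      using simple_finite_edges[OF sH] finite_subset[OF that(2) simple_finite_edges[OF sG]] by simp
    show "edges H \<subset> edges (graph_union H B)" using that e(2) by auto
  qed
  show ?thesis
  proof (cases "\<exists>C\<in>cycles G. {x, y} \<in> edges C")
    case False
    let ?B = "edge_graph x y"
    have sub_iff: "edges C \<subseteq> edges (graph_union H ?B) \<longleftrightarrow> edges C \<subseteq> edges H" if "C \<in> cycles G" for C
      using False that by auto
    have "cactus_gen (graph_union H ?B) (s + 0)"
      by (rule cactus_gen.glue[OF gen, of _ _ x]) (use xy x y in \<open>auto simp: block_def\<close>)
    moreover have "edges C \<subseteq> edges (graph_union H ?B)"
      if "C \<in> cycles G" "edges C \<inter> edges (graph_union H ?B) \<noteq> {}" for C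
      using cl[OF that(1)] that False by auto
    moreover have "{C \<in> cycles G. edges C \<subseteq> edges (graph_union H ?B)}
        = {C \<in> cycles G. edges C \<subseteq> edges H}"
      using sub_iff by blast
    ultimately have "closed_subgraph G (graph_union H ?B) s"
      using sub e xy x s unfolding closed_subgraph_def by auto
    then show ?thesis using that larger[of ?B] e by simp
  next
    case True
    then obtain C where C: "C \<in> cycles G" "{x, y} \<in> edges C" by blast
    have "x \<in> verts C"
      using C simple_edge(1) by (metis cyclesE simple_graph_cycle)
    then obtain p where p: "C = cycle_subgraph (x # p)" "distinct (x # p)" "3 \<le> length (x # p)"
      "set (x # p) \<subseteq> verts G" "edges (cycle_subgraph (x # p)) \<subseteq> edges G"
      using cycle_rotate_to[OF C(1)] by blast
    have walk: "is_walk G (x # p)" and "{last (x # p), x} \<in> edges G"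
      using p cycle_seq_iff[of G "x # p"] by (auto simp: cycle_seq_def)
    have pne: "p \<noteq> []" using p(3) by auto
    \<comment> \<open>Cutting such a walk at its first vertex in \<open>H\<close> leaves a nonempty
      detour, because it starts at \<open>y\<close>, outside \<open>H\<close>.\<close>
    have no_return: "set p' \<inter> verts H = {}"
      if p': "is_walk G p'" "distinct p'" "x \<notin> set p'" "hd p' = y" for p'
    proof (rule ccontr)
      assume ret: "set p' \<inter> verts H \<noteq> {}"
      define R where "R = takeWhile (\<lambda>v. v \<notin> verts H) p'"
      have p'ne: "p' \<noteq> []" using p'(1) by (simp add: is_walk_def)
      have "dropWhile (\<lambda>v. v \<notin> verts H) p' \<noteq> []"
        using ret by (auto simp: dropWhile_eq_Nil_conv)
      then obtain z Z where Z: "dropWhile (\<lambda>v. v \<notin> verts H) p' = z # Z"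
        by (meson neq_Nil_conv)
      have z: "z \<in> verts H" using hd_dropWhile[of "\<lambda>v. v \<notin> verts H" p'] Z by simp
      have split: "p' = R @ z # Z"
        using takeWhile_dropWhile_id[of "\<lambda>v. v \<notin> verts H" p'] Z by (simp add: R_def)
      have Rne: "R \<noteq> []" using p'ne y p'(4) by (cases p') (auto simp: R_def)
      have "hd R = y" using p'(4) split Rne by simp
      moreover have "is_walk G R" "{last R, z} \<in> edges G"
        using p'(1) Rne unfolding split by (auto simp: is_walk_def successively_append_iff)
      moreover have "distinct R" using p'(2) split by simp
      moreover have "set R \<inter> verts H = {}" unfolding R_def by (auto dest: set_takeWhileD)
      moreover have "x \<noteq> z" using p'(3) split by auto
      ultimately show False
        using closed_subgraph_detour[OF H x z] e(1) by blast
    qed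
    have "y = hd p \<or> y = last p"
      using C(2)[unfolded p(1)]
    proof (cases rule: edges_cycleE)
      case (1 i)
      have "i = 0"
      proof (rule ccontr)
        assume "i \<noteq> 0"
        then have "(x # p) ! i \<noteq> (x # p) ! 0" "(x # p) ! Suc i \<noteq> (x # p) ! 0"
          using 1(1) p(2) by (metis nth_eq_iff_index_eq Suc_lessD length_greater_0_conv list.discI nat.distinct(1))+
        then show False using 1(2) by (auto simp: doubleton_eq_iff)
      qed
      then show ?thesis using 1 xy pne by (auto simp: doubleton_eq_iff hd_conv_nth)
    next
      case 2
      then show ?thesis using xy pne by (auto simp: doubleton_eq_iff)
    qed
    \<comment> \<open>The cycle without \<open>x\<close> may be traversed in either direction, so it
      can be made to start at \<open>y\<close>.\<close>
    then have disj: "set p \<inter> verts H = {}"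
    proof
      have "is_walk G p" using walk pne by (cases p) (auto simp: is_walk_def)
      then have rp: "is_walk G (rev p)"
        using pne walk_betw_rev[of G "hd p" p "last p"] by (auto simp: walk_betw_def)
      show ?thesis if "y = hd p"
        using no_return[OF \<open>is_walk G p\<close>] p(2) that by auto
      show ?thesis if "y = last p"
        using no_return[OF rp] p(2) that pne by (auto simp: hd_rev)
    qed
    have HC: "verts H \<inter> verts C = {x}" using disj x p(1) by auto
    have bC: "block C 1" using p unfolding block_def by blast
    have EC: "edges C \<subseteq> edges G" using p by simp
    have gen': "cactus_gen (graph_union H C) (s + 1)"
      by (rule cactus_gen.glue[OF gen bC HC])
    have same: "D = C" if D: "D \<in> cycles G" "edges D \<inter> edges C \<noteq> {}" for D
    proof (rule ccontr)
      assume "D \<noteq> C"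
      obtain f where f: "f \<in> edges D" "f \<in> edges C" using D(2) by blast
      obtain q where q: "D = cycle_subgraph q" "distinct q" "3 \<le> length q"
        using D(1) by (rule cyclesE)
      have "simple_graph D" "simple_graph C"
        using q simple_graph_cycle block_simple[OF bC] by auto
      then have "f \<subseteq> verts D \<inter> verts C" "card f = 2" "finite (verts D \<inter> verts C)"
        using f by (auto simp: simple_graph_def)
      then have "2 \<le> card (verts D \<inter> verts C)" by (metis card_mono)
      then show False using cact[OF D(1) C(1) \<open>D \<noteq> C\<close>] by simp
    qed
    have closed: "edges D \<subseteq> edges (graph_union H C)"
      if "D \<in> cycles G" "edges D \<inter> edges (graph_union H C) \<noteq> {}" for D
    proof (cases "edges D \<inter> edges H = {}")
      case True
      then have "edges D \<inter> edges C \<noteq> {}" using that(2) by auto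
      then have "D = C" using same that(1) by blast
      then show ?thesis by simp
    next
      case False
      then show ?thesis using cl[OF that(1)] by auto
    qed
    have "{D \<in> cycles G. edges D \<subseteq> edges (graph_union H C)}
        = insert C {D \<in> cycles G. edges D \<subseteq> edges H}"
    proof (intro equalityI subsetI)
      fix D assume D: "D \<in> {D \<in> cycles G. edges D \<subseteq> edges (graph_union H C)}"
      then have "edges D \<noteq> {}" using cycle_edges_nonempty by blast
      show "D \<in> insert C {D \<in> cycles G. edges D \<subseteq> edges H}"
      proof (cases "edges D \<inter> edges H = {}")
        case True
        then have "D = C" using D \<open>edges D \<noteq> {}\<close> same[of D] by auto
        then show ?thesis by simp
      next
        case False
        then show ?thesis using cl[of D] D by auto
      qed
    qed (use C in auto)
    moreover have "C \<notin> {D \<in> cycles G. edges D \<subseteq> edges H}" using C(2) e(2) by auto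
    moreover have "finite {D \<in> cycles G. edges D \<subseteq> edges H}" using finite_cycles[OF sG] by simp
    ultimately have "s + 1 = card {D \<in> cycles G. edges D \<subseteq> edges (graph_union H C)}"
      using s by simp
    then have "closed_subgraph G (graph_union H C) (s + 1)"
      using gen' sub EC p closed unfolding closed_subgraph_def by auto
    then show ?thesis using that larger[OF C(2) EC] by blast
  qed
qed

text \<open>A single vertex is closed because cycles have edges. Growth ends only at
  \<open>G\<close> since the number of edges is bounded, and there the index counts all
  cycles.\<close>

theorem cactus_imp_gen:
  assumes G: "cactus G"
  shows "cactus_gen G (card (cycles G))"
proof -
  have sG: "simple_graph G" using G by (simp add: cactus_def)
  have whole: "\<exists>t. closed_subgraph G G t" if "closed_subgraph G H s" for H s
    using that
  proof (induction "card (edges G) - card (edges H)" arbitrary: H s rule: less_induct)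
    case less
    show ?case
    proof (cases "H = G")
      case True
      then show ?thesis using less.prems by blast
    next
      case False
      then obtain H' s' where H': "closed_subgraph G H' s'" "card (edges H) < card (edges H')"
        using closed_subgraph_grow[OF G less.prems] by blast
      have "card (edges H') \<le> card (edges G)"
        using H'(1) simple_finite_edges[OF sG] by (auto simp: closed_subgraph_def intro: card_mono)
      then show ?thesis using less.hyps[OF _ H'(1)] H'(2) by simp
    qed
  qed
  obtain v where v: "v \<in> verts G" using G by (auto simp: cactus_def connected_graph_def)
  have "{C \<in> cycles G. edges C = {}} = {}" using cycle_edges_nonempty by blast
  then have "closed_subgraph G ({v}, {}) 0"
    using v cactus_gen.single[of v] by (simp add: closed_subgraph_def del: Collect_empty_eq)
  then obtain t where t: "closed_subgraph G G t" using whole by blast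
  have "{C \<in> cycles G. edges C \<subseteq> edges G} = cycles G" by (auto elim!: cyclesE intro: cyclesI)
  then show ?thesis using t unfolding closed_subgraph_def by metis
qed

section \<open>Isomorphisms and saw graphs\<close>

text \<open>Mapping edges as sets composes better with unions than \<open>graph_iso\<close>.\<close>

definition graph_map :: "('a \<Rightarrow> 'b) \<Rightarrow> 'a ugraph \<Rightarrow> 'b ugraph \<Rightarrow> bool" where
  "graph_map h X Y \<longleftrightarrow> bij_betw h (verts X) (verts Y) \<and> edges Y = (`) h ` edges X"

lemma graph_map_iso:
  assumes X: "simple_graph X" and h: "graph_map h X Y"
  shows "X \<cong>\<^sub>g Y"
proof -
  have bij: "bij_betw h (verts X) (verts Y)" and E: "edges Y = (`) h ` edges X"
    using h by (auto simp: graph_map_def)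
  have inj: "inj_on h (verts X)" using bij by (rule bij_betw_imp_inj_on)
  have "{u, v} \<in> edges X \<longleftrightarrow> {h u, h v} \<in> edges Y" if uv: "u \<in> verts X" "v \<in> verts X" for u v
  proof
    assume "{h u, h v} \<in> edges Y"
    then obtain e where e: "e \<in> edges X" "h ` {u, v} = h ` e" unfolding E by auto
    have "e \<subseteq> verts X" using X e(1) by (auto simp: simple_graph_def)
    then have "{u, v} = e" using inj_on_image_eq_iff[OF inj, of "{u, v}" e] uv e(2) by simp
    then show "{u, v} \<in> edges X" using e(1) by simp
  next
    assume "{u, v} \<in> edges X"
    then show "{h u, h v} \<in> edges Y" unfolding E by (intro image_eqI[of _ _ "{u, v}"]) auto
  qed
  then show ?thesis using bij by (auto simp: graph_iso_def)
qed

lemma graph_iso_sym: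
  assumes "X \<cong>\<^sub>g Y"
  shows "Y \<cong>\<^sub>g X"
proof -
  obtain h where h: "bij_betw h (verts X) (verts Y)"
    and e: "\<And>u v. u \<in> verts X \<Longrightarrow> v \<in> verts X \<Longrightarrow> {u, v} \<in> edges X \<longleftrightarrow> {h u, h v} \<in> edges Y"
    using assms by (auto simp: graph_iso_def)
  let ?g = "inv_into (verts X) h"
  have g: "bij_betw ?g (verts Y) (verts X)" using h by (rule bij_betw_inv_into)
  have hg: "h (?g y) = y" if "y \<in> verts Y" for y
    using bij_betw_inv_into_right[OF h that] .
  have "{u, v} \<in> edges Y \<longleftrightarrow> {?g u, ?g v} \<in> edges X" if "u \<in> verts Y" "v \<in> verts Y" for u v
    using e[of "?g u" "?g v"] bij_betwE[OF g] hg that by simp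
  then show ?thesis using g by (auto simp: graph_iso_def)
qed

lemma walk_betw_map:
  assumes "walk_betw X u p v" "h ` verts X \<subseteq> verts Y"
    "\<And>u v. u \<in> verts X \<Longrightarrow> v \<in> verts X \<Longrightarrow> {u, v} \<in> edges X \<Longrightarrow> {h u, h v} \<in> edges Y"
  shows "walk_betw Y (h u) (map h p) (h v)"
proof -
  have p: "p \<noteq> []" "set p \<subseteq> verts X" "successively (\<lambda>x y. {x, y} \<in> edges X) p" "hd p = u" "last p = v"
    using assms(1) by (auto simp: walk_betw_def is_walk_def)
  have "successively (\<lambda>x y. {h x, h y} \<in> edges Y) p"
    using p(3) by (rule successively_mono) (use p(2) assms(3) in auto)
  then show ?thesis
    using p assms(2) by (auto simp: walk_betw_def is_walk_def successively_map hd_map last_map)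
qed

lemma edge_wiener_iso:
  assumes X: "simple_graph X" and Y: "simple_graph Y" and iso: "X \<cong>\<^sub>g Y"
  shows "edge_wiener X = edge_wiener Y"
proof -
  obtain h where h: "bij_betw h (verts X) (verts Y)"
    and e: "\<And>u v. u \<in> verts X \<Longrightarrow> v \<in> verts X \<Longrightarrow> {u, v} \<in> edges X \<longleftrightarrow> {h u, h v} \<in> edges Y"
    using iso by (auto simp: graph_iso_def)
  let ?g = "inv_into (verts X) h"
  have inj: "inj_on h (verts X)" using h by (rule bij_betw_imp_inj_on)
  have hV: "h ` verts X = verts Y" using h by (rule bij_betw_imp_surj_on)
  have gh: "?g (h x) = x" if "x \<in> verts X" for x using inv_into_f_f[OF inj that] .
  have gV: "?g ` verts Y \<subseteq> verts X" unfolding hV[symmetric] using gh by auto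
  have ge: "{?g u, ?g v} \<in> edges X" if "u \<in> verts Y" "v \<in> verts Y" "{u, v} \<in> edges Y" for u v
    using that e gh unfolding hV[symmetric] by auto
  have d: "gdist Y (h u) (h v) = gdist X u v" if uv: "u \<in> verts X" "v \<in> verts X" for u v
  proof -
    have "(\<exists>p. walk_betw Y (h u) p (h v) \<and> length p = Suc l) \<longleftrightarrow>
        (\<exists>p. walk_betw X u p v \<and> length p = Suc l)" for l
    proof
      assume "\<exists>p. walk_betw Y (h u) p (h v) \<and> length p = Suc l"
      then obtain p where p: "walk_betw Y (h u) p (h v)" "length p = Suc l" by blast
      have "walk_betw X (?g (h u)) (map ?g p) (?g (h v))"
        using p(1) gV ge by (rule walk_betw_map)
      then show "\<exists>p. walk_betw X u p v \<and> length p = Suc l"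
        using p(2) gh uv by (intro exI[of _ "map ?g p"]) simp
    next
      assume "\<exists>p. walk_betw X u p v \<and> length p = Suc l"
      then obtain p where p: "walk_betw X u p v" "length p = Suc l" by blast
      have "walk_betw Y (h u) (map h p) (h v)"
        using p(1) by (rule walk_betw_map) (use hV e in auto)
      then show "\<exists>p. walk_betw Y (h u) p (h v) \<and> length p = Suc l"
        using p(2) by (intro exI[of _ "map h p"]) simp
    qed
    then show ?thesis by (simp add: gdist_def)
  qed
  have sub: "f \<subseteq> verts X" if "f \<in> edges X" for f using X that by (auto simp: simple_graph_def)
  have injE: "inj_on ((`) h) (edges X)"
    using inj_on_image_eq_iff[OF inj] sub by (auto simp: inj_on_def)
  have EY: "edges Y = (`) h ` edges X"
  proof (intro equalityI subsetI)
    fix f assume f: "f \<in> edges Y"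
    then obtain a b where ab: "f = {a, b}" "a \<in> verts Y" "b \<in> verts Y"
      using Y by (auto elim: simple_edgeE)
    then obtain u v where uv: "a = h u" "b = h v" "u \<in> verts X" "v \<in> verts X"
      unfolding hV[symmetric] by auto
    then have "{u, v} \<in> edges X" using e f ab by auto
    then show "f \<in> (`) h ` edges X" using ab uv by (intro image_eqI[of _ _ "{u, v}"]) auto
  next
    fix f assume "f \<in> (`) h ` edges X"
    then obtain f' where f': "f' \<in> edges X" "f = h ` f'" by auto
    then obtain u v where "f' = {u, v}" "u \<in> verts X" "v \<in> verts X"
      using X by (auto elim: simple_edgeE)
    then show "f \<in> edges Y" using f' e by auto
  qed
  have ed: "edge_dist Y (h ` f) (h ` g) = edge_dist X f g" if fg: "f \<in> edges X" "g \<in> edges X" for f g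
  proof -
    have "{gdist Y u v |u v. u \<in> h ` f \<and> v \<in> h ` g} = {gdist X u v |u v. u \<in> f \<and> v \<in> g}"
      using d sub[OF fg(1)] sub[OF fg(2)] by (auto, metis subsetD, metis imageI subsetD)
    moreover have "h ` f = h ` g \<longleftrightarrow> f = g"
      using inj_on_image_eq_iff[OF inj] sub fg by blast
    ultimately show ?thesis by (simp add: edge_dist_def)
  qed
  have "2 * edge_wiener Y = (\<Sum>f\<in>edges X. \<Sum>g\<in>edges X. edge_dist Y (h ` f) (h ` g))"
    unfolding edge_wiener_double_sum[OF simple_finite_edges[OF Y]] EY sum.reindex[OF injE] by simp
  also have "\<dots> = (\<Sum>f\<in>edges X. \<Sum>g\<in>edges X. edge_dist X f g)"
    using ed by (intro sum.cong refl) auto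
  also have "\<dots> = 2 * edge_wiener X"
    using edge_wiener_double_sum[OF simple_finite_edges[OF X]] by simp
  finally show ?thesis by simp
qed

lemma link_map:
  assumes "link s B u v" "link s B' u' v'"
  obtains g where "graph_map g B B'" "g u = u'" "g v = v'"
  using assms(1)
proof (cases rule: linkE)
  case 1
  then have B': "u' \<noteq> v'" "B' = edge_graph u' v'" using assms(2) by (auto simp: link_def)
  show ?thesis
    by (rule that[of "\<lambda>x. if x = u then u' else v'"])
       (use 1 B' in \<open>auto simp: graph_map_def bij_betw_def inj_on_def\<close>)
next
  case (2 z)
  then obtain z' where B': "distinct [u', v', z']" "B' = triangle_graph u' v' z'"
    using assms(2) by (auto simp: link_def)
  show ?thesis
    by (rule that[of "\<lambda>x. if x = u then u' else if x = v then v' else z'"])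
       (use 2 B' in \<open>auto simp: graph_map_def bij_betw_def inj_on_def\<close>)
qed

text \<open>Isomorphisms of the blocks that match the attachment vertices are glued together. The
  result is injective because the images of the two parts meet only in the image of the common
  vertex.\<close>

lemma chain_graph_unique:
  assumes "chain_graph X u S w" "chain_graph Y u' S w'"
  shows "\<exists>h. graph_map h X Y \<and> h u = u'"
  using assms
proof (induction arbitrary: Y u' rule: chain_graph.induct)
  case (Nil u)
  then have "Y = ({u'}, {})" by (simp add: chain_graph_Nil_iff)
  then show ?case by (intro exI[of _ "\<lambda>_. u'"]) (auto simp: graph_map_def bij_betw_def)
next
  case (Cons s B u v X S w)
  from Cons.prems obtain B' v' Y' where Y: "Y = graph_union B' Y'" "link s B' u' v'"
    "chain_graph Y' v' S w'" "verts B' \<inter> verts Y' = {v'}"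
    by (auto elim: chain_graph.cases)
  obtain h where h: "graph_map h X Y'" "h v = v'" using Cons.IH[OF Y(3)] by blast
  obtain g where g: "graph_map g B B'" "g u = u'" "g v = v'"
    using Cons.hyps(1) Y(2) by (rule link_map)
  define f where "f x = (if x \<in> verts X then h x else g x)" for x
  have fX: "f x = h x" if "x \<in> verts X" for x using that by (simp add: f_def)
  have fB: "f x = g x" if "x \<in> verts B" for x
  proof (cases "x \<in> verts X")
    case True
    then have "x = v" using Cons.hyps(3) that by auto
    then show ?thesis using h g by (simp add: f_def)
  qed (simp add: f_def)
  have bX: "bij_betw f (verts X) (verts Y')"
    using h(1) bij_betw_cong[of "verts X" f h] fX by (simp add: graph_map_def)
  have bB: "bij_betw f (verts B) (verts B')"
    using g(1) bij_betw_cong[of "verts B" f g] fB by (simp add: graph_map_def)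
  have v: "v \<in> verts B" "v \<in> verts X" using Cons.hyps(3) by auto
  have "inj_on f (verts B \<union> verts X)"
  proof (rule inj_onI)
    fix a b assume ab: "a \<in> verts B \<union> verts X" "b \<in> verts B \<union> verts X" "f a = f b"
    have cross: "x = y" if xy: "x \<in> verts B" "y \<in> verts X" "f x = f y" for x y
    proof -
      have "f x \<in> verts B'" using bij_betwE[OF bB] xy(1) by blast
      moreover have "f x \<in> verts Y'" using bij_betwE[OF bX] xy(2,3) by simp
      ultimately have "f x \<in> verts B' \<inter> verts Y'" by blast
      then have "f x = f v" using Y(4) fX[OF v(2)] h(2) by auto
      then show ?thesis
        using xy v bB bX by (metis bij_betw_imp_inj_on inj_onD)
    qed
    show "a = b"
      using ab cross[of a b] cross[of b a] bij_betw_imp_inj_on[OF bB] bij_betw_imp_inj_on[OF bX]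
      by (auto dest: inj_onD)
  qed
  then have bij: "bij_betw f (verts (graph_union B X)) (verts Y)"
    using bX bB unfolding Y(1) by (auto simp: bij_betw_def)
  have "(`) f ` edges X = edges Y'"
  proof -
    have "f ` e = h ` e" if "e \<in> edges X" for e
      using chain_graph_simple[OF Cons.hyps(2)] that fX by (force simp: simple_graph_def)
    then show ?thesis using h(1) by (auto simp: graph_map_def)
  qed
  moreover have "(`) f ` edges B = edges B'"
  proof -
    have "f ` e = g ` e" if "e \<in> edges B" for e
      using link_simple[OF Cons.hyps(1)] that fB by (force simp: simple_graph_def)
    then show ?thesis using g(1) by (auto simp: graph_map_def)
  qed
  ultimately have "graph_map f (graph_union B X) Y"
    using bij by (simp add: graph_map_def Y(1) image_Un)
  moreover have "f u = u'" using fB link_verts[OF Cons.hyps(1)] g by auto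
  ultimately show ?case by blast
qed

section \<open>Saw graphs as chains\<close>

lemma chain_graph_triangle_chain:
  "chain_graph (triangle_chain a i) a (replicate i True) (a + 2 * i)"
proof (induction i)
  case 0
  then show ?case by (simp add: triangle_chain_def chain_graph_Nil_iff)
next
  case (Suc i)
  let ?B = "triangle_graph (a + 2 * i) (a + 2 * Suc i) (a + 2 * i + 1)"
  have "link True ?B (a + 2 * i) (a + 2 * Suc i)"
    unfolding link_def if_True by (rule exI[of _ "a + 2 * i + 1"]) simp
  then have "chain_graph ?B (a + 2 * i) [True] (a + 2 * Suc i)"
    by (rule chain_graph_single)
  moreover have "verts (triangle_chain a i) \<inter> verts ?B = {a + 2 * i}"
    by (auto simp: triangle_chain_def)
  ultimately have "chain_graph (graph_union (triangle_chain a i) ?B) a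
      (replicate i True @ [True]) (a + 2 * Suc i)"
    by (rule chain_graph_append[OF Suc])
  moreover have "graph_union (triangle_chain a i) ?B = triangle_chain a (Suc i)"
    by (intro prod_eqI) (auto simp: triangle_chain_def lessThan_Suc insert_commute)
  ultimately show ?case by (simp add: replicate_append_same)
qed

lemma chain_graph_path_graph:
  "chain_graph (path_graph a l) a (replicate l False) (a + l)"
proof (induction l)
  case 0
  then show ?case by (simp add: path_graph_def chain_graph_Nil_iff)
next
  case (Suc l)
  let ?B = "edge_graph (a + l) (a + Suc l)"
  have "chain_graph ?B (a + l) [False] (a + Suc l)"
    by (rule chain_graph_single) (auto simp: link_def)
  moreover have "verts (path_graph a l) \<inter> verts ?B = {a + l}"
    by (auto simp: path_graph_def)
  ultimately have "chain_graph (graph_union (path_graph a l) ?B) a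
      (replicate l False @ [False]) (a + Suc l)"
    by (rule chain_graph_append[OF Suc])
  moreover have "graph_union (path_graph a l) ?B = path_graph a (Suc l)"
    by (intro prod_eqI) (auto simp: path_graph_def less_Suc_eq)
  ultimately show ?case by (simp add: replicate_append_same)
qed

lemma chain_graph_saw: "\<exists>w. chain_graph (saw i j l) 0 (saw_chain i j l) w"
proof -
  have 1: "chain_graph (graph_union (path_graph (2 * i) l) (triangle_chain (2 * i + l) j)) (2 * i)
      (replicate l False @ replicate j True) (2 * i + l + 2 * j)"
    by (rule chain_graph_append[OF chain_graph_path_graph chain_graph_triangle_chain])
       (auto simp: path_graph_def triangle_chain_def)
  have 2: "chain_graph (triangle_chain 0 i) 0 (replicate i True) (2 * i)"
    using chain_graph_triangle_chain[of 0 i] by simp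
  show ?thesis
    unfolding saw_def saw_chain_def
    by (rule exI, rule chain_graph_append[OF 2 1])
       (auto simp: path_graph_def triangle_chain_def)
qed

section \<open>Edge-Wiener indices of the extremal graphs\<close>

lemma edge_wiener_real:
  assumes "simple_graph G" "wsum G (\<lambda>_. 0) = 2 * v" "card (edges G) = m"
  shows "real (edge_wiener G) = real v + real m * (real m - 1) / 2"
proof -
  have "real (2 * edge_wiener G + m) = real (2 * v + m * m)"
    using edge_wiener_wsum[OF assms(1)] assms(2,3) by simp
  then show ?thesis by (simp add: field_simps)
qed

lemma edge_wiener_saw:
  "real (edge_wiener (saw i j l)) = real (cval 0 (saw_chain i j l) 0)
     + real (3 * i + 3 * j + l) * (real (3 * i + 3 * j + l) - 1) / 2"
proof -
  obtain w where w: "chain_graph (saw i j l) 0 (saw_chain i j l) w"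
    using chain_graph_saw by blast
  show ?thesis
  proof (rule edge_wiener_real[OF chain_graph_simple[OF w]])
    show "wsum (saw i j l) (\<lambda>_. 0) = 2 * cval 0 (saw_chain i j l) 0"
      using wsum_chain_graph[OF w, of 0] by (simp add: fun_upd_def)
    show "card (edges (saw i j l)) = 3 * i + 3 * j + l"
      using chain_graph_card_edges[OF w] by simp
  qed
qed

lemma cycle_graph_iso:
  assumes "distinct q" "3 \<le> length q"
  shows "cycle_subgraph q \<cong>\<^sub>g cycle_graph (length q)"
proof -
  let ?n = "length q"
  have "cycle_edge q i = (!) q ` cycle_edge [0..<?n] i" if "i < ?n" for i
  proof -
    have "Suc i mod ?n < ?n" using that by (intro mod_less_divisor) linarith
    then show ?thesis using that by (simp add: cycle_edge_def)
  qed
  then have "edges (cycle_subgraph q) = (`) ((!) q) ` edges (cycle_graph ?n)"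
    by (auto simp: cycle_graph_def edges_cycle_subgraph)
  moreover have "bij_betw ((!) q) (verts (cycle_graph ?n)) (verts (cycle_subgraph q))"
    using bij_betw_nth[OF assms(1) refl refl] by (simp add: cycle_graph_def atLeast0LessThan)
  ultimately have "graph_map ((!) q) (cycle_graph ?n) (cycle_subgraph q)"
    by (simp add: graph_map_def)
  moreover have "simple_graph (cycle_graph ?n)"
    unfolding cycle_graph_def using assms(2) by (intro simple_graph_cycle) auto
  ultimately show ?thesis by (metis graph_iso_sym graph_map_iso)
qed

text \<open>Each edge has distance sum at most \<open>gapsum 4 = 2\<close>, so \<open>wsum\<close>
  is at most 10. The 10 ordered pairs of disjoint edges contribute at least 1 each. Hence twice the
  index plus 5 is \<open>10 + 25\<close>.\<close>

lemma edge_wiener_cycle_5: "edge_wiener (cycle_graph 5) = 15"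
proof -
  define q :: "nat list" where "q = [0, 1, 2, 3, 4]"
  have C: "cycle_graph 5 = cycle_subgraph q"
    by (simp add: cycle_graph_def q_def numeral_eq_Suc)
  have q: "distinct q" "3 \<le> length q" by (simp_all add: q_def)
  let ?C = "cycle_subgraph q"
  note sC = simple_graph_cycle[OF q] and cC = connected_cycle[OF q]
  have E: "edges ?C = {{0, 1}, {1, 2}, {2, 3}, {3, 4}, {4, 0}}"
  proof -
    have "{..<length q} = {0, 1, 2, 3, 4}" by (auto simp: q_def)
    then show ?thesis by (simp add: edges_cycle_subgraph cycle_edge_def) (simp add: q_def)
  qed
  have card: "card (edges ?C) = 5" using card_edges_cycle[OF q] by (simp add: q_def)
  have "gapsum 4 = 2" by (simp add: gapsum_def numeral_eq_Suc)
  moreover have "length q - 1 = 4" by (simp add: q_def)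
  ultimately have upper: "(\<Sum>e'\<in>edges ?C. sdist ?C e e') \<le> 2" if e: "e \<in> edges ?C" for e
  proof -
    obtain i where "i < length q" "e = cycle_edge q i" using e by (auto simp: edges_cycle_subgraph)
    then show ?thesis
      using edge_edges_cycle[OF q, of i] \<open>length q - 1 = 4\<close> \<open>gapsum 4 = 2\<close> by simp
  qed
  have "wsum ?C (\<lambda>_. 0) = (\<Sum>e\<in>edges ?C. \<Sum>e'\<in>edges ?C. sdist ?C e e')"
    by (simp add: wsum_expand[OF sC])
  also have "\<dots> \<le> (\<Sum>e\<in>edges ?C. 2)"
    using upper by (rule sum_mono)
  finally have le: "wsum ?C (\<lambda>_. 0) \<le> 10" by (simp add: card)
  have pos: "(if e \<inter> e' = {} then 1 else 0) \<le> sdist ?C e e'"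
    if ee: "e \<in> edges ?C" "e' \<in> edges ?C" for e e'
  proof (cases "e \<inter> e' = {}")
    case True
    obtain u v where uv: "u \<in> e" "v \<in> e'" "sdist ?C e e' = gdist ?C u v"
      by (rule sdist_attained[of e e' ?C]) (use ee in \<open>auto simp: E\<close>)
    moreover have "u \<in> verts ?C" "v \<in> verts ?C"
      using uv ee sC unfolding simple_graph_def by blast+
    moreover have "u \<noteq> v" using True uv by blast
    ultimately have "0 < gdist ?C u v" using gdist_pos[OF cC, of u v] by blast
    then show ?thesis using True uv(3) by simp
  qed simp
  have "(10 :: nat) = (\<Sum>e\<in>edges ?C. \<Sum>e'\<in>edges ?C. if e \<inter> e' = {} then 1 else 0)"
    unfolding E by (simp add: doubleton_eq_iff)
  also have "\<dots> \<le> (\<Sum>e\<in>edges ?C. \<Sum>e'\<in>edges ?C. sdist ?C e e')"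
    using pos by (intro sum_mono) auto
  finally have "wsum ?C (\<lambda>_. 0) = 10"
    using le by (simp add: wsum_expand[OF sC])
  then show ?thesis using edge_wiener_wsum[OF sC] card by (simp add: C)
qed

lemma chain_graph_iso_saw:
  assumes "chain_graph G u S w" "S = saw_chain i j l \<or> S = rev (saw_chain i j l)"
  shows "G \<cong>\<^sub>g saw i j l"
proof -
  have "\<exists>u w. chain_graph G u (saw_chain i j l) w"
    using assms chain_graph_rev[OF assms(1)] by (elim disjE) (auto simp del: saw_chain_simps)
  then obtain u w where G: "chain_graph G u (saw_chain i j l) w" by blast
  obtain w' where "chain_graph (saw i j l) 0 (saw_chain i j l) w'" using chain_graph_saw by blast
  from chain_graph_unique[OF G this] show ?thesis
    using graph_map_iso[OF chain_graph_simple[OF G]] by blast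
qed

text \<open>\<open>G\<close> and the saw have equally many edges, so only \<open>wsum\<close> is
  compared. Equality requires both that replacing \<open>G\<close> by the list \<open>T\<close>
  loses nothing and that \<open>T\<close> is an optimal chain; the realization of \<open>T\<close>
  then identifies \<open>G\<close>, apart from the pentagon.\<close>

lemma edge_wiener_cactus:
  assumes G: "cactus G" and n: "5 \<le> card (verts G)"
    and t: "card (cycles G) = k + k'" "k \<le> k'" "k' \<le> Suc k"
  defines "S \<equiv> saw k k' (card (verts G) - 2 * (k + k') - 1)"
  shows "2 * (k + k') + 1 \<le> card (verts G)"
    and "edge_wiener G \<le> edge_wiener S"
    and "edge_wiener G = edge_wiener S \<longleftrightarrow> G \<cong>\<^sub>g S \<or> (k + k' = 1 \<and> G \<cong>\<^sub>g cycle_graph 5)"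
proof -
  define l where "l = card (verts G) - 2 * (k + k') - 1"
  have gen: "cactus_gen G (k + k')" using cactus_imp_gen[OF G] t(1) by simp
  have sG: "simple_graph G" using gen by (rule cactus_gen_simple)
  have c: "card (edges G) + 1 = card (verts G) + (k + k')" "2 * (k + k') + 1 \<le> card (verts G)"
    using cactus_gen_card[OF gen] by auto
  show "2 * (k + k') + 1 \<le> card (verts G)" by (rule c(2))
  have S: "S = saw k k' l" by (simp add: S_def l_def)
  have m: "card (edges G) = 3 * (k + k') + l" proof -
    have "card (verts G) = 2 * (k + k') + 1 + l" using c(2) by (simp add: l_def)
    then show ?thesis using c(1) by simp
  qed
  \<comment> \<open>With at least one cycle there are at least as many edges as vertices.\<close>
  have "k + k' = 0 \<or> 5 \<le> card (edges G)" using n c by linarith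
  then obtain T where T: "ntri T = k + k'" "csize T = card (edges G)"
    "wsum G (\<lambda>_. 0) \<le> 2 * cval 0 T 0"
    "wsum G (\<lambda>_. 0) = 2 * cval 0 T 0 \<Longrightarrow> five_cycle G \<or> (\<exists>u w. chain_graph G u T w)"
  proof (rule cactus_gen_bound[OF gen], goal_cases)
    case (1 T)
    then show ?thesis by (intro that[of T]) blast+
  qed
  let ?V = "cval 0 (saw_chain k k' l) 0"
  have T': "csize T = 3 * (k + k') + l" using T(2) m by simp
  have WG: "2 * edge_wiener G + card (edges G) = wsum G (\<lambda>_. 0) + card (edges G) * card (edges G)"
    by (rule edge_wiener_wsum[OF sG])
  have "real (2 * edge_wiener S + card (edges G)) = real (2 * ?V + card (edges G) * card (edges G))"
    unfolding S m by (simp add: edge_wiener_saw field_simps)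
  then have WS: "2 * edge_wiener S + card (edges G) = 2 * ?V + card (edges G) * card (edges G)"
    by linarith
  have V: "cval 0 T 0 \<le> ?V" by (rule cval_le_saw_chain(1)[OF T(1) T' t(2,3)])
  show "edge_wiener G \<le> edge_wiener S" using V T(3) WG WS by linarith
  show "edge_wiener G = edge_wiener S \<longleftrightarrow> G \<cong>\<^sub>g S \<or> (k + k' = 1 \<and> G \<cong>\<^sub>g cycle_graph 5)"
  proof
    assume "edge_wiener G = edge_wiener S"
    then have eq: "wsum G (\<lambda>_. 0) = 2 * cval 0 T 0" "cval 0 T 0 = ?V"
      using V T(3) WG WS by linarith+
    have form: "T = saw_chain k k' l \<or> T = rev (saw_chain k k' l)"
      by (rule cval_le_saw_chain(2)[OF T(1) T' t(2,3) eq(2)])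
    from T(4)[OF eq(1)] show "G \<cong>\<^sub>g S \<or> (k + k' = 1 \<and> G \<cong>\<^sub>g cycle_graph 5)"
    proof
      assume "five_cycle G"
      then obtain q where q: "distinct q" "length q = 5" "G = cycle_subgraph q"
        by (auto simp: five_cycle_def)
      have "card (verts G) = 5" "card (edges G) = 5"
        using q card_edges_cycle[of q] distinct_card[of q] by simp_all
      then have "k + k' = 1" using c by linarith
      then show ?thesis using cycle_graph_iso[of q] q by simp
    next
      assume "\<exists>u w. chain_graph G u T w"
      then obtain u w where "chain_graph G u T w" by blast
      then have "G \<cong>\<^sub>g S" unfolding S using form by (rule chain_graph_iso_saw)
      then show ?thesis ..
    qed
  next
    assume "G \<cong>\<^sub>g S \<or> (k + k' = 1 \<and> G \<cong>\<^sub>g cycle_graph 5)"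
    then show "edge_wiener G = edge_wiener S"
    proof
      assume "G \<cong>\<^sub>g S"
      then show ?thesis by (intro edge_wiener_iso sG) (simp add: S simple_graph_saw)
    next
      assume iso: "k + k' = 1 \<and> G \<cong>\<^sub>g cycle_graph 5"
      have "simple_graph (cycle_graph 5)"
        unfolding cycle_graph_def by (rule simple_graph_cycle) auto
      then have W: "edge_wiener G = 15"
        using edge_wiener_iso[OF sG _ conjunct2[OF iso]] edge_wiener_cycle_5 by simp
      obtain h where "bij_betw h (verts G) (verts (cycle_graph 5))"
        using iso by (auto simp: graph_iso_def)
      then have "card (verts G) = 5" by (simp add: bij_betw_same_card cycle_graph_def)
      then have l: "l = 2" using iso by (simp add: l_def)
      have "k = 0" "k' = 1" using iso t by linarith+
      then have "real (edge_wiener S) = 15"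
        unfolding S l by (simp add: edge_wiener_saw saw_chain_def numeral_eq_Suc)
      then show ?thesis using W by simp
    qed
  qed
qed

theorem theorem2:
  fixes G :: "'a ugraph" and n t k :: nat
  assumes "n \<ge> 5"
    and "cactus G"
    and "card (verts G) = n"
    and "card (cycles G) = t"
  shows
    "(t = 2 * k \<longrightarrow>
        (let B = 1 / 6 * real n ^ 3 - 1 / 2 * real n ^ 2 + 1 / 3 * real n + real k * real n ^ 2
               - 4 * real k ^ 2 * real n + 4 / 3 * real k ^ 3 + 8 * real k ^ 2 - 10 / 3 * real k
         in real (edge_wiener G) \<le> B \<and>
            (real (edge_wiener G) = B \<longleftrightarrow> G \<cong>\<^sub>g saw k k (n - 4 * k - 1))))
     \<and>
     (t = 2 * k + 1 \<longrightarrow>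
        (let B = 1 / 6 * real n ^ 3 - 13 / 6 * real n + real k * real n ^ 2
               - 4 * real k ^ 2 * real n - 4 * real k * real n
               + 4 / 3 * real k ^ 3 + 10 * real k ^ 2 + 35 / 3 * real k + 5
         in real (edge_wiener G) \<le> B \<and>
            (real (edge_wiener G) = B \<longleftrightarrow>
               G \<cong>\<^sub>g saw k (k + 1) (n - 4 * k - 3) \<or> G \<cong>\<^sub>g cycle_graph 5)))"
proof (intro conjI impI)
  assume t: "t = 2 * k"
  have "card (cycles G) = k + k" using assms t by simp
  note * = edge_wiener_cactus[OF assms(2) _ this, unfolded assms(3), OF assms(1)]
  let ?l = "n - 4 * k - 1"
  have odd: "k + k \<noteq> 1" by presburger
  have l: "n - 2 * (k + k) - 1 = ?l" by simp
  \<comment> \<open>The bound \<open>2 * t + 1 \<le> n\<close> for generated cacti makes the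
    truncated difference exact.\<close>
  have n: "real n = real ?l + 4 * real k + 1" using *(1) by simp
  have B: "real (edge_wiener (saw k k ?l)) = 1 / 6 * real n ^ 3 - 1 / 2 * real n ^ 2 + 1 / 3 * real n
      + real k * real n ^ 2 - 4 * real k ^ 2 * real n + 4 / 3 * real k ^ 3 + 8 * real k ^ 2
      - 10 / 3 * real k"
    unfolding edge_wiener_saw cval_saw_chain cval_replicate_True cval_replicate_False n
    by (simp add: field_simps power2_eq_square power3_eq_cube)
  show "let B = 1 / 6 * real n ^ 3 - 1 / 2 * real n ^ 2 + 1 / 3 * real n + real k * real n ^ 2
               - 4 * real k ^ 2 * real n + 4 / 3 * real k ^ 3 + 8 * real k ^ 2 - 10 / 3 * real k
         in real (edge_wiener G) \<le> B \<and>
            (real (edge_wiener G) = B \<longleftrightarrow> G \<cong>\<^sub>g saw k k ?l)"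
    unfolding B[symmetric] Let_def of_nat_le_iff of_nat_eq_iff
    using *(2,3) odd unfolding l by auto
next
  assume t: "t = 2 * k + 1"
  have "card (cycles G) = k + (k + 1)" using assms t by simp
  note * = edge_wiener_cactus[OF assms(2) _ this, unfolded assms(3), OF assms(1)]
  let ?l = "n - 4 * k - 3"
  have l: "n - 2 * (k + (k + 1)) - 1 = ?l" by simp
  have n: "real n = real ?l + 4 * real k + 3" using *(1) by simp
  have B: "real (edge_wiener (saw k (k + 1) ?l)) = 1 / 6 * real n ^ 3 - 13 / 6 * real n
      + real k * real n ^ 2 - 4 * real k ^ 2 * real n - 4 * real k * real n
      + 4 / 3 * real k ^ 3 + 10 * real k ^ 2 + 35 / 3 * real k + 5"
    unfolding edge_wiener_saw cval_saw_chain cval_replicate_True cval_replicate_False n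
    by (simp add: field_simps power2_eq_square power3_eq_cube)
  \<comment> \<open>For five vertices \<open>2 * t + 1 \<le> n\<close> leaves only
    \<open>k = 0\<close>. Hence the pentagon alternative can be stated without a condition on
    \<open>k\<close>.\<close>
  have "k + (k + 1) = 1" if iso: "G \<cong>\<^sub>g cycle_graph 5"
  proof -
    obtain h where "bij_betw h (verts G) (verts (cycle_graph 5))"
      using iso by (auto simp: graph_iso_def)
    then have "n = 5" using assms(3) by (simp add: bij_betw_same_card cycle_graph_def)
    then show ?thesis using *(1) by simp
  qed
  then show "let B = 1 / 6 * real n ^ 3 - 13 / 6 * real n + real k * real n ^ 2
               - 4 * real k ^ 2 * real n - 4 * real k * real n
               + 4 / 3 * real k ^ 3 + 10 * real k ^ 2 + 35 / 3 * real k + 5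
         in real (edge_wiener G) \<le> B \<and>
            (real (edge_wiener G) = B \<longleftrightarrow>
               G \<cong>\<^sub>g saw k (k + 1) ?l \<or> G \<cong>\<^sub>g cycle_graph 5)"
    unfolding B[symmetric] Let_def of_nat_le_iff of_nat_eq_iff
    using *(2,3) unfolding l by auto
qed

end
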